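(* Let $X$ be a pointed metric subspace of a normed real vector space $E$ and let $\varepsilon>0$. (a) If $X$ is $t_\varepsilon^-$-closed in $E$, there is a canonical isomorphism $\Psi_1^-:\pi_1(t_\varepsilon^-X)\to\pi_1(D_\varepsilon^-X)$ from the combinatorial fundamental group to the topological fundamental group, namely the composite $$\Psi_1^-=\pi_1(f_\varepsilon^-)\circ\Phi_1=\bigl(\pi_1(t_\varepsilon^-X)\to\pi_1(\mathcal{S}(t_\varepsilon^-X))\to\pi_1(D_\varepsilon^-X)\bigr)$$ of the geometric realisation isomorphism $\Phi_1$ with the isomorphism $\pi_1(f_\varepsilon^-)$ induced by the simplexwise affine map $f_\varepsilon^-:\mathcal{S}(t_\varepsilon^-X)\to D_\varepsilon^-X$. (b) If $X$ is also $t_\varepsilon$-closed in $E$, there is a canonical isomorphism $\Psi_1=\pi_1(f_\varepsilon)\circ\Phi_1:\pi_1(t_\varepsilon X)\to\pi_1(D_\varepsilon^-X)$, consisting of the lower row of the following commutative diagram, all of whose arrows are isomorphisms: $$\begin{array}{ccccc}\pi_1(t_\varepsilon^-X)&\xrightarrow{\ \Phi_1\ }&\pi_1(\mathcal{S}(t_\varepsilon^-X))&\xrightarrow{\ \pi_1(f_\varepsilon^-)\ }&\pi_1(D_\varepsilon^-X)\\ \downarrow&&\downarrow&&\|\\ \pi_1(t_\varepsilon X)&\xrightarrow{\ \Phi_1\ }&\pi_1(\mathcal{S}(t_\varepsilon X))&\xrightarrow{\ \pi_1(f_\varepsilon)\ }&\pi_1(D_\varepsilon^-X)\end{array}$$ where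 the first two vertical arrows are induced by the identity of the set $X$, regarded as a map of simplicial complexes $t_\varepsilon^-X\to t_\varepsilon X$. In (a) and in (b) the similar conclusions hold with $\pi_0$ in place of $\pi_1$ (with isomorphisms of pointed sets).
   Context: **Simplicial complexes.** A simplicial complex is a set $Y$ equipped with a family $!Y$ of finite subsets (the linked parts) containing $\emptyset$ and all singletons and closed under taking subsets. A map is a mapping sending linked parts to linked parts. A finite subset of a product is linked iff all its projections are linked. $\mathbf{Z}$ is the set of integers whose linked parts are $\emptyset$, the singletons and the pairs $\{i,i+1\}$; $\mathbf{Z}^2$ has the product structure. **Combinatorial $\pi_0$ and $\pi_1$.** For a pointed simplicial complex $(Y,* )$, $\pi_0(Y)$ is the quotient of $Y$ by the equivalence relation generated by $y\,!\,y'$ iff $\{y,y'\}$ is linked. A loop is a map $a:\mathbf{Z}\to Y$ with $a(i)=*$ for $i\le\rho^-$ and for $i\ge\rho^+$, for some integers $\rho^-\le\rho^+$; $[\rho^-,\rho^+]$ is called a support, and the least one (or $[0,0]$ if $a$ is constant) is written $[\rho^-(a),\rho^+(a)]$. Two loops $a,b$ are equivalent if there is a map $A:\mathbf{Z}^2\to Y$ and integers $\rho^-\le\rho^+$, $\sigma^-\le\sigma^+$ with $A(i,j)=*$ for $i\le\rho^-$ or $i\ge\rho^+$, $A(i,j)=a(i)$ for $j\le\sigma^-$, $A(i,j)=b(i)$ for $j\ge\sigma^+$. $\pi_1(Y)$ is the set of equivalence classes, a group under $[a]+[b]=[a+b]$, where $(a+b)(i)=a(i-\rho^-(b))$ for $i\le\rho^+(a)+\rho^-(b)$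 and $(a+b)(i)=b(i-\rho^+(a))$ for $i\ge\rho^+(a)+\rho^-(b)$. **Geometric realisation.** $\mathcal{S}Y$ is the set of functions $\lambda:Y\to[0,1]$ with linked support and $\sum_y\lambda(y)=1$, with the direct limit topology of its simplices $\Delta(\xi)=\{\lambda\mid\mathrm{supp}(\lambda)\subset\xi\}$ ($\xi$ non-empty linked, $\Delta(\xi)$ with the euclidean topology); $y\in Y$ is identified with its characteristic function. $\Phi_1:\pi_1(Y)\to\pi_1(\mathcal{S}Y)$ sends the class of a combinatorial loop $a:\mathbf{Z}\to Y$ to the class of its extension $\hat a:\mathbf{R}\to\mathcal{S}Y$, affine on each interval $[i,i+1]$ (eventually constant at the left and the right, and so regarded as a topological loop on a compact interval); similarly $\Phi_0:\pi_0(Y)\to\pi_0(\mathcal{S}Y)$ (path components) is induced by the inclusion $Y\subset\mathcal{S}Y$. **Metric structures.** For a metric space $(X,d)$ and $\varepsilon>0$, $t_\varepsilon X$ (resp. $t_\varepsilon^-X$) is the simplicial complex on the set $X$ in which a finite subset is linked iff $d(x,x')\le\varepsilon$ (resp. $d(x,x')<\varepsilon$) for all its elements $x,x'$. **Spot dilation.** For $X\subset E$, with $d$ the metric of the norm, $D_\varepsilon^-X=\{x'\in E\mid d(x,x')<\varepsilon/2\text{ for some }x\in X\}$, a topological subspace of $E$ with the base point of $X$. $X$ is $t_\varepsilon^-$-closed (resp. $t_\varepsilon$-closed) in $E$ if $D_\varepsilon^-X$ contains the convex envelope (in $E$) of every linked subset of $t_\varepsilon^-X$ (resp. $t_\varepsilon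 X$). Then $f_\varepsilon^-:\mathcal{S}(t_\varepsilon^-X)\to D_\varepsilon^-X$ (resp. $f_\varepsilon:\mathcal{S}(t_\varepsilon X)\to D_\varepsilon^-X$) denotes the continuous mapping which extends the identity of $X$ and is affine on each simplex $\Delta(\xi)$, i.e. $\lambda\mapsto\sum_x\lambda(x)\,x$. *)

theory Defs
  imports "HOL-Analysis.Analysis" "HOL-Algebra.Group"
begin

section \<open>Simplicial complexes\<close>

record 'a complex_on =
  points :: "'a set"
  linked :: "'a set set"

definition linkage_complex :: "'a complex_on \<Rightarrow> bool" where
  "linkage_complex K \<longleftrightarrow>
     (\<forall>\<xi>\<in>linked K. finite \<xi> \<and> \<xi> \<subseteq> points K) \<and>
     {} \<in> linked K \<and> (\<forall>y\<in>points K. {y} \<in> linked K) \<and>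
     (\<forall>\<xi>\<in>linked K. \<forall>\<eta>. \<eta> \<subseteq> \<xi> \<longrightarrow> \<eta> \<in> linked K)"

definition simplicial_map :: "'a complex_on \<Rightarrow> 'b complex_on \<Rightarrow> ('a \<Rightarrow> 'b) \<Rightarrow> bool" where
  "simplicial_map K L f \<longleftrightarrow>
     f \<in> points K \<rightarrow> points L \<and> (\<forall>\<xi>\<in>linked K. f ` \<xi> \<in> linked L)"

definition prod_complex :: "'a complex_on \<Rightarrow> 'b complex_on \<Rightarrow> ('a \<times> 'b) complex_on" where
  "prod_complex K L =
     \<lparr>points = points K \<times> points L,
      linked = {\<xi>. finite \<xi> \<and> \<xi> \<subseteq> points K \<times> points L \<and>
                   fst ` \<xi> \<in> linked K \<and> snd ` \<xi> \<in> linked L}\<rparr>"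

definition int_line :: "int complex_on" where
  "int_line = \<lparr>points = UNIV, linked = {{}} \<union> range (\<lambda>i. {i}) \<union> range (\<lambda>i. {i, i + 1})\<rparr>"

definition t_complex :: "real \<Rightarrow> 'a::metric_space set \<Rightarrow> 'a complex_on" where
  "t_complex \<epsilon> X =
     \<lparr>points = X,
      linked = {\<xi>. finite \<xi> \<and> \<xi> \<subseteq> X \<and> (\<forall>x\<in>\<xi>. \<forall>x'\<in>\<xi>. dist x x' \<le> \<epsilon>)}\<rparr>"

definition t_minus_complex :: "real \<Rightarrow> 'a::metric_space set \<Rightarrow> 'a complex_on" where
  "t_minus_complex \<epsilon> X =
     \<lparr>points = X,
      linked = {\<xi>. finite \<xi> \<and> \<xi> \<subseteq> X \<and> (\<forall>x\<in>\<xi>. \<forall>x'\<in>\<xi>. dist x x' < \<epsilon>)}\<rparr>"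

section \<open>Combinatorial homotopy\<close>

definition comb_pi0_rel :: "'a complex_on \<Rightarrow> ('a \<times> 'a) set" where
  "comb_pi0_rel K =
     {(y, y'). y \<in> points K \<and> y' \<in> points K \<and> equivclp (\<lambda>u v. {u, v} \<in> linked K) y y'}"

definition comb_pi0 :: "'a complex_on \<Rightarrow> 'a set set" where
  "comb_pi0 K = points K // comb_pi0_rel K"

definition loop_support :: "'a \<Rightarrow> (int \<Rightarrow> 'a) \<Rightarrow> int \<Rightarrow> int \<Rightarrow> bool" where
  "loop_support b a l u \<longleftrightarrow> l \<le> u \<and> (\<forall>i\<le>l. a i = b) \<and> (\<forall>i\<ge>u. a i = b)"

definition comb_loops :: "'a complex_on \<Rightarrow> 'a \<Rightarrow> (int \<Rightarrow> 'a) set" where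
  "comb_loops K b = {a. simplicial_map int_line K a \<and> (\<exists>l u. loop_support b a l u)}"

text \<open>The end points of the least support; \<open>[0, 0]\<close> for the constant loop, whose supports have
  no least element.\<close>

definition rho_minus :: "'a \<Rightarrow> (int \<Rightarrow> 'a) \<Rightarrow> int" where
  "rho_minus b a = (if \<forall>i. a i = b then 0 else GREATEST l. \<exists>u. loop_support b a l u)"

definition rho_plus :: "'a \<Rightarrow> (int \<Rightarrow> 'a) \<Rightarrow> int" where
  "rho_plus b a = (if \<forall>i. a i = b then 0 else LEAST u. \<exists>l. loop_support b a l u)"

definition loop_sum :: "'a \<Rightarrow> (int \<Rightarrow> 'a) \<Rightarrow> (int \<Rightarrow> 'a) \<Rightarrow> int \<Rightarrow> 'a" where
  "loop_sum b a a' = (\<lambda>i. if i \<le> rho_plus b a + rho_minus b a'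
                          then a (i - rho_minus b a') else a' (i - rho_plus b a))"

definition comb_loop_rel :: "'a complex_on \<Rightarrow> 'a \<Rightarrow> ((int \<Rightarrow> 'a) \<times> (int \<Rightarrow> 'a)) set" where
  "comb_loop_rel K b =
     {(a, a'). a \<in> comb_loops K b \<and> a' \<in> comb_loops K b \<and>
        (\<exists>A l u m n. simplicial_map (prod_complex int_line int_line) K A \<and> l \<le> u \<and> m \<le> n \<and>
           (\<forall>i j. i \<le> l \<or> u \<le> i \<longrightarrow> A (i, j) = b) \<and>
           (\<forall>i j. j \<le> m \<longrightarrow> A (i, j) = a i) \<and>
           (\<forall>i j. n \<le> j \<longrightarrow> A (i, j) = a' i))}"

text \<open>Operations on, and mappings between, sets of classes are written as unions over
  representatives: such a union is a class exactly when the result does not depend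
  on the representatives.\<close>

definition comb_pi1 :: "'a complex_on \<Rightarrow> 'a \<Rightarrow> (int \<Rightarrow> 'a) set monoid" where
  "comb_pi1 K b =
     \<lparr>carrier = comb_loops K b // comb_loop_rel K b,
      mult = (\<lambda>A A'. \<Union>a\<in>A. \<Union>a'\<in>A'. comb_loop_rel K b `` {loop_sum b a a'}),
      one = comb_loop_rel K b `` {\<lambda>i. b}\<rparr>"

text \<open>The mappings induced by a map of complexes into \<open>L\<close> with base point \<open>c\<close>.\<close>

definition comb_pi0_map :: "'b complex_on \<Rightarrow> ('a \<Rightarrow> 'b) \<Rightarrow> 'a set \<Rightarrow> 'b set" where
  "comb_pi0_map L g A = (\<Union>y\<in>A. comb_pi0_rel L `` {g y})"

definition comb_pi1_map ::
    "'b complex_on \<Rightarrow> 'b \<Rightarrow> ('a \<Rightarrow> 'b) \<Rightarrow> (int \<Rightarrow> 'a) set \<Rightarrow> (int \<Rightarrow> 'b) set" where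
  "comb_pi1_map L c g A = (\<Union>a\<in>A. comb_loop_rel L c `` {g \<circ> a})"

section \<open>Topological homotopy\<close>

text \<open>\<open>\<pi>\<^sub>0\<close> of a space is \<^const>\<open>path_components_of\<close>. The sort constraint below is
  only there because the library restricts \<^const>\<open>joinpaths\<close>; the topology that matters is
  the argument \<open>T\<close>.\<close>

definition top_loops :: "'a::topological_space topology \<Rightarrow> 'a \<Rightarrow> (real \<Rightarrow> 'a) set" where
  "top_loops T b = {p. pathin T p \<and> pathstart p = b \<and> pathfinish p = b}"

definition top_loop_rel ::
    "'a::topological_space topology \<Rightarrow> 'a \<Rightarrow> ((real \<Rightarrow> 'a) \<times> (real \<Rightarrow> 'a)) set" where
  "top_loop_rel T b =
     {(p, q). p \<in> top_loops T b \<and> q \<in> top_loops T b \<and>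
        homotopic_with (\<lambda>r. pathstart r = b \<and> pathfinish r = b) (top_of_set {0..1}) T p q}"

definition top_pi1 :: "'a::topological_space topology \<Rightarrow> 'a \<Rightarrow> (real \<Rightarrow> 'a) set monoid" where
  "top_pi1 T b =
     \<lparr>carrier = top_loops T b // top_loop_rel T b,
      mult = (\<lambda>P Q. \<Union>p\<in>P. \<Union>q\<in>Q. top_loop_rel T b `` {p +++ q}),
      one = top_loop_rel T b `` {\<lambda>t. b}\<rparr>"

definition top_pi0_map :: "'b topology \<Rightarrow> ('a \<Rightarrow> 'b) \<Rightarrow> 'a set \<Rightarrow> 'b set" where
  "top_pi0_map T f C = (\<Union>x\<in>C. path_component_of_set T (f x))"

definition top_pi1_map ::
    "'b::topological_space topology \<Rightarrow> 'b \<Rightarrow> ('a \<Rightarrow> 'b) \<Rightarrow> (real \<Rightarrow> 'a) set \<Rightarrow> (real \<Rightarrow> 'b) set" where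
  "top_pi1_map T c f P = (\<Union>p\<in>P. top_loop_rel T c `` {f \<circ> p})"

section \<open>Geometric realisation\<close>

text \<open>A function on \<open>points K\<close> with linked support is encoded as a function on the
  whole type that vanishes outside \<open>points K\<close>.\<close>

definition fsupp :: "('a \<Rightarrow> real) \<Rightarrow> 'a set" where
  "fsupp w = {y. w y \<noteq> 0}"

definition realisation_set :: "'a complex_on \<Rightarrow> ('a \<Rightarrow> real) set" where
  "realisation_set K =
     {w. (\<forall>y. w y \<in> {0..1}) \<and> fsupp w \<in> linked K \<and> sum w (fsupp w) = 1}"

definition simplex_of :: "'a complex_on \<Rightarrow> 'a set \<Rightarrow> ('a \<Rightarrow> real) set" where
  "simplex_of K \<xi> = {w \<in> realisation_set K. fsupp w \<subseteq> \<xi>}"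

text \<open>As \<open>\<xi>\<close> is finite and the elements of the simplex vanish outside \<open>\<xi>\<close>, the product topology
  induces the euclidean one.\<close>

definition simplex_topology :: "'a complex_on \<Rightarrow> 'a set \<Rightarrow> ('a \<Rightarrow> real) topology" where
  "simplex_topology K \<xi> = subtopology (powertop_real UNIV) (simplex_of K \<xi>)"

definition realisation :: "'a complex_on \<Rightarrow> ('a \<Rightarrow> real) topology" where
  "realisation K = topology (\<lambda>U. U \<subseteq> realisation_set K \<and>
     (\<forall>\<xi>\<in>linked K. \<xi> \<noteq> {} \<longrightarrow> openin (simplex_topology K \<xi>) (U \<inter> simplex_of K \<xi>)))"

definition vertex :: "'a \<Rightarrow> 'a \<Rightarrow> real" where
  "vertex y = indicat_real {y}"

text \<open>The mapping \<open>\<S>g\<close> induced by a map \<open>g\<close> of complexes.\<close>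

definition realisation_map :: "('a \<Rightarrow> 'b) \<Rightarrow> ('a \<Rightarrow> real) \<Rightarrow> 'b \<Rightarrow> real" where
  "realisation_map g w = (\<lambda>z. sum w {y \<in> fsupp w. g y = z})"

definition hat :: "(int \<Rightarrow> 'a) \<Rightarrow> real \<Rightarrow> 'a \<Rightarrow> real" where
  "hat a t = (\<lambda>y. (1 - frac t) * vertex (a \<lfloor>t\<rfloor>) y + frac t * vertex (a (\<lfloor>t\<rfloor> + 1)) y)"

text \<open>\<open>hat a\<close> restricted to the least support of \<open>a\<close>, reparametrised on \<open>[0, 1]\<close>.\<close>

definition hat_loop :: "'a \<Rightarrow> (int \<Rightarrow> 'a) \<Rightarrow> real \<Rightarrow> 'a \<Rightarrow> real" where
  "hat_loop b a s =
     hat a (of_int (rho_minus b a) + s * of_int (rho_plus b a - rho_minus b a))"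

definition Phi0 :: "'a complex_on \<Rightarrow> 'a set \<Rightarrow> ('a \<Rightarrow> real) set" where
  "Phi0 K A = (\<Union>y\<in>A. path_component_of_set (realisation K) (vertex y))"

definition Phi1 :: "'a complex_on \<Rightarrow> 'a \<Rightarrow> (int \<Rightarrow> 'a) set \<Rightarrow> (real \<Rightarrow> 'a \<Rightarrow> real) set" where
  "Phi1 K b A = (\<Union>a\<in>A. top_loop_rel (realisation K) (vertex b) `` {hat_loop b a})"

section \<open>Spot dilation\<close>

definition spot_dilation :: "real \<Rightarrow> 'a::real_normed_vector set \<Rightarrow> 'a set" where
  "spot_dilation \<epsilon> X = {x'. \<exists>x\<in>X. dist x x' < \<epsilon> / 2}"

definition t_closed :: "real \<Rightarrow> 'a::real_normed_vector set \<Rightarrow> bool" where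
  "t_closed \<epsilon> X \<longleftrightarrow> (\<forall>\<xi>\<in>linked (t_complex \<epsilon> X). convex hull \<xi> \<subseteq> spot_dilation \<epsilon> X)"

definition t_minus_closed :: "real \<Rightarrow> 'a::real_normed_vector set \<Rightarrow> bool" where
  "t_minus_closed \<epsilon> X \<longleftrightarrow>
     (\<forall>\<xi>\<in>linked (t_minus_complex \<epsilon> X). convex hull \<xi> \<subseteq> spot_dilation \<epsilon> X)"

text \<open>The formula for both \<open>f\<^sub>\<epsilon>\<close> and \<open>f\<^sub>\<epsilon>\<^sup>-\<close>, which differ only in their domain.\<close>

definition affine_ext :: "('a::real_normed_vector \<Rightarrow> real) \<Rightarrow> 'a" where
  "affine_ext w = (\<Sum>x\<in>fsupp w. w x *\<^sub>R x)"

section \<open>Isomorphisms\<close>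

definition group_iso :: "('a \<Rightarrow> 'b) \<Rightarrow> 'a monoid \<Rightarrow> 'b monoid \<Rightarrow> bool" where
  "group_iso h G H \<longleftrightarrow> group G \<and> group H \<and> h \<in> iso G H"

definition pointed_iso :: "('a \<Rightarrow> 'b) \<Rightarrow> 'a set \<Rightarrow> 'a \<Rightarrow> 'b set \<Rightarrow> 'b \<Rightarrow> bool" where
  "pointed_iso h S s T t \<longleftrightarrow> s \<in> S \<and> t \<in> T \<and> bij_betw h S T \<and> h s = t"

section \<open>Well-definedness\<close>

lemma linkage_complex_int_line: "linkage_complex int_line"
proof -
  have "\<eta> = {} \<or> \<eta> = {i} \<or> \<eta> = {i + 1} \<or> \<eta> = {i, i + 1}" if "\<eta> \<subseteq> {i, i + 1}" for \<eta> and i :: int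
    using that by blast
  then show ?thesis
    unfolding linkage_complex_def int_line_def by (simp add: subset_singleton_iff) blast
qed

lemma linkage_complex_t_complex: "0 < \<epsilon> \<Longrightarrow> linkage_complex (t_complex \<epsilon> X)"
  by (auto simp: linkage_complex_def t_complex_def finite_subset subset_iff)

lemma linkage_complex_t_minus_complex: "0 < \<epsilon> \<Longrightarrow> linkage_complex (t_minus_complex \<epsilon> X)"
  by (auto simp: linkage_complex_def t_minus_complex_def finite_subset subset_iff)

lemma openin_realisation:
  "openin (realisation K) U \<longleftrightarrow> U \<subseteq> realisation_set K \<and>
     (\<forall>\<xi>\<in>linked K. \<xi> \<noteq> {} \<longrightarrow> openin (simplex_topology K \<xi>) (U \<inter> simplex_of K \<xi>))"
proof -
  let ?P = "\<lambda>U. U \<subseteq> realisation_set K \<and>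
     (\<forall>\<xi>\<in>linked K. \<xi> \<noteq> {} \<longrightarrow> openin (simplex_topology K \<xi>) (U \<inter> simplex_of K \<xi>))"
  have "?P (S \<inter> T)" if "?P S" "?P T" for S T
  proof -
    have "S \<inter> T \<inter> simplex_of K \<xi> = (S \<inter> simplex_of K \<xi>) \<inter> (T \<inter> simplex_of K \<xi>)" for \<xi>
      by auto
    with that show ?thesis
      by (simp add: openin_Int le_infI1)
  qed
  moreover have "?P (\<Union>\<K>)" if "\<forall>S\<in>\<K>. ?P S" for \<K>
  proof -
    have "openin (simplex_topology K \<xi>) (\<Union>\<K> \<inter> simplex_of K \<xi>)"
      if "\<xi> \<in> linked K" "\<xi> \<noteq> {}" for \<xi>
    proof -
      have "openin (simplex_topology K \<xi>) (\<Union>((\<lambda>S. S \<inter> simplex_of K \<xi>) ` \<K>))"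
        using \<open>\<forall>S\<in>\<K>. ?P S\<close> that by (intro openin_Union) blast
      then show ?thesis
        by (simp only: Int_Union2)
    qed
    with that show ?thesis
      by (simp add: Sup_le_iff)
  qed
  ultimately have "istopology ?P"
    unfolding istopology_def by blast
  then show ?thesis
    by (simp add: realisation_def)
qed

lemma topspace_simplex_topology [simp]: "topspace (simplex_topology K \<xi>) = simplex_of K \<xi>"
  by (simp add: simplex_topology_def)

lemma simplex_of_subset: "simplex_of K \<xi> \<subseteq> realisation_set K"
  by (auto simp: simplex_of_def)

lemma topspace_realisation [simp]: "topspace (realisation K) = realisation_set K"
proof -
  have "realisation_set K \<inter> simplex_of K \<xi> = topspace (simplex_topology K \<xi>)" for \<xi>
    using simplex_of_subset[of K \<xi>] by auto
  then have "openin (realisation K) (realisation_set K)"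
    unfolding openin_realisation by (metis openin_topspace order_refl)
  then show ?thesis
    by (metis openin_realisation openin_subset openin_topspace subset_antisym)
qed

lemma continuous_map_from_realisation:
  assumes f: "f \<in> realisation_set K \<rightarrow> topspace T"
    and cont: "\<And>\<xi>. \<lbrakk>\<xi> \<in> linked K; \<xi> \<noteq> {}\<rbrakk> \<Longrightarrow> continuous_map (simplex_topology K \<xi>) T f"
  shows "continuous_map (realisation K) T f"
proof -
  have "openin (realisation K) {w \<in> realisation_set K. f w \<in> U}" if U: "openin T U" for U
  proof -
    have "{w \<in> realisation_set K. f w \<in> U} \<inter> simplex_of K \<xi> =
          {w \<in> topspace (simplex_topology K \<xi>). f w \<in> U}" for \<xi>
      using simplex_of_subset[of K \<xi>] by auto
    then show ?thesis
      using cont U unfolding openin_realisation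
      by (auto simp del: topspace_simplex_topology dest!: openin_continuous_map_preimage)
  qed
  with f show ?thesis
    by (auto simp: continuous_map_def)
qed

lemma simplex_topology_into_realisation:
  assumes \<xi>: "\<xi> \<in> linked K"
  shows "continuous_map (simplex_topology K \<xi>) (realisation K) (\<lambda>w. w)"
proof -
  have "openin (simplex_topology K \<xi>) {w \<in> simplex_of K \<xi>. w \<in> U}"
    if U: "openin (realisation K) U" for U
  proof (cases "\<xi> = {}")
    case True
    then have "simplex_of K \<xi> = {}"
      by (auto simp: simplex_of_def realisation_set_def)
    then show ?thesis by simp
  next
    case False
    have "{w \<in> simplex_of K \<xi>. w \<in> U} = U \<inter> simplex_of K \<xi>" by auto
    then show ?thesis
      using U \<xi> False by (simp add: openin_realisation)
  qed
  then show ?thesis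
    using simplex_of_subset[of K \<xi>] by (auto simp: continuous_map_def)
qed

lemma fsupp_vertex [simp]: "fsupp (vertex y) = {y}"
  by (auto simp: fsupp_def vertex_def indicator_def split: if_splits)

lemma vertex_in_realisation:
  assumes "linkage_complex K" "y \<in> points K"
  shows "vertex y \<in> realisation_set K"
proof -
  have "vertex y z \<in> {0..1}" "vertex y y = 1" for z
    by (auto simp: vertex_def indicator_def)
  with assms show ?thesis
    unfolding realisation_set_def linkage_complex_def by simp
qed

lemma realisation_map_id: "realisation_map id w = w"
proof -
  have "{y \<in> fsupp w. y = z} = (if w z = 0 then {} else {z})" for z
    by (auto simp: fsupp_def)
  then show ?thesis
    by (auto simp: realisation_map_def)
qed

lemma affine_ext_vertex: "affine_ext (vertex y) = y"
  by (simp add: affine_ext_def) (simp add: vertex_def)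

lemma affine_ext_in_hull:
  assumes "linkage_complex K" "w \<in> realisation_set K"
  shows "affine_ext w \<in> convex hull (fsupp w)"
proof -
  have "finite (fsupp w)"
    using assms by (auto simp: realisation_set_def linkage_complex_def)
  then show ?thesis
    unfolding affine_ext_def
    using assms hull_subset[of "fsupp w" convex]
    by (intro convex_sum) (auto simp: realisation_set_def)
qed

lemma continuous_map_affine_ext:
  assumes K: "linkage_complex K"
    and D: "\<And>\<xi>. \<xi> \<in> linked K \<Longrightarrow> convex hull \<xi> \<subseteq> D"
  shows "continuous_map (realisation K) (top_of_set D) affine_ext"
proof (rule continuous_map_from_realisation)
  show into: "affine_ext \<in> realisation_set K \<rightarrow> topspace (top_of_set D)"
    using affine_ext_in_hull[OF K] D by (force simp: realisation_set_def)
  fix \<xi> assume \<xi>: "\<xi> \<in> linked K"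
  then have fin: "finite \<xi>"
    using K by (auto simp: linkage_complex_def)
  have proj: "continuous_map (simplex_topology K \<xi>) euclideanreal (\<lambda>w. w x)" for x
    unfolding simplex_topology_def
    by (intro continuous_map_from_subtopology continuous_map_product_projection) auto
  have scale: "continuous_map euclideanreal euclidean (\<lambda>r. r *\<^sub>R x)" for x :: 'a
    unfolding continuous_map_iff_continuous2 by (intro continuous_intros)
  have "continuous_map (simplex_topology K \<xi>) euclidean (\<lambda>w. w x *\<^sub>R x)" for x :: 'a
    using continuous_map_compose[OF proj scale, of x x] by (simp only: o_def)
  then have "continuous_map (simplex_topology K \<xi>) euclidean (\<lambda>w. \<Sum>x\<in>\<xi>. w x *\<^sub>R x)"
    using fin by (intro continuous_map_sum)
  moreover have "(\<Sum>x\<in>\<xi>. w x *\<^sub>R x) = affine_ext w" if "w \<in> topspace (simplex_topology K \<xi>)" for w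
    unfolding affine_ext_def using fin that
    by (intro sum.mono_neutral_right) (auto simp: simplex_of_def fsupp_def)
  ultimately have "continuous_map (simplex_topology K \<xi>) euclidean affine_ext"
    by (rule continuous_map_eq)
  then show "continuous_map (simplex_topology K \<xi>) (top_of_set D) affine_ext"
    using into simplex_of_subset[of K \<xi>] by (auto simp: continuous_map_in_subtopology)
qed

end

(*
  The composite Psi from combinatorial to topological loops of the dilation D is shown to be
  bijective on classes by hand.  Every loop of D stays, on the pieces of a fine subdivision, within
  eps/2 of points of X, two consecutive ones being less than eps apart; this gives surjectivity.
  Applied to the grid points of a homotopy in D between realised loops, the same choice gives a
  combinatorial homotopy (the four points of a unit square all lie within eps/2 of a common point)
  between step-like reparametrisations of the given loops, hence injectivity.  Since Phi_1 is
  surjective by simplicial approximation with stars, both factors of Psi are bijective.  All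
  group laws, and the comparison of the complexes t_eps^- X and t_eps X, are pulled back from D.
*)
theory Submission
  imports Defs
begin

section \<open>Quotients by equivalence relations\<close>

text \<open>The obstacle is the closed inequality in \<open>t_complex\<close>. Linked points may be
  exactly \<epsilon> apart, and the midpoint of the edge between them is then at distance
  \<epsilon>/2 from both ends, however finely the loop is subdivided. So a point of a realised loop
  and its nearest vertex satisfy only a weak bound, while compactness gives strict bounds for the
  centres chosen along a homotopy. Strict plus weak is still less than \<epsilon>; only two vertices
  of the same given loop need another argument, and they are linked because that loop is a
  simplicial map. This is why the grid of a homotopy is extended by rows that carry the given loops,
  and why one locale can treat both complexes. A second obstacle is the direct limit topology of the
  realisation, in which a homotopy is not continuous merely because its coordinates are; compactness
  of paths reduces this to finitely many vertices.\<close>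

definition quot_map :: "('b \<times> 'b) set \<Rightarrow> ('a \<Rightarrow> 'b) \<Rightarrow> 'a set \<Rightarrow> 'b set" where
  "quot_map R' h A = (\<Union>a\<in>A. R' `` {h a})"

text \<open>Bijectivity on classes, expressed with representatives so that comparisons can be
  composed and cancelled. Being the preimage of the equivalence relation \<open>R'\<close> forces
  \<open>R\<close> to be one, so reflexivity, symmetry and transitivity are checked only in the
  target.\<close>

definition quot_equiv ::
    "'a set \<Rightarrow> ('a \<times> 'a) set \<Rightarrow> ('a \<Rightarrow> 'b) \<Rightarrow> 'b set \<Rightarrow> ('b \<times> 'b) set \<Rightarrow> bool" where
  "quot_equiv C R h C' R' \<longleftrightarrow> R \<subseteq> C \<times> C \<and> equiv C' R' \<and> h \<in> C \<rightarrow> C' \<and>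
     (\<forall>a\<in>C. \<forall>b\<in>C. (a, b) \<in> R \<longleftrightarrow> (h a, h b) \<in> R') \<and> (\<forall>c\<in>C'. \<exists>a\<in>C. (h a, c) \<in> R')"

lemma quot_equiv_equiv:
  assumes "quot_equiv C R h C' R'"
  shows "equiv C R"
proof (rule equivI)
  have R': "equiv C' R'" and h: "\<And>a. a \<in> C \<Longrightarrow> h a \<in> C'" and sub: "R \<subseteq> C \<times> C"
    and iff: "\<And>a b. a \<in> C \<Longrightarrow> b \<in> C \<Longrightarrow> (a, b) \<in> R \<longleftrightarrow> (h a, h b) \<in> R'"
    using assms unfolding quot_equiv_def by blast+
  show "R \<subseteq> C \<times> C" by fact
  show "refl_on C R"
    using R' h iff by (auto simp: refl_on_def equiv_def)
  show "sym R"
  proof (rule symI)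
    fix a b assume ab: "(a, b) \<in> R"
    then have C: "a \<in> C" "b \<in> C" using sub by auto
    then have "(h b, h a) \<in> R'" using ab iff R' by (auto simp: equiv_def dest: symD)
    then show "(b, a) \<in> R" using iff C by blast
  qed
  show "trans R"
  proof (rule transI)
    fix a b c assume ab: "(a, b) \<in> R" and bc: "(b, c) \<in> R"
    then have C: "a \<in> C" "b \<in> C" "c \<in> C" using sub by auto
    then have "(h a, h b) \<in> R'" "(h b, h c) \<in> R'" using ab bc iff by blast+
    then have "(h a, h c) \<in> R'" using R' by (auto simp: equiv_def dest: transD)
    then show "(a, c) \<in> R" using iff C by blast
  qed
qed

lemma quot_map_class:
  assumes "equiv C R" "equiv C' R'" "\<And>a b. (a, b) \<in> R \<Longrightarrow> (h a, h b) \<in> R'" "a \<in> C"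
  shows "quot_map R' h (R `` {a}) = R' `` {h a}"
proof -
  have "R' `` {h b} = R' `` {h a}" if "(a, b) \<in> R" for b
    using assms(2,3) that by (metis equiv_class_eq)
  moreover have "(a, a) \<in> R"
    using assms(1,4) by (auto simp: equiv_def refl_on_def)
  ultimately show ?thesis
    unfolding quot_map_def by blast
qed

lemma quot_equiv_map_class:
  assumes "quot_equiv C R h C' R'" "a \<in> C"
  shows "quot_map R' h (R `` {a}) = R' `` {h a}"
  by (rule quot_map_class[OF quot_equiv_equiv[OF assms(1)] _ _ assms(2)])
     (use assms(1) in \<open>auto simp: quot_equiv_def\<close>)

lemma quot_equiv_bij:
  assumes q: "quot_equiv C R h C' R'"
  shows "bij_betw (quot_map R' h) (C // R) (C' // R')"
  unfolding bij_betw_def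
proof
  have R': "equiv C' R'" and h: "\<And>a. a \<in> C \<Longrightarrow> h a \<in> C'"
    and iff: "\<And>a b. a \<in> C \<Longrightarrow> b \<in> C \<Longrightarrow> (a, b) \<in> R \<longleftrightarrow> (h a, h b) \<in> R'"
    and sur: "\<And>c. c \<in> C' \<Longrightarrow> \<exists>a\<in>C. (h a, c) \<in> R'"
    using q unfolding quot_equiv_def by blast+
  note R = quot_equiv_equiv[OF q] and cl = quot_equiv_map_class[OF q]
  show "inj_on (quot_map R' h) (C // R)"
  proof (rule inj_onI)
    fix A B assume "A \<in> C // R" "B \<in> C // R" and eq: "quot_map R' h A = quot_map R' h B"
    then obtain a b where ab: "A = R `` {a}" "a \<in> C" "B = R `` {b}" "b \<in> C"
      by (auto elim!: quotientE)
    then have "(h a, h b) \<in> R'"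
      using eq R' h by (metis cl eq_equiv_class)
    then show "A = B"
      using ab iff R by (metis equiv_class_eq)
  qed
  show "quot_map R' h ` (C // R) = C' // R'"
  proof
    show "quot_map R' h ` (C // R) \<subseteq> C' // R'"
      using cl h by (auto elim!: quotientE intro!: quotientI)
    show "C' // R' \<subseteq> quot_map R' h ` (C // R)"
    proof
      fix D assume "D \<in> C' // R'"
      then obtain c where c: "D = R' `` {c}" "c \<in> C'" by (auto elim: quotientE)
      then obtain a where a: "a \<in> C" "(h a, c) \<in> R'" using sur by blast
      then have "quot_map R' h (R `` {a}) = D"
        using cl c R' by (metis equiv_class_eq)
      then show "D \<in> quot_map R' h ` (C // R)"
        using a(1) by (metis imageI quotientI)
    qed
  qed
qed

lemma quot_equiv_pointed_iso:
  assumes q: "quot_equiv C R h C' R'" and x: "x \<in> C"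
  shows "pointed_iso (quot_map R' h) (C // R) (R `` {x}) (C' // R') (R' `` {h x})"
proof -
  have "h x \<in> C'" using q x by (auto simp: quot_equiv_def)
  then show ?thesis
    unfolding pointed_iso_def
    using quot_equiv_bij[OF q] quot_equiv_map_class[OF q x] x by (simp add: quotientI)
qed

lemma quot_equivD:
  assumes "quot_equiv C R h C' R'"
  shows "equiv C' R'" "R \<subseteq> C \<times> C" "a \<in> C \<Longrightarrow> h a \<in> C'"
    "a \<in> C \<Longrightarrow> b \<in> C \<Longrightarrow> (a, b) \<in> R \<longleftrightarrow> (h a, h b) \<in> R'"
    "c \<in> C' \<Longrightarrow> \<exists>a\<in>C. (h a, c) \<in> R'"
  using assms by (auto simp: quot_equiv_def)

lemma quot_equiv_comp:
  assumes q: "quot_equiv C R h C' R'" and q': "quot_equiv C' R' h' C'' R''"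
  shows "quot_equiv C R (h' \<circ> h) C'' R''"
proof -
  note D = quot_equivD[OF q] and D' = quot_equivD[OF q']
  have "\<exists>a\<in>C. (h' (h a), c) \<in> R''" if c: "c \<in> C''" for c
  proof -
    obtain b where b: "b \<in> C'" "(h' b, c) \<in> R''" using D'(5)[OF c] by blast
    obtain a where a: "a \<in> C" "(h a, b) \<in> R'" using D(5)[OF b(1)] by blast
    have "(h' (h a), h' b) \<in> R''" using D'(4)[OF D(3)[OF a(1)] b(1)] a(2) by simp
    then have "(h' (h a), c) \<in> R''" using b(2) D'(1) by (auto simp: equiv_def dest: transD)
    then show ?thesis using a(1) by blast
  qed
  moreover have "(a, b) \<in> R \<longleftrightarrow> (h' (h a), h' (h b)) \<in> R''" if "a \<in> C" "b \<in> C" for a b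
    using D(3,4) D'(4) that by metis
  ultimately show ?thesis
    unfolding quot_equiv_def using D(2,3) D'(1,3) by simp
qed

text \<open>The two-out-of-three step: two sources compared with the same target are thereby
  compared with each other. Surjectivity of \<open>h\<close> on classes holds because
  \<open>h'\<close> reflects the relation.\<close>

lemma quot_equiv_cancel:
  assumes q: "quot_equiv C R (h' \<circ> h) C'' R''" and q': "quot_equiv C' R' h' C'' R''"
    and h: "h \<in> C \<rightarrow> C'"
  shows "quot_equiv C R h C' R'"
proof -
  note D = quot_equivD[OF q] and D' = quot_equivD[OF q']
  have "\<exists>a\<in>C. (h a, c) \<in> R'" if c: "c \<in> C'" for c
  proof -
    obtain a where a: "a \<in> C" "(h' (h a), h' c) \<in> R''"
      using D(5)[OF D'(3)[OF c]] by auto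
    then have "(h a, c) \<in> R'" using D'(4)[of "h a" c] h c by blast
    then show ?thesis using a(1) by blast
  qed
  moreover have "(a, b) \<in> R \<longleftrightarrow> (h a, h b) \<in> R'" if "a \<in> C" "b \<in> C" for a b
    using D(4)[of a b] D'(4)[of "h a" "h b"] that h by (simp add: Pi_iff)
  ultimately show ?thesis
    unfolding quot_equiv_def using D(2) h quot_equiv_equiv[OF q'] by simp
qed

lemma quot_map_comp:
  assumes q: "quot_equiv C R h C' R'" and q': "quot_equiv C' R' h' C'' R''" and A: "A \<in> C // R"
  shows "quot_map R'' h' (quot_map R' h A) = quot_map R'' (h' \<circ> h) A"
proof -
  obtain a where a: "a \<in> C" "A = R `` {a}" using A by (auto elim: quotientE)
  then show ?thesis
    using quot_equiv_map_class[OF q a(1)] quot_equiv_map_class[OF q' quot_equivD(3)[OF q a(1)]]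
      quot_equiv_map_class[OF quot_equiv_comp[OF q q'] a(1)] by simp
qed

section \<open>Groups of classes\<close>

definition quot_monoid ::
    "'a set \<Rightarrow> ('a \<times> 'a) set \<Rightarrow> ('a \<Rightarrow> 'a \<Rightarrow> 'a) \<Rightarrow> 'a \<Rightarrow> 'a set monoid" where
  "quot_monoid C R m e =
     \<lparr>carrier = C // R, mult = (\<lambda>A B. \<Union>a\<in>A. \<Union>b\<in>B. R `` {m a b}), one = R `` {e}\<rparr>"

text \<open>Group laws up to \<open>R\<close>, in the one-sided form that \<open>groupI\<close> asks
  for, together with compatibility of \<open>m\<close> with \<open>R\<close>.\<close>

definition quot_group ::
    "'a set \<Rightarrow> ('a \<times> 'a) set \<Rightarrow> ('a \<Rightarrow> 'a \<Rightarrow> 'a) \<Rightarrow> 'a \<Rightarrow> bool" where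
  "quot_group C R m e \<longleftrightarrow> equiv C R \<and> e \<in> C \<and> m \<in> C \<rightarrow> C \<rightarrow> C \<and>
     (\<forall>a b c d. (a, b) \<in> R \<longrightarrow> (c, d) \<in> R \<longrightarrow> (m a c, m b d) \<in> R) \<and>
     (\<forall>a\<in>C. \<forall>b\<in>C. \<forall>c\<in>C. (m (m a b) c, m a (m b c)) \<in> R) \<and>
     (\<forall>a\<in>C. (m e a, a) \<in> R) \<and> (\<forall>a\<in>C. \<exists>b\<in>C. (m b a, e) \<in> R)"

lemma quot_monoid_mult:
  assumes q: "quot_group C R m e" and "a \<in> C" "b \<in> C"
  shows "mult (quot_monoid C R m e) (R `` {a}) (R `` {b}) = R `` {m a b}"
proof -
  have R: "equiv C R" and cong: "\<And>a b c d. (a, b) \<in> R \<Longrightarrow> (c, d) \<in> R \<Longrightarrow> (m a c, m b d) \<in> R"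
    using q unfolding quot_group_def by blast+
  have "R `` {m a' b'} = R `` {m a b}" if "(a, a') \<in> R" "(b, b') \<in> R" for a' b'
    using cong[OF that] R by (metis equiv_class_eq)
  moreover have "(a, a) \<in> R" "(b, b) \<in> R"
    using R assms(2,3) by (auto simp: equiv_def refl_on_def)
  ultimately have "(\<Union>a'\<in>R `` {a}. \<Union>b'\<in>R `` {b}. R `` {m a' b'}) = R `` {m a b}"
    by blast
  then show ?thesis
    by (simp add: quot_monoid_def)
qed

lemma quot_group_group:
  assumes q: "quot_group C R m e"
  shows "group (quot_monoid C R m e)"
proof -
  let ?G = "quot_monoid C R m e"
  have R: "equiv C R" and e: "e \<in> C" and m: "\<And>a b. a \<in> C \<Longrightarrow> b \<in> C \<Longrightarrow> m a b \<in> C"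
    and assoc: "\<And>a b c. a \<in> C \<Longrightarrow> b \<in> C \<Longrightarrow> c \<in> C \<Longrightarrow> (m (m a b) c, m a (m b c)) \<in> R"
    and unit: "\<And>a. a \<in> C \<Longrightarrow> (m e a, a) \<in> R" and inv: "\<And>a. a \<in> C \<Longrightarrow> \<exists>b\<in>C. (m b a, e) \<in> R"
    using q unfolding quot_group_def by blast+
  note mult = quot_monoid_mult[OF q]
  have car: "carrier ?G = C // R" and one: "\<one>\<^bsub>?G\<^esub> = R `` {e}"
    by (simp_all add: quot_monoid_def)
  have rep: "\<exists>a\<in>C. A = R `` {a}" if "A \<in> carrier ?G" for A
    using that unfolding car by (auto elim: quotientE)
  show ?thesis
  proof (rule groupI)
    show "\<one>\<^bsub>?G\<^esub> \<in> carrier ?G"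
      using e by (simp add: car one quotientI)
    fix A assume "A \<in> carrier ?G"
    then obtain a where a: "a \<in> C" "A = R `` {a}" using rep by blast
    show "\<one>\<^bsub>?G\<^esub> \<otimes>\<^bsub>?G\<^esub> A = A"
      using a e unit R by (metis mult one equiv_class_eq)
    obtain b where b: "b \<in> C" "(m b a, e) \<in> R" using inv a by blast
    then have "R `` {b} \<otimes>\<^bsub>?G\<^esub> A = \<one>\<^bsub>?G\<^esub>"
      using a R by (metis mult one equiv_class_eq)
    then show "\<exists>B\<in>carrier ?G. B \<otimes>\<^bsub>?G\<^esub> A = \<one>\<^bsub>?G\<^esub>"
      using b by (auto simp: car intro: quotientI)
    fix B assume "B \<in> carrier ?G"
    then obtain b where b: "b \<in> C" "B = R `` {b}" using rep by blast
    show "A \<otimes>\<^bsub>?G\<^esub> B \<in> carrier ?G"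
      using a b m by (simp add: mult car quotientI)
    fix D assume "D \<in> carrier ?G"
    then obtain d where d: "d \<in> C" "D = R `` {d}" using rep by blast
    have "R `` {m (m a b) d} = R `` {m a (m b d)}"
      using assoc[OF a(1) b(1) d(1)] R by (metis equiv_class_eq)
    then show "A \<otimes>\<^bsub>?G\<^esub> B \<otimes>\<^bsub>?G\<^esub> D = A \<otimes>\<^bsub>?G\<^esub> (B \<otimes>\<^bsub>?G\<^esub> D)"
      using a b d m by (simp add: mult)
  qed
qed

text \<open>Each law is tested after applying \<open>h\<close>: there \<open>hom\<close> exchanges
  \<open>m\<close> for \<open>m'\<close> up to \<open>R'\<close>, and \<open>h\<close> reflects the
  relation. For inverses, surjectivity on classes replaces an inverse in \<open>C'\<close> by an
  equivalent element \<open>h b\<close>.\<close>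

lemma quot_group_pullback:
  assumes q: "quot_equiv C R h C' R'" and g: "quot_group C' R' m' e'"
    and e: "e \<in> C" "(h e, e') \<in> R'" and m: "m \<in> C \<rightarrow> C \<rightarrow> C"
    and hom: "\<And>a b. a \<in> C \<Longrightarrow> b \<in> C \<Longrightarrow> (h (m a b), m' (h a) (h b)) \<in> R'"
  shows "quot_group C R m e"
proof -
  have h: "\<And>a. a \<in> C \<Longrightarrow> h a \<in> C'" and sub: "R \<subseteq> C \<times> C"
    and iff: "\<And>a b. a \<in> C \<Longrightarrow> b \<in> C \<Longrightarrow> (a, b) \<in> R \<longleftrightarrow> (h a, h b) \<in> R'"
    and sur: "\<And>c. c \<in> C' \<Longrightarrow> \<exists>a\<in>C. (h a, c) \<in> R'"
    using q unfolding quot_equiv_def by blast+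
  have R': "equiv C' R'"
    and cong: "\<And>a b c d. (a, b) \<in> R' \<Longrightarrow> (c, d) \<in> R' \<Longrightarrow> (m' a c, m' b d) \<in> R'"
    and assoc: "\<And>a b c. a \<in> C' \<Longrightarrow> b \<in> C' \<Longrightarrow> c \<in> C' \<Longrightarrow> (m' (m' a b) c, m' a (m' b c)) \<in> R'"
    and unit: "\<And>a. a \<in> C' \<Longrightarrow> (m' e' a, a) \<in> R'" and inv: "\<And>a. a \<in> C' \<Longrightarrow> \<exists>b\<in>C'. (m' b a, e') \<in> R'"
    using g unfolding quot_group_def by blast+
  have refl: "\<And>a. a \<in> C' \<Longrightarrow> (a, a) \<in> R'" and sym: "\<And>a b. (a, b) \<in> R' \<Longrightarrow> (b, a) \<in> R'"
    and trans: "\<And>a b c. (a, b) \<in> R' \<Longrightarrow> (b, c) \<in> R' \<Longrightarrow> (a, c) \<in> R'"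
    using R' by (auto simp: equiv_def refl_on_def dest: symD transD)
  have mC: "\<And>a b. a \<in> C \<Longrightarrow> b \<in> C \<Longrightarrow> m a b \<in> C" using m by blast
  have "(m a c, m b d) \<in> R" if "(a, b) \<in> R" "(c, d) \<in> R" for a b c d
  proof -
    have C: "a \<in> C" "b \<in> C" "c \<in> C" "d \<in> C" using that sub by auto
    have "(m' (h a) (h c), m' (h b) (h d)) \<in> R'" using cong that C iff by blast
    then have "(h (m a c), h (m b d)) \<in> R'" using trans[OF trans[OF hom] sym[OF hom]] C by blast
    then show ?thesis using iff C mC by blast
  qed
  moreover have "(m (m a b) c, m a (m b c)) \<in> R" if C: "a \<in> C" "b \<in> C" "c \<in> C" for a b c
  proof -
    have 1: "(h (m (m a b) c), m' (m' (h a) (h b)) (h c)) \<in> R'"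
      by (intro trans[OF hom cong[OF hom refl]] C mC h)
    have 2: "(h (m a (m b c)), m' (h a) (m' (h b) (h c))) \<in> R'"
      by (intro trans[OF hom cong[OF refl hom]] C mC h)
    have "(h (m (m a b) c), h (m a (m b c))) \<in> R'"
      using trans[OF trans[OF 1 assoc] sym[OF 2]] C h by blast
    then show ?thesis
      using iff[OF mC[OF mC[OF C(1,2)] C(3)] mC[OF C(1) mC[OF C(2,3)]]] by simp
  qed
  moreover have "(m e a, a) \<in> R" if C: "a \<in> C" for a
  proof -
    have "(h (m e a), m' e' (h a)) \<in> R'"
      by (intro trans[OF hom cong[OF e(2) refl]] C h e(1))
    then have "(h (m e a), h a) \<in> R'" by (rule trans[OF _ unit[OF h[OF C]]])
    then show ?thesis using iff[OF mC[OF e(1) C] C] by simp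
  qed
  moreover have "\<exists>b\<in>C. (m b a, e) \<in> R" if C: "a \<in> C" for a
  proof -
    obtain b' where b': "b' \<in> C'" "(m' b' (h a), e') \<in> R'" using inv h C by blast
    obtain b where b: "b \<in> C" "(h b, b') \<in> R'" using sur b' by blast
    have "(h (m b a), m' b' (h a)) \<in> R'" 
      by (intro trans[OF hom cong[OF b(2) refl]] C h b(1))
    then have "(h (m b a), h e) \<in> R'" by (rule trans[OF trans[OF _ b'(2)] sym[OF e(2)]])
    then show ?thesis using b(1) iff[OF mC[OF b(1) C] e(1)] by blast
  qed
  ultimately show ?thesis
    unfolding quot_group_def using quot_equiv_equiv[OF q] e(1) m by blast
qed

lemma quot_group_iso:
  assumes q: "quot_equiv C R h C' R'" and g: "quot_group C R m e" and g': "quot_group C' R' m' e'"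
    and hom: "\<And>a b. a \<in> C \<Longrightarrow> b \<in> C \<Longrightarrow> (h (m a b), m' (h a) (h b)) \<in> R'"
  shows "group_iso (quot_map R' h) (quot_monoid C R m e) (quot_monoid C' R' m' e')"
proof -
  let ?G = "quot_monoid C R m e" and ?H = "quot_monoid C' R' m' e'"
  note cl = quot_equiv_map_class[OF q]
  have h: "\<And>a. a \<in> C \<Longrightarrow> h a \<in> C'" using q by (auto simp: quot_equiv_def)
  have mC: "\<And>a b. a \<in> C \<Longrightarrow> b \<in> C \<Longrightarrow> m a b \<in> C" and R': "equiv C' R'"
    using g g' unfolding quot_group_def by auto
  have bij: "bij_betw (quot_map R' h) (carrier ?G) (carrier ?H)"
    using quot_equiv_bij[OF q] by (simp add: quot_monoid_def)
  have "quot_map R' h \<in> hom ?G ?H"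
  proof (rule homI)
    fix A B assume "A \<in> carrier ?G" "B \<in> carrier ?G"
    then obtain a b where ab: "a \<in> C" "A = R `` {a}" "b \<in> C" "B = R `` {b}"
      by (auto simp: quot_monoid_def elim!: quotientE)
    then show "quot_map R' h (A \<otimes>\<^bsub>?G\<^esub> B) = quot_map R' h A \<otimes>\<^bsub>?H\<^esub> quot_map R' h B"
      using hom[OF ab(1,3)] R' mC h
      by (simp add: quot_monoid_mult[OF g] quot_monoid_mult[OF g'] cl equiv_class_eq)
  qed (use bij in \<open>auto simp: bij_betw_def\<close>)
  then show ?thesis
    using bij quot_group_group[OF g] quot_group_group[OF g'] by (simp add: group_iso_def iso_def)
qed

section \<open>Fundamental groups and path components as quotients\<close>

lemma top_pi1_quot: "top_pi1 T b = quot_monoid (top_loops T b) (top_loop_rel T b) (+++) (\<lambda>t. b)"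
  by (simp add: top_pi1_def quot_monoid_def)

lemma comb_pi1_quot:
  "comb_pi1 K b = quot_monoid (comb_loops K b) (comb_loop_rel K b) (loop_sum b) (\<lambda>i. b)"
  by (simp add: comb_pi1_def quot_monoid_def)

lemma top_pi1_map_quot: "top_pi1_map T c f = quot_map (top_loop_rel T c) ((\<circ>) f)"
  by (rule ext) (simp add: top_pi1_map_def quot_map_def)

lemma comb_pi1_map_quot: "comb_pi1_map L c g = quot_map (comb_loop_rel L c) ((\<circ>) g)"
  by (rule ext) (simp add: comb_pi1_map_def quot_map_def)

lemma Phi1_quot: "Phi1 K b = quot_map (top_loop_rel (realisation K) (vertex b)) (hat_loop b)"
  by (rule ext) (simp add: Phi1_def quot_map_def)

text \<open>Presents path components as classes of a relation, so that the quotient lemmas serve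
  \<pi>_0 as well as \<pi>_1.\<close>

definition path_rel :: "'a topology \<Rightarrow> ('a \<times> 'a) set" where
  "path_rel T = {(x, y). path_component_of T x y}"

lemma path_rel_class: "path_rel T `` {x} = path_component_of_set T x"
  by (auto simp: path_rel_def)

lemma path_components_of_quot: "path_components_of T = topspace T // path_rel T"
  by (auto simp: path_components_of_def quotient_def path_rel_class)

lemma equiv_path_rel: "equiv (topspace T) (path_rel T)"
  by (rule equivI)
     (auto simp: path_rel_def refl_on_def path_component_of_refl
       intro!: symI transI dest: path_component_in_topspace path_component_of_sym path_component_of_trans)

lemma comb_pi0_map_quot: "comb_pi0_map L g = quot_map (comb_pi0_rel L) g"
  by (rule ext) (simp add: comb_pi0_map_def quot_map_def)

lemma top_pi0_map_quot: "top_pi0_map T f = quot_map (path_rel T) f"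
  by (rule ext) (simp add: top_pi0_map_def quot_map_def path_rel_class)

lemma Phi0_quot: "Phi0 K = quot_map (path_rel (realisation K)) vertex"
  by (rule ext) (simp add: Phi0_def quot_map_def path_rel_class)

section \<open>Loops and their homotopies in a topological space\<close>

lemma top_loops_iff:
  "p \<in> top_loops T b \<longleftrightarrow> continuous_map (top_of_set {0..1}) T p \<and> p 0 = b \<and> p 1 = b"
  by (simp add: top_loops_def pathin_def pathstart_def pathfinish_def)

lemma const_in_top_loops: "b \<in> topspace T \<Longrightarrow> (\<lambda>t. b) \<in> top_loops T b"
  by (simp add: top_loops_iff)

lemma equiv_top_loop_rel: "equiv (top_loops T b) (top_loop_rel T b)"
proof (rule equivI)
  show "refl_on (top_loops T b) (top_loop_rel T b)"
    by (simp add: refl_on_def top_loop_rel_def top_loops_def pathin_def)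
  show "sym (top_loop_rel T b)"
    by (auto simp: top_loop_rel_def intro!: symI homotopic_with_symD)
  show "trans (top_loop_rel T b)"
    by (auto simp: top_loop_rel_def intro!: transI elim: homotopic_with_trans)
qed (auto simp: top_loop_rel_def)

lemma join_in_top_loops:
  assumes p: "p \<in> top_loops T b" and q: "q \<in> top_loops T b"
  shows "p +++ q \<in> top_loops T b"
proof -
  let ?I = "top_of_set {0..1::real}"
  have "continuous_map ?I T (\<lambda>x. if x \<le> 1/2 then (p \<circ> (\<lambda>t. 2 * t)) x else (q \<circ> (\<lambda>t. 2 * t - 1)) x)"
  proof (intro continuous_map_cases_le)
    have "continuous_map (subtopology ?I {x \<in> topspace ?I. x \<le> 1/2}) ?I ((*) 2)"
      by (auto simp: continuous_map_in_subtopology continuous_map_from_subtopology)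
    then show "continuous_map (subtopology ?I {x \<in> topspace ?I. x \<le> 1/2}) T (p \<circ> (\<lambda>t. 2 * t))"
      using p continuous_map_compose unfolding top_loops_iff by blast
    have "continuous_map (subtopology ?I {x. 0 \<le> x \<and> x \<le> 1 \<and> 1 \<le> x * 2}) euclideanreal (\<lambda>t. 2 * t - 1)"
      by (intro continuous_intros) (force intro: continuous_map_from_subtopology)
    then have "continuous_map (subtopology ?I {x \<in> topspace ?I. 1/2 \<le> x}) ?I (\<lambda>t. 2 * t - 1)"
      by (force simp: continuous_map_in_subtopology)
    then show "continuous_map (subtopology ?I {x \<in> topspace ?I. 1/2 \<le> x}) T (q \<circ> (\<lambda>t. 2 * t - 1))"
      using q continuous_map_compose unfolding top_loops_iff by blast
    show "(p \<circ> (\<lambda>t. 2 * t)) x = (q \<circ> (\<lambda>t. 2 * t - 1)) x" if "x = 1/2" for x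
      using p q unfolding that by (simp add: top_loops_iff)
  qed (auto intro!: continuous_map_from_subtopology)
  moreover have "p +++ q =
      (\<lambda>x. if x \<le> 1/2 then (p \<circ> (\<lambda>t. 2 * t)) x else (q \<circ> (\<lambda>t. 2 * t - 1)) x)"
    by (simp add: joinpaths_def fun_eq_iff)
  ultimately have "continuous_map ?I T (p +++ q)"
    by (simp only:)
  then show ?thesis
    using p q by (simp add: top_loops_iff joinpaths_def)
qed

lemma compose_in_top_loops:
  assumes "continuous_map T T' f" "p \<in> top_loops T b"
  shows "f \<circ> p \<in> top_loops T' (f b)"
  using assms by (auto simp: top_loops_iff intro: continuous_map_compose)

lemma compose_top_loop_rel:
  assumes "continuous_map T T' f" "(p, q) \<in> top_loop_rel T b"
  shows "(f \<circ> p, f \<circ> q) \<in> top_loop_rel T' (f b)"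
  using assms compose_in_top_loops[OF assms(1)] unfolding top_loop_rel_def
  by (auto simp: pathstart_def pathfinish_def elim!: homotopic_with_compose_continuous_map_left)

lemma top_loops_top_of_set:
  "p \<in> top_loops (top_of_set S) b \<longleftrightarrow> path p \<and> path_image p \<subseteq> S \<and> pathstart p = b \<and> pathfinish p = b"
  by (auto simp: top_loops_def pathin_canon_iff path_image_def image_subset_iff_funcset)

text \<open>The bridge to the calculus of \<open>homotopic_paths\<close>, which supplies the group
  laws in the dilation.\<close>

lemma top_loop_rel_top_of_set:
  "(p, q) \<in> top_loop_rel (top_of_set S) b \<longleftrightarrow>
     p \<in> top_loops (top_of_set S) b \<and> homotopic_paths S p q"
proof -
  have "q \<in> top_loops (top_of_set S) b" if "p \<in> top_loops (top_of_set S) b" "homotopic_paths S p q"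
    using that homotopic_paths_imp_path homotopic_paths_imp_subset
      homotopic_paths_imp_pathstart homotopic_paths_imp_pathfinish
    unfolding top_loops_top_of_set by metis
  then show ?thesis
    by (auto simp: top_loop_rel_def homotopic_paths_def top_loops_def)
qed

lemma quot_group_top_of_set:
  fixes S :: "'a::real_normed_vector set"
  assumes b: "b \<in> S"
  shows "quot_group (top_loops (top_of_set S) b) (top_loop_rel (top_of_set S) b) (+++) (\<lambda>t. b)"
proof -
  let ?L = "top_loops (top_of_set S) b" and ?R = "top_loop_rel (top_of_set S) b"
  \<comment> \<open>The unit and inverse laws for \<open>homotopic_paths\<close> write constant
    paths as \<open>linepath b b\<close>.\<close>
  have const: "(\<lambda>t. b) = linepath b b"
    by (simp add: linepath_def fun_eq_iff flip: scaleR_add_left)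
  have "(p +++ q, p' +++ q') \<in> ?R" if "(p, p') \<in> ?R" "(q, q') \<in> ?R" for p p' q q'
  proof -
    have "p \<in> ?L" "q \<in> ?L" using that by (auto simp: top_loop_rel_def)
    then show ?thesis
      using that join_in_top_loops[of p _ b q]
      by (auto simp: top_loop_rel_top_of_set intro!: homotopic_paths_join) (auto simp: top_loops_def)
  qed
  moreover have "((p +++ q) +++ r, p +++ (q +++ r)) \<in> ?R" if "p \<in> ?L" "q \<in> ?L" "r \<in> ?L" for p q r
    using that join_in_top_loops[OF join_in_top_loops[OF that(1,2)] that(3)]
    unfolding top_loop_rel_top_of_set
    by (auto simp: top_loops_top_of_set intro!: homotopic_paths_sym[OF homotopic_paths_assoc])
  moreover have "((\<lambda>t. b) +++ p, p) \<in> ?R" if p: "p \<in> ?L" for p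
    using p join_in_top_loops[OF const_in_top_loops p] b
    unfolding top_loop_rel_top_of_set const
    by (auto simp: top_loops_top_of_set intro!: homotopic_paths_lid')
  moreover have "\<exists>q\<in>?L. (q +++ p, \<lambda>t. b) \<in> ?R" if p: "p \<in> ?L" for p
  proof
    show q: "reversepath p \<in> ?L"
      using p by (auto simp: top_loops_top_of_set)
    show "(reversepath p +++ p, \<lambda>t. b) \<in> ?R"
      using p homotopic_paths_linv[of p S] join_in_top_loops[OF q p]
      unfolding top_loop_rel_top_of_set const by (auto simp: top_loops_top_of_set)
  qed
  ultimately show ?thesis
    unfolding quot_group_def
    using equiv_top_loop_rel[of "top_of_set S" b] const_in_top_loops[of b "top_of_set S"] b
      join_in_top_loops[of _ "top_of_set S" b] by auto
qed

section \<open>Maps into the geometric realisation\<close>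

lemma linkage_complexD:
  assumes "linkage_complex K"
  shows "\<xi> \<in> linked K \<Longrightarrow> finite \<xi>" "\<xi> \<in> linked K \<Longrightarrow> \<xi> \<subseteq> points K"
    "y \<in> points K \<Longrightarrow> {y} \<in> linked K" "\<xi> \<in> linked K \<Longrightarrow> \<eta> \<subseteq> \<xi> \<Longrightarrow> \<eta> \<in> linked K"
  using assms by (auto simp: linkage_complex_def)

text \<open>Replaces the support and the sum, both varying with \<open>w\<close>, by closed
  conditions on the fixed finite set \<xi>. These conditions mention \<open>K\<close> no longer, so
  a set linked in two complexes spans the same simplex in both.\<close>

lemma realisation_set_iff:
  assumes K: "linkage_complex K" and \<xi>: "\<xi> \<in> linked K"
  shows "w \<in> realisation_set K \<and> fsupp w \<subseteq> \<xi> \<longleftrightarrow>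
     (\<forall>y. 0 \<le> w y) \<and> (\<forall>y. y \<notin> \<xi> \<longrightarrow> w y = 0) \<and> sum w \<xi> = 1"
proof -
  have fin: "finite \<xi>" using linkage_complexD(1)[OF K \<xi>] .
  have eq: "sum w (fsupp w) = sum w \<xi>" if "fsupp w \<subseteq> \<xi>"
    using fin that by (intro sum.mono_neutral_left) (auto simp: fsupp_def)
  have "w y \<le> 1" if "\<forall>y. 0 \<le> w y" "\<forall>y. y \<notin> \<xi> \<longrightarrow> w y = 0" "sum w \<xi> = 1" for y
    using that fin by (metis member_le_sum zero_le_one)
  moreover have "fsupp w \<subseteq> \<xi> \<longleftrightarrow> (\<forall>y. y \<notin> \<xi> \<longrightarrow> w y = 0)"
    by (auto simp: fsupp_def)
  ultimately show ?thesis
    using eq linkage_complexD(4)[OF K \<xi>] unfolding realisation_set_def by auto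
qed

lemma realisation_setI:
  assumes "linkage_complex K" "\<xi> \<in> linked K" "\<And>y. 0 \<le> w y" "\<And>y. y \<notin> \<xi> \<Longrightarrow> w y = 0" "sum w \<xi> = 1"
  shows "w \<in> realisation_set K"
  using realisation_set_iff[OF assms(1,2), of w] assms(3-5) by blast

lemma realisation_setD:
  assumes "linkage_complex K" "w \<in> realisation_set K"
  shows "fsupp w \<in> linked K" "finite (fsupp w)" "fsupp w \<noteq> {}" "0 \<le> w y"
    "finite \<xi> \<Longrightarrow> fsupp w \<subseteq> \<xi> \<Longrightarrow> sum w \<xi> = 1"
proof -
  show 1: "fsupp w \<in> linked K" "0 \<le> w y" "fsupp w \<noteq> {}"
    using assms(2) by (auto simp: realisation_set_def)
  show "finite (fsupp w)" using linkage_complexD(1)[OF assms(1) 1(1)] .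
  have "sum w (fsupp w) = 1" using assms(2) by (simp add: realisation_set_def)
  then show "sum w \<xi> = 1" if "finite \<xi>" "fsupp w \<subseteq> \<xi>"
    using sum.mono_neutral_left[OF that, of w] by (auto simp: fsupp_def)
qed

lemma convex_combination_realisation:
  assumes K: "linkage_complex K" and w: "w \<in> realisation_set K" "w' \<in> realisation_set K"
    and \<xi>: "fsupp w \<union> fsupp w' \<in> linked K" and t: "0 \<le> t" "t \<le> 1"
  shows "(\<lambda>y. (1 - t) * w y + t * w' y) \<in> realisation_set K"
proof (rule realisation_setI[OF K \<xi>])
  have fin: "finite (fsupp w \<union> fsupp w')" using linkage_complexD(1)[OF K \<xi>] .
  show "(\<Sum>y\<in>fsupp w \<union> fsupp w'. (1 - t) * w y + t * w' y) = 1"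
    using realisation_setD(5)[OF K w(1) fin] realisation_setD(5)[OF K w(2) fin]
    by (simp add: sum.distrib flip: sum_distrib_left)
  show "0 \<le> (1 - t) * w y + t * w' y" for y
    using realisation_setD(4)[OF K w(1), of y] realisation_setD(4)[OF K w(2), of y] t by simp
qed (auto simp: fsupp_def)

lemma closedin_simplex:
  assumes K: "linkage_complex K" and \<xi>: "\<xi> \<in> linked K"
  shows "closedin (powertop_real UNIV) (simplex_of K \<xi>)"
proof -
  have eq: "simplex_of K \<xi> =
      (\<Inter>y. {w \<in> topspace (powertop_real UNIV). w y \<in> (if y \<in> \<xi> then {0..} else {0})}) \<inter>
      {w \<in> topspace (powertop_real UNIV). sum w \<xi> \<in> {1}}"
    unfolding simplex_of_def mem_Collect_eq realisation_set_iff[OF K \<xi>]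
    by (auto split: if_splits) (metis order_refl)+
  have proj: "continuous_map (powertop_real UNIV) euclideanreal (\<lambda>w. w y)" for y :: 'a
    by (intro continuous_map_product_projection) auto
  have "continuous_map (powertop_real UNIV) euclideanreal (\<lambda>w. sum w \<xi>)"
    using proj linkage_complexD(1)[OF K \<xi>] by (intro continuous_map_sum)
  then have "closedin (powertop_real UNIV) {w \<in> topspace (powertop_real UNIV). sum w \<xi> \<in> {1}}"
    by (rule closedin_continuous_map_preimage) simp
  moreover have "closedin (powertop_real UNIV)
      {w \<in> topspace (powertop_real UNIV). w y \<in> (if y \<in> \<xi> then {0..} else {0})}" for y
    by (rule closedin_continuous_map_preimage[OF proj]) simp
  ultimately show ?thesis
    unfolding eq
    by (intro closedin_Int closedin_Inter) auto
qed

lemma closedin_realisation_Int_simplex: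
  assumes K: "linkage_complex K" and \<xi>: "\<xi> \<in> linked K" and C: "closedin (realisation K) C"
  shows "closedin (powertop_real UNIV) (C \<inter> simplex_of K \<xi>)"
proof -
  have "closedin (simplex_topology K \<xi>) {w \<in> topspace (simplex_topology K \<xi>). w \<in> C}"
    by (rule closedin_continuous_map_preimage[OF simplex_topology_into_realisation[OF \<xi>] C])
  moreover have "{w \<in> topspace (simplex_topology K \<xi>). w \<in> C} = C \<inter> simplex_of K \<xi>" by auto
  ultimately show ?thesis
    unfolding simplex_topology_def using closedin_simplex[OF K \<xi>] closedin_trans_full by metis
qed

text \<open>The direct limit topology is finer than that of the coordinates, but with all supports
  inside a finite \<open>F\<close> only finitely many simplices occur. The preimage of a closed set
  is then a finite union of preimages of its closed traces on these simplices.\<close>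

lemma continuous_map_into_realisation:
  assumes K: "linkage_complex K" and F: "finite F"
    and g: "\<And>x. x \<in> topspace T \<Longrightarrow> g x \<in> realisation_set K" "\<And>x. x \<in> topspace T \<Longrightarrow> fsupp (g x) \<subseteq> F"
    and cont: "\<And>y. continuous_map T euclideanreal (\<lambda>x. g x y)"
  shows "continuous_map T (realisation K) g"
  unfolding continuous_map_closedin
proof (intro conjI allI impI ballI)
  show "g \<in> topspace T \<rightarrow> topspace (realisation K)"
    using g(1) by simp
  fix C assume C: "closedin (realisation K) C"
  have pow: "continuous_map T (powertop_real UNIV) g"
    by (rule continuous_map_coordinatewise_then_product) (auto intro: cont)
  let ?\<Xi> = "{\<xi> \<in> linked K. \<xi> \<subseteq> F}"
  have "closedin T {x \<in> topspace T. g x \<in> C \<inter> simplex_of K \<xi>}" if "\<xi> \<in> ?\<Xi>" for \<xi>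
    using closedin_continuous_map_preimage[OF pow closedin_realisation_Int_simplex[OF K _ C]] that
    by blast
  moreover have "finite ?\<Xi>"
    using F by (auto intro: finite_subset[of _ "Pow F"])
  ultimately have "closedin T (\<Union>\<xi>\<in>?\<Xi>. {x \<in> topspace T. g x \<in> C \<inter> simplex_of K \<xi>})"
    by (intro closedin_Union) auto
  moreover have "(\<Union>\<xi>\<in>?\<Xi>. {x \<in> topspace T. g x \<in> C \<inter> simplex_of K \<xi>}) = {x \<in> topspace T. g x \<in> C}"
    using g realisation_setD(1)[OF K] by (fastforce simp: simplex_of_def)
  ultimately show "closedin T {x \<in> topspace T. g x \<in> C}" by simp
qed

lemma continuous_map_realisation_coordinate:
  "continuous_map (realisation K) euclideanreal (\<lambda>w. w y)"
proof (rule continuous_map_from_realisation)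
  show "continuous_map (simplex_topology K \<xi>) euclideanreal (\<lambda>w. w y)" for \<xi>
    unfolding simplex_topology_def
    by (intro continuous_map_from_subtopology continuous_map_product_projection) auto
qed simp

text \<open>If infinitely many vertices occurred, points of \<open>C\<close> chosen one for each
  vertex would form an infinite closed discrete subset of a compact set, because every simplex
  contains only finitely many of them.\<close>

lemma compactin_realisation_finite_support:
  assumes K: "linkage_complex K" and C: "compactin (realisation K) C"
  shows "finite (\<Union>w\<in>C. fsupp w)"
proof (rule ccontr)
  assume inf: "infinite (\<Union>w\<in>C. fsupp w)"
  have C_sub: "C \<subseteq> realisation_set K"
    using compactin_subset_topspace[OF C] by simp
  have "\<forall>y\<in>\<Union>w\<in>C. fsupp w. \<exists>w. w \<in> C \<and> y \<in> fsupp w" by blast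
  then obtain w where w: "\<And>y. y \<in> (\<Union>w\<in>C. fsupp w) \<Longrightarrow> w y \<in> C \<and> y \<in> fsupp (w y)"
    by metis
  define W where "W = w ` (\<Union>w\<in>C. fsupp w)"
  have W_C: "W \<subseteq> C" using w by (auto simp: W_def)
  have t1: "t1_space (powertop_real (UNIV :: 'a set))"
    by (simp add: t1_space_product_topology t1_space_euclidean)
  \<comment> \<open>For \<open>v\<close> in \<open>W\<close>, the only point of \<open>W\<close> in
    \<open>U v\<close> is \<open>v\<close>, so a finite subcover leaves only finitely many points in
    \<open>W\<close>.\<close>
  define U where "U v = realisation_set K - (W - {v})" for v
  have "openin (realisation K) (U v)" for v
    unfolding openin_realisation
  proof (intro conjI ballI impI)
    fix \<xi> assume \<xi>: "\<xi> \<in> linked K"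
    \<comment> \<open>A chosen point \<open>w y\<close> in this simplex has \<open>y\<close> in its
      support, hence \<open>y\<close> in \<xi>.\<close>
    have "(W - {v}) \<inter> simplex_of K \<xi> \<subseteq> w ` \<xi>"
      using w by (fastforce simp: W_def simplex_of_def)
    then have "finite ((W - {v}) \<inter> simplex_of K \<xi>)"
      using finite_subset linkage_complexD(1)[OF K \<xi>] by blast
    then have "closedin (simplex_topology K \<xi>) ((W - {v}) \<inter> simplex_of K \<xi>)"
      unfolding simplex_topology_def
      using t1 by (intro closedin_subset_topspace) (auto simp: t1_space_closedin_finite)
    then have "openin (simplex_topology K \<xi>)
        (topspace (simplex_topology K \<xi>) - (W - {v}) \<inter> simplex_of K \<xi>)"
      by (rule openin_diff[OF openin_topspace])
    moreover have "topspace (simplex_topology K \<xi>) - (W - {v}) \<inter> simplex_of K \<xi> =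
        U v \<inter> simplex_of K \<xi>"
      using simplex_of_subset[of K \<xi>] by (auto simp: U_def)
    ultimately show "openin (simplex_topology K \<xi>) (U v \<inter> simplex_of K \<xi>)" by simp
  qed (auto simp: U_def)
  moreover have "C \<subseteq> \<Union>(range U)"
    using C_sub by (auto simp: U_def)
  ultimately obtain \<F> where \<F>: "finite \<F>" "\<F> \<subseteq> range U" "C \<subseteq> \<Union>\<F>"
    using C unfolding compactin_def by (metis (no_types, lifting) rangeE)
  then obtain N where N: "finite N" "\<F> = U ` N"
    by (metis finite_subset_image)
  have "W \<subseteq> N"
  proof
    fix v assume v: "v \<in> W"
    then obtain v' where v': "v' \<in> N" "v \<in> U v'" using \<F>(3) N(2) W_C by blast
    then have "v = v'" using v by (simp add: U_def)
    then show "v \<in> N" using v' by simp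
  qed
  then have "finite W" using N(1) by (rule finite_subset)
  moreover have "finite (fsupp v)" if "v \<in> W" for v
    using realisation_setD(2)[OF K] that W_C C_sub by auto
  ultimately have "finite (\<Union>v\<in>W. fsupp v)" by simp
  moreover have "(\<Union>w\<in>C. fsupp w) \<subseteq> (\<Union>v\<in>W. fsupp v)"
  proof
    fix y assume "y \<in> (\<Union>w\<in>C. fsupp w)"
    then have "w y \<in> W" "y \<in> fsupp (w y)" using w by (auto simp: W_def)
    then show "y \<in> (\<Union>v\<in>W. fsupp v)" by blast
  qed
  ultimately show False
    using inf by (metis finite_subset)
qed

text \<open>The linkedness condition keeps each segment inside a simplex. Joint continuity is
  checked coordinatewise, which suffices because the two compact images involve finitely many
  vertices in all.\<close>

lemma straight_line_homotopy_realisation: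
  assumes K: "linkage_complex K" and p: "p \<in> top_loops (realisation K) b"
    and q: "q \<in> top_loops (realisation K) b"
    and lnk: "\<And>s. s \<in> {0..1} \<Longrightarrow> fsupp (p s) \<union> fsupp (q s) \<in> linked K"
  shows "(p, q) \<in> top_loop_rel (realisation K) b"
proof -
  let ?I = "top_of_set {0..1::real}"
  let ?h = "\<lambda>z y. (1 - fst z) * p (snd z) y + fst z * q (snd z) y"
  have cont: "continuous_map ?I (realisation K) p" "continuous_map ?I (realisation K) q"
    using p q by (auto simp: top_loops_iff)
  let ?F = "(\<Union>w\<in>p ` {0..1} \<union> q ` {0..1}. fsupp w)"
  have "compactin (realisation K) (p ` {0..1} \<union> q ` {0..1})"
    by (intro compactin_Un image_compactin[OF _ cont(1)] image_compactin[OF _ cont(2)])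
       (simp_all add: compactin_subtopology)
  then have F: "finite ?F"
    by (rule compactin_realisation_finite_support[OF K])
  have in_S: "p s \<in> realisation_set K" "q s \<in> realisation_set K" if "s \<in> {0..1}" for s
    using cont that by (auto simp: continuous_map_def Pi_iff)
  have "continuous_map (prod_topology ?I ?I) (realisation K) ?h"
  proof (rule continuous_map_into_realisation[OF K F])
    show "?h z \<in> realisation_set K" if "z \<in> topspace (prod_topology ?I ?I)" for z
      using that by (intro convex_combination_realisation[OF K] in_S lnk) auto
    show "fsupp (?h z) \<subseteq> ?F" if "z \<in> topspace (prod_topology ?I ?I)" for z
      using that by (fastforce simp: fsupp_def)
    have coord: "continuous_map (prod_topology ?I ?I) euclideanreal (\<lambda>z. r (snd z) y)"
      if "continuous_map ?I (realisation K) r" for r y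
      using continuous_map_compose[OF continuous_map_compose[OF continuous_map_snd[of ?I ?I] that]
          continuous_map_realisation_coordinate[of K y]]
      by (simp only: o_def)
    have fst: "continuous_map (prod_topology ?I ?I) euclideanreal fst"
      using continuous_map_fst[of ?I ?I] continuous_map_into_fulltopology by blast
    show "continuous_map (prod_topology ?I ?I) euclideanreal (\<lambda>z. ?h z y)" for y
      by (intro continuous_map_add continuous_map_real_mult continuous_map_diff
          coord[OF cont(1)] coord[OF cont(2)] fst) simp_all
  qed
  moreover have "pathstart (\<lambda>s. ?h (t, s)) = b \<and> pathfinish (\<lambda>s. ?h (t, s)) = b" for t
    using p q by (auto simp: top_loops_iff pathstart_def pathfinish_def algebra_simps fun_eq_iff)
  ultimately show ?thesis
    using p q unfolding top_loop_rel_def homotopic_with_def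
    by (auto intro!: exI[of _ ?h])
qed

lemma path_component_of_realisation:
  assumes K: "linkage_complex K" and w: "w \<in> realisation_set K" "w' \<in> realisation_set K"
    and \<xi>: "fsupp w \<union> fsupp w' \<in> linked K"
  shows "path_component_of (realisation K) w w'"
proof -
  let ?g = "\<lambda>t y. (1 - t) * w y + t * w' y"
  have "pathin (realisation K) ?g"
    unfolding pathin_def
  proof (rule continuous_map_into_realisation[OF K linkage_complexD(1)[OF K \<xi>]])
    show "?g t \<in> realisation_set K" if "t \<in> topspace (top_of_set {0..1})" for t
      using that by (intro convex_combination_realisation[OF K w \<xi>]) auto
    show "continuous_map (top_of_set {0..1}) euclideanreal (\<lambda>t. ?g t y)" for y
      by (auto intro!: continuous_intros)
  qed (auto simp: fsupp_def)
  moreover have "?g 0 = w" "?g 1 = w'" by auto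
  ultimately show ?thesis
    unfolding path_component_of_def by blast
qed

section \<open>Combinatorial loops\<close>

lemma simplicial_map_int_line:
  assumes K: "linkage_complex K"
  shows "simplicial_map int_line K a \<longleftrightarrow> (\<forall>i. {a i, a (i + 1)} \<in> linked K)"
proof
  assume a: "simplicial_map int_line K a"
  have "{i, i + 1} \<in> linked int_line" for i
    by (auto simp: int_line_def)
  then have "a ` {i, i + 1} \<in> linked K" for i
    using a unfolding simplicial_map_def by blast
  then show "\<forall>i. {a i, a (i + 1)} \<in> linked K"
    by simp
next
  assume a: "\<forall>i. {a i, a (i + 1)} \<in> linked K"
  then have "{a i} \<in> linked K" for i
    using linkage_complexD(4)[OF K, of "{a i, a (i + 1)}"] by blast
  moreover have "a i \<in> points K" for i
    using a linkage_complexD(2)[OF K] by blast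
  ultimately show "simplicial_map int_line K a"
    using a linkage_complexD(4)[OF K, of "{a i, a (i + 1)}" "{}" for i]
    by (auto simp: simplicial_map_def int_line_def)
qed

lemma simplicial_map_int_plane:
  assumes K: "linkage_complex K"
  shows "simplicial_map (prod_complex int_line int_line) K A \<longleftrightarrow>
     (\<forall>i j. {A (i, j), A (i + 1, j), A (i, j + 1), A (i + 1, j + 1)} \<in> linked K)"
    (is "_ \<longleftrightarrow> (\<forall>i j. ?Q i j \<in> _)")
proof
  assume a: "simplicial_map (prod_complex int_line int_line) K A"
  have "{(i, j), (i + 1, j), (i, j + 1), (i + 1, j + 1)} \<in> linked (prod_complex int_line int_line)" for i j
    by (auto simp: prod_complex_def int_line_def)
  then have "A ` {(i, j), (i + 1, j), (i, j + 1), (i + 1, j + 1)} \<in> linked K" for i j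
    using a unfolding simplicial_map_def by blast
  then show "\<forall>i j. ?Q i j \<in> linked K"
    by simp
next
  assume a: "\<forall>i j. ?Q i j \<in> linked K"
  have "A z \<in> points K" for z
    using a linkage_complexD(2)[OF K] by (cases z) blast
  moreover have "A ` \<xi> \<in> linked K" if \<xi>: "\<xi> \<in> linked (prod_complex int_line int_line)" for \<xi>
  proof -
    have sub: "\<exists>i. \<eta> \<subseteq> {i, i + 1}" if "\<eta> \<in> linked int_line" for \<eta>
      using that by (auto simp: int_line_def)
    obtain i j where "fst ` \<xi> \<subseteq> {i, i + 1}" "snd ` \<xi> \<subseteq> {j, j + 1}"
      using \<xi> sub by (auto simp: prod_complex_def) metis
    then have "\<xi> \<subseteq> {i, i + 1} \<times> {j, j + 1}"
      by (auto simp: image_subset_iff)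
    then have "A ` \<xi> \<subseteq> ?Q i j" by auto
    then show ?thesis
      using a linkage_complexD(4)[OF K] by blast
  qed
  ultimately show "simplicial_map (prod_complex int_line int_line) K A"
    by (simp add: simplicial_map_def)
qed

lemma comb_loops_iff:
  assumes "linkage_complex K"
  shows "a \<in> comb_loops K b \<longleftrightarrow>
     (\<forall>i. {a i, a (i + 1)} \<in> linked K) \<and> (\<exists>l u. loop_support b a l u)"
  by (simp add: comb_loops_def simplicial_map_int_line[OF assms])

lemma loop_support_mono:
  "loop_support b a l u \<Longrightarrow> l' \<le> l \<Longrightarrow> u \<le> u' \<Longrightarrow> loop_support b a l' u'"
  by (auto simp: loop_support_def)

text \<open>A position \<open>k\<close> with \<open>a k \<noteq> b\<close> lies strictly between
  every possible left end and every possible right end. The two ends can therefore be optimised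
  independently, each over a finite set bounded by \<open>k\<close> and the given support.\<close>

lemma rho_support:
  assumes ex: "loop_support b a l u" and nc: "\<not> (\<forall>i. a i = b)"
  shows "loop_support b a (rho_minus b a) (rho_plus b a)" "l \<le> rho_minus b a" "rho_plus b a \<le> u"
proof -
  obtain k where k: "a k \<noteq> b" using nc by blast
  define L where "L = {l'. \<forall>i\<le>l'. a i = b}"
  define V where "V = {u'. \<forall>i\<ge>u'. a i = b}"
  have lu: "l \<in> L" "u \<in> V" using ex by (auto simp: L_def V_def loop_support_def)
  have L_k: "l' < k" if "l' \<in> L" for l'
    by (rule ccontr) (use that k in \<open>simp add: L_def\<close>)
  have V_k: "k < u'" if "u' \<in> V" for u'
    by (rule ccontr) (use that k in \<open>simp add: V_def\<close>)
  have "l' \<le> u'" if "l' \<in> L" "u' \<in> V" for l' u'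
    using L_k[OF that(1)] V_k[OF that(2)] by simp
  then have iff: "loop_support b a l' u' \<longleftrightarrow> l' \<in> L \<and> u' \<in> V" for l' u'
    unfolding loop_support_def L_def V_def by blast
  have fin: "finite (L \<inter> {l..k})" "l \<in> L \<inter> {l..k}" "finite (V \<inter> {k..u})" "u \<in> V \<inter> {k..u}"
    using lu L_k[OF lu(1)] V_k[OF lu(2)] by simp_all
  define m where "m = Max (L \<inter> {l..k})"
  define n where "n = Min (V \<inter> {k..u})"
  have "m \<in> L \<inter> {l..k}" unfolding m_def by (rule Max_in[OF fin(1)]) (use fin(2) in blast)
  then have m: "m \<in> L" "l \<le> m" by simp_all
  have m': "l' \<le> m" if "l' \<in> L" for l'
  proof (cases "l \<le> l'")
    case True
    then have "l' \<in> L \<inter> {l..k}" using that L_k[OF that] by simp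
    then show ?thesis unfolding m_def by (rule Max_ge[OF fin(1)])
  qed (use m in auto)
  have "n \<in> V \<inter> {k..u}" unfolding n_def by (rule Min_in[OF fin(3)]) (use fin(4) in blast)
  then have n: "n \<in> V" "n \<le> u" by simp_all
  have n': "n \<le> u'" if "u' \<in> V" for u'
  proof (cases "u' \<le> u")
    case True
    then have "u' \<in> V \<inter> {k..u}" using that V_k[OF that] by simp
    then show ?thesis unfolding n_def by (rule Min_le[OF fin(3)])
  qed (use n in auto)
  have "rho_minus b a = m"
    unfolding rho_minus_def iff using nc m m' n(1) by (auto intro!: Greatest_equality)
  moreover have "rho_plus b a = n"
    unfolding rho_plus_def iff using nc n n' m by (auto intro!: Least_equality)
  ultimately show "loop_support b a (rho_minus b a) (rho_plus b a)" "l \<le> rho_minus b a" "rho_plus b a \<le> u"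
    using iff m n by auto
qed

lemma loop_support_rho:
  assumes "a \<in> comb_loops K b"
  shows "loop_support b a (rho_minus b a) (rho_plus b a)"
proof (cases "\<forall>i. a i = b")
  case True
  then show ?thesis by (simp add: loop_support_def rho_minus_def rho_plus_def)
next
  case False
  obtain l u where "loop_support b a l u" using assms by (auto simp: comb_loops_def)
  then show ?thesis using False by (rule rho_support(1))
qed

lemma const_in_comb_loops:
  assumes "linkage_complex K" "b \<in> points K"
  shows "(\<lambda>i. b) \<in> comb_loops K b"
proof -
  have "loop_support b (\<lambda>i. b) 0 0" by (simp add: loop_support_def)
  then show ?thesis
    unfolding comb_loops_iff[OF assms(1)] using linkage_complexD(3)[OF assms] by auto
qed

lemma loop_support_sum:
  assumes "loop_support b a (rho_minus b a) (rho_plus b a)"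
    "loop_support b a' (rho_minus b a') (rho_plus b a')"
  shows "loop_support b (loop_sum b a a') (rho_minus b a + rho_minus b a') (rho_plus b a + rho_plus b a')"
  using assms unfolding loop_support_def loop_sum_def by auto

lemma loop_sum_in_comb_loops:
  assumes K: "linkage_complex K" and a: "a \<in> comb_loops K b" and a': "a' \<in> comb_loops K b"
  shows "loop_sum b a a' \<in> comb_loops K b"
proof -
  note s = loop_support_rho[OF a] and s' = loop_support_rho[OF a']
  have "{loop_sum b a a' i, loop_sum b a a' (i + 1)} \<in> linked K" for i
  proof -
    consider "i + 1 \<le> rho_plus b a + rho_minus b a'" | "i = rho_plus b a + rho_minus b a'"
      | "i > rho_plus b a + rho_minus b a'"
      by linarith
    then show ?thesis
    proof cases
      case 1
      have "{a (i - rho_minus b a'), a (i - rho_minus b a' + 1)} \<in> linked K"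
        using a comb_loops_iff[OF K] by blast
      then show ?thesis using 1 by (simp add: loop_sum_def algebra_simps)
    next
      \<comment> \<open>The seam: \<open>a\<close> has already returned to \<open>b\<close> and
        \<open>a'\<close> has not yet left it, so this value may be read off from
        \<open>a'\<close>.\<close>
      case 2
      have "a (rho_plus b a) = b" "a' (rho_minus b a') = b"
        using s s' by (auto simp: loop_support_def)
      moreover have "{a' (rho_minus b a'), a' (rho_minus b a' + 1)} \<in> linked K"
        using a' comb_loops_iff[OF K] by blast
      ultimately show ?thesis using 2 by (simp add: loop_sum_def algebra_simps)
    next
      case 3
      have "{a' (i - rho_plus b a), a' (i - rho_plus b a + 1)} \<in> linked K"
        using a' comb_loops_iff[OF K] by blast
      then show ?thesis using 3 by (simp add: loop_sum_def algebra_simps)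
    qed
  qed
  then show ?thesis
    using loop_support_sum[OF s s'] comb_loops_iff[OF K] by blast
qed

section \<open>Combinatorial homotopies: reversal, gluing and reparametrisation\<close>

lemma comb_loop_rel_sym:
  assumes K: "linkage_complex K" and "(a, a') \<in> comb_loop_rel K b"
  shows "(a', a) \<in> comb_loop_rel K b"
proof -
  obtain A l u m n where C: "a \<in> comb_loops K b" "a' \<in> comb_loops K b"
    and A: "simplicial_map (prod_complex int_line int_line) K A" "l \<le> u" "m \<le> n"
      "\<forall>i j. i \<le> l \<or> u \<le> i \<longrightarrow> A (i, j) = b" "\<forall>i j. j \<le> m \<longrightarrow> A (i, j) = a i"
      "\<forall>i j. n \<le> j \<longrightarrow> A (i, j) = a' i"
    using assms(2) unfolding comb_loop_rel_def by blast
  define B where "B = (\<lambda>(i, j). A (i, - j))"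
  \<comment> \<open>Reflection carries the unit square between rows j and j + 1 to the one between
    rows - j - 1 and - j.\<close>
  have "{B (i, j), B (i + 1, j), B (i, j + 1), B (i + 1, j + 1)} =
      {A (i, - j - 1), A (i + 1, - j - 1), A (i, - j - 1 + 1), A (i + 1, - j - 1 + 1)}" for i j
    by (auto simp: B_def)
  then have "simplicial_map (prod_complex int_line int_line) K B"
    using A(1) unfolding simplicial_map_int_plane[OF K] by metis
  moreover have "\<forall>i j. i \<le> l \<or> u \<le> i \<longrightarrow> B (i, j) = b" "\<forall>i j. j \<le> - n \<longrightarrow> B (i, j) = a' i"
      "\<forall>i j. - m \<le> j \<longrightarrow> B (i, j) = a i" "- n \<le> - m"
    using A by (simp_all add: B_def)
  ultimately show ?thesis
    unfolding comb_loop_rel_def using C A(2) by blast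
qed

lemma comb_loop_rel_trans:
  assumes K: "linkage_complex K" and 1: "(a, a') \<in> comb_loop_rel K b" and 2: "(a', a'') \<in> comb_loop_rel K b"
  shows "(a, a'') \<in> comb_loop_rel K b"
proof -
  obtain A l u m n where C: "a \<in> comb_loops K b"
    and A: "simplicial_map (prod_complex int_line int_line) K A" "l \<le> u" "m \<le> n"
      "\<forall>i j. i \<le> l \<or> u \<le> i \<longrightarrow> A (i, j) = b" "\<forall>i j. j \<le> m \<longrightarrow> A (i, j) = a i"
      "\<forall>i j. n \<le> j \<longrightarrow> A (i, j) = a' i"
    using 1 unfolding comb_loop_rel_def by blast
  obtain B l' u' m' n' where C': "a'' \<in> comb_loops K b"
    and B: "simplicial_map (prod_complex int_line int_line) K B" "l' \<le> u'" "m' \<le> n'"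
      "\<forall>i j. i \<le> l' \<or> u' \<le> i \<longrightarrow> B (i, j) = b" "\<forall>i j. j \<le> m' \<longrightarrow> B (i, j) = a' i"
      "\<forall>i j. n' \<le> j \<longrightarrow> B (i, j) = a'' i"
    using 2 unfolding comb_loop_rel_def by blast
  \<comment> \<open>\<open>B\<close> is shifted so that its row \<open>m'\<close> falls on row
    \<open>n\<close> of \<open>A\<close>; both rows are \<open>a'\<close>.\<close>
  define D where "D = (\<lambda>(i, j). if j \<le> n then A (i, j) else B (i, j - n + m'))"
  have "{D (i, j), D (i + 1, j), D (i, j + 1), D (i + 1, j + 1)} \<in> linked K" for i j
  proof (cases "j < n")
    case True
    then show ?thesis
      using A(1)[unfolded simplicial_map_int_plane[OF K]] by (simp add: D_def)
  next
    case False
    then have "D (i, j) = B (i, j - n + m')" for i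
      using A(6) B(5) by (cases "j = n") (auto simp: D_def)
    moreover have "D (i, j + 1) = B (i, j - n + m' + 1)" for i
      using False by (simp add: D_def algebra_simps)
    ultimately show ?thesis
      using B(1)[unfolded simplicial_map_int_plane[OF K]] by simp
  qed
  then have D: "simplicial_map (prod_complex int_line int_line) K D"
    by (simp add: simplicial_map_int_plane[OF K])
  have "min l l' \<le> max u u'" "m \<le> n + (n' - m')" using A B by auto
  moreover have "\<forall>i j. i \<le> min l l' \<or> max u u' \<le> i \<longrightarrow> D (i, j) = b" using A(4) B(4) by (auto simp: D_def)
  moreover have "\<forall>i j. j \<le> m \<longrightarrow> D (i, j) = a i" using A(3,5) by (auto simp: D_def)
  moreover have "D (i, j) = a'' i" if "n + (n' - m') \<le> j" for i j
  proof (cases "j \<le> n")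
    \<comment> \<open>Row \<open>n\<close> is taken from \<open>A\<close>, so it shows
      \<open>a'\<close>; but here \<open>B\<close> has no intermediate rows, and \<open>a'\<close>
      and \<open>a''\<close> agree.\<close>
    case True
    then have "n' = m'" "j = n" using that B(3) by auto
    then show ?thesis using A(6) B(5)[rule_format, of m' i] B(6)[rule_format, of m' i] by (simp add: D_def)
  qed (use that B(6) in \<open>simp add: D_def\<close>)
  ultimately show ?thesis
    unfolding comb_loop_rel_def using C C' D by blast
qed

text \<open>Reparametrisations of \<int> that may pause but never skip or turn back. They arise when
  a loop is sampled more finely than its own unit steps; unboundedness on both sides makes the
  sample run through the whole loop.\<close>

definition step_map :: "(int \<Rightarrow> int) \<Rightarrow> bool" where
  "step_map \<phi> \<longleftrightarrow> (\<forall>i. \<phi> i \<le> \<phi> (i + 1) \<and> \<phi> (i + 1) \<le> \<phi> i + 1) \<and>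
     (\<forall>k. \<exists>i. \<phi> i \<le> k) \<and> (\<forall>k. \<exists>i. k \<le> \<phi> i)"

lemma step_map_mono: "step_map \<phi> \<Longrightarrow> i \<le> j \<Longrightarrow> \<phi> i \<le> \<phi> j"
proof -
  assume \<phi>: "step_map \<phi>" and "i \<le> j"
  from \<open>i \<le> j\<close> show ?thesis
    by (induction j rule: int_ge_induct) (use \<phi> in \<open>auto simp: step_map_def intro: order_trans\<close>)
qed

lemma linked_two_consecutive:
  assumes K: "linkage_complex K" and a: "\<forall>i. {a i, a (i + 1)} \<in> linked K"
    and "\<xi> \<subseteq> {k, k + 1}"
  shows "a ` \<xi> \<in> linked K"
proof (rule linkage_complexD(4)[OF K a[rule_format, of k]])
  show "a ` \<xi> \<subseteq> {a k, a (k + 1)}" using assms(3) by auto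
qed

lemma step_map_in_comb_loops:
  assumes K: "linkage_complex K" and a: "a \<in> comb_loops K b" and \<phi>: "step_map \<phi>"
  shows "a \<circ> \<phi> \<in> comb_loops K b"
proof -
  obtain l u where s: "loop_support b a l u" and e: "\<forall>i. {a i, a (i + 1)} \<in> linked K"
    using a comb_loops_iff[OF K] by blast
  have "{(a \<circ> \<phi>) i, (a \<circ> \<phi>) (i + 1)} \<in> linked K" for i
  proof -
    have "\<phi> i \<le> \<phi> (i + 1)" "\<phi> (i + 1) \<le> \<phi> i + 1"
      using \<phi> by (auto simp: step_map_def)
    then have "{\<phi> i, \<phi> (i + 1)} \<subseteq> {\<phi> i, \<phi> i + 1}" by auto
    from linked_two_consecutive[OF K e this] show ?thesis by simp
  qed
  moreover have "\<exists>l u. loop_support b (a \<circ> \<phi>) l u"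
  proof -
    obtain i j where ij: "\<phi> i \<le> l" "u \<le> \<phi> j" using \<phi> unfolding step_map_def by blast
    have "\<phi> k \<le> l" if "k \<le> i" for k using step_map_mono[OF \<phi> that] ij by simp
    moreover have "u \<le> \<phi> k" if "max i j \<le> k" for k using step_map_mono[OF \<phi>, of j k] that ij by simp
    ultimately have "loop_support b (a \<circ> \<phi>) i (max i j)"
      using s unfolding loop_support_def by auto
    then show ?thesis by blast
  qed
  ultimately show ?thesis using comb_loops_iff[OF K] by blast
qed

lemma step_map_max:
  assumes "step_map \<phi>" "step_map \<psi>"
  shows "step_map (\<lambda>i. max (\<phi> i) (\<psi> i))"
proof -
  have "\<exists>i. max (\<phi> i) (\<psi> i) \<le> k" for k
  proof -
    obtain i j where "\<phi> i \<le> k" "\<psi> j \<le> k" using assms unfolding step_map_def by blast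
    then show ?thesis
      using step_map_mono[OF assms(1), of "min i j" i] step_map_mono[OF assms(2), of "min i j" j]
      by (intro exI[of _ "min i j"]) auto
  qed
  moreover have "max (\<phi> i) (\<psi> i) \<le> max (\<phi> (i + 1)) (\<psi> (i + 1)) \<and>
      max (\<phi> (i + 1)) (\<psi> (i + 1)) \<le> max (\<phi> i) (\<psi> i) + 1" for i
  proof -
    have "\<phi> i \<le> \<phi> (i + 1)" "\<phi> (i + 1) \<le> \<phi> i + 1" "\<psi> i \<le> \<psi> (i + 1)" "\<psi> (i + 1) \<le> \<psi> i + 1"
      using assms by (auto simp: step_map_def)
    then show ?thesis by linarith
  qed
  moreover have "\<exists>i. k \<le> max (\<phi> i) (\<psi> i)" for k
    using assms(1) unfolding step_map_def le_max_iff_disj by blast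
  ultimately show ?thesis
    unfolding step_map_def by blast
qed

text \<open>The lattice operations are maps \<open>\<int>\<^sup>2 \<rightarrow> \<int>\<close> of complexes, so a reparametrised
  loop can be deformed through \<open>max (\<phi> i) (min (\<psi> i) j)\<close>.\<close>

lemma comb_loop_rel_step_max:
  assumes K: "linkage_complex K" and a: "a \<in> comb_loops K b" and \<phi>: "step_map \<phi>" and \<psi>: "step_map \<psi>"
  shows "(a \<circ> \<phi>, a \<circ> (\<lambda>i. max (\<phi> i) (\<psi> i))) \<in> comb_loop_rel K b"
proof -
  obtain l u where s: "loop_support b a l u" and e: "\<forall>i. {a i, a (i + 1)} \<in> linked K"
    using a comb_loops_iff[OF K] by blast
  have s1: "a i = b" if "i \<le> l \<or> u \<le> i" for i using s that by (auto simp: loop_support_def)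
  have lu: "l \<le> u" using s by (auto simp: loop_support_def)
  define \<theta> where "\<theta> i j = max (\<phi> i) (min (\<psi> i) j)" for i j
  define A where "A = (\<lambda>(i, j). a (\<theta> i j))"
  have "{A (i, j), A (i + 1, j), A (i, j + 1), A (i + 1, j + 1)} \<in> linked K" for i j
  proof -
    have 1: "\<phi> i \<le> \<phi> (i + 1)" "\<phi> (i + 1) \<le> \<phi> i + 1" "\<psi> i \<le> \<psi> (i + 1)" "\<psi> (i + 1) \<le> \<psi> i + 1"
      using \<phi> \<psi> unfolding step_map_def by auto
    \<comment> \<open>Maxima and minima of quantities that rise by 0 or 1 rise by 0 or 1 themselves,
      so the whole square falls on a single edge of the line.\<close>
    have "x \<in> {\<theta> i j, \<theta> i j + 1}" if "x \<in> {\<theta> (i + 1) j, \<theta> i (j + 1), \<theta> (i + 1) (j + 1)}" for x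
      using that 1 unfolding \<theta>_def max_def min_def by (auto split: if_splits)
    then have "{\<theta> i j, \<theta> (i + 1) j, \<theta> i (j + 1), \<theta> (i + 1) (j + 1)} \<subseteq> {\<theta> i j, \<theta> i j + 1}"
      by blast
    from linked_two_consecutive[OF K e this] show ?thesis
      by (simp add: A_def)
  qed
  then have A: "simplicial_map (prod_complex int_line int_line) K A"
    by (simp add: simplicial_map_int_plane[OF K])
  obtain i j j' where ij: "\<phi> i \<le> l" "u \<le> \<phi> j" "\<psi> j' \<le> l" using \<phi> \<psi> unfolding step_map_def by blast
  \<comment> \<open>On the left both maps must be at most \<open>l\<close>; on the right it is
    enough that \<phi> has passed \<open>u\<close>, since \<theta> is at least \<phi>. The outer
    maximum secures \<open>?l \<le> ?u\<close>.\<close>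
  let ?l = "min i j'" and ?u = "max j (min i j')"
  have "A (k, k') = b" if "k \<le> ?l \<or> ?u \<le> k" for k k'
  proof (cases "k \<le> ?l")
    case True
    then have "\<theta> k k' \<le> l"
      using step_map_mono[OF \<phi>, of k i] step_map_mono[OF \<psi>, of k j'] ij by (auto simp: \<theta>_def)
    then show ?thesis using s1 by (simp add: A_def)
  next
    case False
    then have "u \<le> \<theta> k k'"
      using step_map_mono[OF \<phi>, of j k] ij that by (auto simp: \<theta>_def)
    then show ?thesis using s1 by (simp add: A_def)
  qed
  \<comment> \<open>In these rows \<theta> differs from \<phi> only where both are at most
    \<open>l\<close>, and there \<open>a\<close> is \<open>b\<close>. The upper rows are treated
    symmetrically with \<open>u\<close>.\<close>
  moreover have "A (k, k') = (a \<circ> \<phi>) k" if "k' \<le> l" for k k'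
  proof (cases "\<phi> k \<le> l")
    case True
    then have "\<theta> k k' \<le> l" using that by (auto simp: \<theta>_def)
    then show ?thesis using True s1 by (simp add: A_def)
  next
    case False
    then have "\<theta> k k' = \<phi> k" using that by (auto simp: \<theta>_def)
    then show ?thesis by (simp add: A_def)
  qed
  moreover have "A (k, k') = (a \<circ> (\<lambda>i. max (\<phi> i) (\<psi> i))) k" if "u \<le> k'" for k k'
  proof (cases "u \<le> max (\<phi> k) (\<psi> k)")
    case True
    then have "u \<le> \<theta> k k'" using that by (auto simp: \<theta>_def)
    then show ?thesis using True s1 by (simp add: A_def)
  next
    case False
    then have "\<theta> k k' = max (\<phi> k) (\<psi> k)" using that by (auto simp: \<theta>_def)
    then show ?thesis by (simp add: A_def)
  qed
  moreover have "?l \<le> ?u" by simp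
  moreover note step_map_in_comb_loops[OF K a \<phi>]
    step_map_in_comb_loops[OF K a step_map_max[OF \<phi> \<psi>]]
  ultimately show ?thesis
    unfolding comb_loop_rel_def using A lu by blast
qed

text \<open>Both reparametrised loops deform to the one along the pointwise maximum. With the
  identity as one of the two maps, reparametrisation does not change the class of
  \<open>a\<close>.\<close>

lemma comb_loop_rel_step:
  assumes K: "linkage_complex K" and a: "a \<in> comb_loops K b" and \<phi>: "step_map \<phi>" and \<psi>: "step_map \<psi>"
  shows "(a \<circ> \<phi>, a \<circ> \<psi>) \<in> comb_loop_rel K b"
proof -
  have "(\<lambda>i. max (\<psi> i) (\<phi> i)) = (\<lambda>i. max (\<phi> i) (\<psi> i))" by (simp add: max.commute)
  then have "(a \<circ> (\<lambda>i. max (\<phi> i) (\<psi> i)), a \<circ> \<psi>) \<in> comb_loop_rel K b"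
    using comb_loop_rel_sym[OF K comb_loop_rel_step_max[OF K a \<psi> \<phi>]] by simp
  then show ?thesis
    by (rule comb_loop_rel_trans[OF K comb_loop_rel_step_max[OF K a \<phi> \<psi>]])
qed

section \<open>Realisation of combinatorial loops\<close>

lemma vertex_apply: "vertex y z = (if z = y then 1 else 0)"
  by (simp add: vertex_def indicator_def)

text \<open>The case r = 1, where the floor has already jumped, is included so that closed unit
  intervals can be glued.\<close>

lemma hat_affine:
  assumes "0 \<le> r" "r \<le> 1"
  shows "hat a (of_int m + r) = (\<lambda>y. (1 - r) * vertex (a m) y + r * vertex (a (m + 1)) y)"
proof (cases "r = 1")
  case True
  have "(of_int m + 1 :: real) = of_int (m + 1)" by simp
  then have "frac (of_int m + 1 :: real) = 0" "\<lfloor>of_int m + 1 :: real\<rfloor> = m + 1"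
    by (metis frac_of_int, metis floor_of_int)
  then show ?thesis using True by (simp add: hat_def)
next
  case False
  then have "\<lfloor>of_int m + r\<rfloor> = m" using assms by (intro floor_unique) auto
  moreover then have "frac (of_int m + r) = r" by (simp add: frac_def)
  ultimately show ?thesis by (simp add: hat_def)
qed

lemma hat_of_int: "hat a (of_int m) = vertex (a m)"
  using hat_affine[of 0 a m] by simp

lemma hat_base:
  assumes "loop_support b a l u" "t \<le> of_int l \<or> of_int u \<le> t"
  shows "hat a t = vertex b"
proof (cases "t = of_int l")
  case True
  then show ?thesis using assms by (simp add: hat_of_int loop_support_def)
next
  case False
  then have "\<lfloor>t\<rfloor> + 1 \<le> l \<or> u \<le> \<lfloor>t\<rfloor>"
    using assms(2) by (auto simp: le_floor_iff floor_less_iff add1_zle_eq)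
  then have "a \<lfloor>t\<rfloor> = b" "a (\<lfloor>t\<rfloor> + 1) = b"
    using assms(1) by (auto simp: loop_support_def)
  then show ?thesis by (simp add: hat_def fun_eq_iff algebra_simps)
qed

lemma fsupp_hat: "fsupp (hat a t) \<subseteq> {a \<lfloor>t\<rfloor>, a (\<lfloor>t\<rfloor> + 1)}"
  by (auto simp: fsupp_def hat_def vertex_apply split: if_splits)

lemma hat_in_realisation:
  assumes K: "linkage_complex K" and a: "{a \<lfloor>t\<rfloor>, a (\<lfloor>t\<rfloor> + 1)} \<in> linked K"
  shows "hat a t \<in> realisation_set K"
proof -
  have "a \<lfloor>t\<rfloor> \<in> points K" "a (\<lfloor>t\<rfloor> + 1) \<in> points K"
    using linkage_complexD(2)[OF K a] by auto
  then show ?thesis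
    unfolding hat_def using a frac_ge_0[of t] frac_lt_1[of t]
    by (intro convex_combination_realisation[OF K] vertex_in_realisation[OF K]) (auto simp: insert_commute)
qed

lemma continuous_on_hat: "continuous_on UNIV (\<lambda>t. hat a t y)"
proof -
  have seg: "continuous_on {of_int m..of_int m + 1} (\<lambda>t. hat a t y)" for m
  proof -
    have "continuous_on {of_int m..of_int m + 1}
        (\<lambda>t. (1 - (t - of_int m)) * vertex (a m) y + (t - of_int m) * vertex (a (m + 1)) y)"
      by (intro continuous_intros)
    moreover have "(1 - (t - of_int m)) * vertex (a m) y + (t - of_int m) * vertex (a (m + 1)) y = hat a t y"
      if "t \<in> {of_int m..of_int m + 1}" for t
      using hat_affine[of "t - of_int m" a m] that by simp
    ultimately show ?thesis by (rule continuous_on_eq)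
  qed
  have ivl: "continuous_on {of_int m..of_int m + of_nat n} (\<lambda>t. hat a t y)" for m n
  proof (induction n)
    case (Suc n)
    have "{of_int m..of_int m + of_nat (Suc n)} =
        {of_int m..of_int m + of_nat n} \<union> {of_int (m + int n)..of_int (m + int n) + 1 :: real}"
      by auto
    then show ?case
      using Suc seg[of "m + int n"] by (simp only: continuous_on_closed_Un closed_real_atLeastAtMost)
  qed simp
  have "isCont (\<lambda>t. hat a t y) t" for t
  proof -
    \<comment> \<open>Three unit intervals, the first one starting a unit before the floor, surround
      \<open>t\<close> even when it is an integer.\<close>
    have "t \<in> interior {of_int (\<lfloor>t\<rfloor> - 1)..of_int (\<lfloor>t\<rfloor> - 1) + of_nat 3}"
      by (simp add: interior_atLeastAtMost_real) linarith
    then show ?thesis using continuous_on_interior[OF ivl] by blast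
  qed
  then show ?thesis by (simp add: continuous_at_imp_continuous_on)
qed

lemma continuous_map_hat:
  assumes K: "linkage_complex K" and a: "a \<in> comb_loops K b"
  shows "continuous_map euclideanreal (realisation K) (hat a)"
proof -
  obtain l u where s: "loop_support b a l u" and e: "\<forall>i. {a i, a (i + 1)} \<in> linked K"
    using a comb_loops_iff[OF K] by blast
  have "range a \<subseteq> insert b (a ` {l..u})"
  proof
    fix y assume "y \<in> range a"
    then obtain i where i: "y = a i" by blast
    show "y \<in> insert b (a ` {l..u})"
    proof (cases "i \<in> {l..u}")
      case False
      then have "a i = b" using s by (auto simp: loop_support_def)
      then show ?thesis using i by simp
    qed (use i in blast)
  qed
  then have F: "finite (range a)" by (rule finite_subset) simp
  show ?thesis
  proof (rule continuous_map_into_realisation[OF K F])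
    show "hat a t \<in> realisation_set K" for t
      by (rule hat_in_realisation[OF K]) (rule e[rule_format])
    show "fsupp (hat a t) \<subseteq> range a" for t using fsupp_hat[of a t] by auto
    show "continuous_map euclideanreal euclideanreal (\<lambda>t. hat a t y)" for y
      using continuous_on_hat by auto
  qed
qed

text \<open>The interpolation takes place between the real parameters \<alpha> and \<beta>, before
  \<open>hat a\<close> is applied, so only the behaviour at the two ends has to be
  controlled.\<close>

lemma hat_compose_homotopic:
  assumes K: "linkage_complex K" and a: "a \<in> comb_loops K b"
    and cont: "continuous_on {0..1} \<alpha>" "continuous_on {0..1} \<beta>"
    and ends: "\<And>t. t \<in> {0..1} \<Longrightarrow> hat a ((1 - t) * \<alpha> 0 + t * \<beta> 0) = vertex b"
      "\<And>t. t \<in> {0..1} \<Longrightarrow> hat a ((1 - t) * \<alpha> 1 + t * \<beta> 1) = vertex b"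
  shows "(hat a \<circ> \<alpha>, hat a \<circ> \<beta>) \<in> top_loop_rel (realisation K) (vertex b)"
proof -
  let ?I = "top_of_set {0..1::real}"
  have loop: "hat a \<circ> \<gamma> \<in> top_loops (realisation K) (vertex b)"
    if "continuous_on {0..1} \<gamma>" "hat a (\<gamma> 0) = vertex b" "hat a (\<gamma> 1) = vertex b" for \<gamma>
    using that continuous_map_compose[OF _ continuous_map_hat[OF K a], of ?I \<gamma>]
    by (simp add: top_loops_iff)
  have "continuous_on ({0..1} \<times> {0..1}) (\<lambda>z. (1 - fst z) * \<alpha> (snd z) + fst z * \<beta> (snd z))"
    by (intro continuous_intros continuous_on_compose2[OF cont(1)] continuous_on_compose2[OF cont(2)]) auto
  then have "continuous_map (prod_topology ?I ?I) (realisation K)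
      (hat a \<circ> (\<lambda>z. (1 - fst z) * \<alpha> (snd z) + fst z * \<beta> (snd z)))"
    by (intro continuous_map_compose[OF _ continuous_map_hat[OF K a]]) simp
  then have "homotopic_with (\<lambda>r. pathstart r = vertex b \<and> pathfinish r = vertex b) ?I (realisation K)
      (hat a \<circ> \<alpha>) (hat a \<circ> \<beta>)"
    unfolding homotopic_with_def using ends
    by (intro exI[of _ "hat a \<circ> (\<lambda>z. (1 - fst z) * \<alpha> (snd z) + fst z * \<beta> (snd z))"])
       (simp add: pathstart_def pathfinish_def)
  moreover have "hat a \<circ> \<alpha> \<in> top_loops (realisation K) (vertex b)"
    using ends[of 0] by (intro loop cont) auto
  moreover have "hat a \<circ> \<beta> \<in> top_loops (realisation K) (vertex b)"
    using ends[of 1] by (intro loop cont) auto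
  ultimately show ?thesis by (simp add: top_loop_rel_def)
qed

text \<open>Frees all later arguments from the least support and its uniform parametrisation. The
  starting parameters lie on a half-line where \<open>hat a\<close> is constant, and so do the final
  ones; half-lines are convex, so interpolation keeps the base point.\<close>

lemma hat_loop_homotopic:
  assumes K: "linkage_complex K" and a: "a \<in> comb_loops K b" and s: "loop_support b a l u"
    and \<beta>: "continuous_on {0..1} \<beta>" "\<beta> 0 \<le> of_int l" "of_int u \<le> \<beta> 1"
  shows "(hat_loop b a, hat a \<circ> \<beta>) \<in> top_loop_rel (realisation K) (vertex b)"
proof -
  let ?l = "rho_minus b a" and ?u = "rho_plus b a"
  let ?\<alpha> = "\<lambda>s. of_int ?l + s * of_int (?u - ?l) :: real"
  have base: "hat a ((1 - t) * ?\<alpha> 0 + t * \<beta> 0) = vertex b \<and>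
      hat a ((1 - t) * ?\<alpha> 1 + t * \<beta> 1) = vertex b" if t: "t \<in> {0..1}" for t
  proof (cases "\<forall>i. a i = b")
    \<comment> \<open>For the constant loop the conventional support [0, 0] bears no relation to
      \<open>l\<close> and \<open>u\<close>, but \<open>hat a\<close> is constant
      everywhere.\<close>
    case True
    then show ?thesis by (simp add: hat_def fun_eq_iff algebra_simps)
  next
    case False
    note r = rho_support[OF s False]
    have "(1 - t) * of_int ?l + t * \<beta> 0 \<le> of_int ?l"
    proof -
      have "\<beta> 0 \<le> of_int ?l" using \<beta>(2) r(2) by linarith
      then have "t * \<beta> 0 \<le> t * of_int ?l" using t by (intro mult_left_mono) auto
      then show ?thesis by (simp add: algebra_simps)
    qed
    moreover have "of_int ?u \<le> (1 - t) * of_int ?u + t * \<beta> 1"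
    proof -
      have "of_int ?u \<le> \<beta> 1" using \<beta>(3) r(3) by linarith
      then have "t * of_int ?u \<le> t * \<beta> 1" using t by (intro mult_left_mono) auto
      then show ?thesis by (simp add: algebra_simps)
    qed
    ultimately show ?thesis using hat_base[OF r(1)] by simp
  qed
  have "hat_loop b a = hat a \<circ> ?\<alpha>" by (simp add: hat_loop_def fun_eq_iff)
  then show ?thesis
    using hat_compose_homotopic[OF K a, of ?\<alpha> \<beta>] base \<beta>(1) by (simp add: continuous_intros)
qed

lemma hat_loop_in_top_loops:
  assumes K: "linkage_complex K" and a: "a \<in> comb_loops K b"
  shows "hat_loop b a \<in> top_loops (realisation K) (vertex b)"
proof -
  have "(hat_loop b a, hat a \<circ> (\<lambda>s. of_int (rho_minus b a) + s * of_int (rho_plus b a - rho_minus b a)))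
      \<in> top_loop_rel (realisation K) (vertex b)"
    by (rule hat_loop_homotopic[OF K a loop_support_rho[OF a]]) (auto intro!: continuous_intros)
  then show ?thesis by (simp add: top_loop_rel_def)
qed

text \<open>The joined path is the realisation of the sum with another parametrisation: it spends
  half of the time on each summand, whereas \<open>hat_loop\<close> of the sum runs at uniform
  speed.\<close>

lemma hat_loop_sum:
  assumes K: "linkage_complex K" and a: "a \<in> comb_loops K b" and a': "a' \<in> comb_loops K b"
  shows "(hat_loop b (loop_sum b a a'), hat_loop b a +++ hat_loop b a')
    \<in> top_loop_rel (realisation K) (vertex b)"
proof -
  define l u l' u' where "l = rho_minus b a" and "u = rho_plus b a"
    and "l' = rho_minus b a'" and "u' = rho_plus b a'"
  note defs = l_def u_def l'_def u'_def
  have s: "loop_support b a l u" and s': "loop_support b a' l' u'"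
    using loop_support_rho[OF a] loop_support_rho[OF a'] by (simp_all add: defs)
  let ?c = "loop_sum b a a'"
  have sc: "loop_support b ?c (l + l') (u + u')"
    using loop_support_sum s s' by (simp add: defs)
  have lu: "l \<le> u" "l' \<le> u'" using s s' by (auto simp: loop_support_def)
  have end_eq: "a u = b" "a' l' = b" using s s' by (auto simp: loop_support_def)
  have left: "hat ?c (x + of_int l') = hat a x" if "x \<le> of_int u" for x
  \<comment> \<open>At x = u the formula for \<open>hat\<close> already refers to index u + 1,
    beyond the seam, so this point is compared directly.\<close>
  proof (cases "x = of_int u")
    case True
    have "hat ?c (of_int (u + l')) = vertex b" "hat a (of_int u) = vertex b"
      unfolding hat_of_int using end_eq by (simp_all add: loop_sum_def defs)
    then show ?thesis using True by simp
  next
    case False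
    then have "\<lfloor>x\<rfloor> + 1 \<le> u" using that by (simp add: floor_less_iff add1_zle_eq)
    moreover have "\<lfloor>x + of_int l'\<rfloor> = \<lfloor>x\<rfloor> + l'" "frac (x + of_int l') = frac x"
      by (simp_all add: frac_def)
    ultimately show ?thesis
      by (simp add: hat_def loop_sum_def defs)
  qed
  have right: "hat ?c (x + of_int u) = hat a' x" if "of_int l' \<le> x" for x
  proof -
    have "l' \<le> \<lfloor>x\<rfloor>" using that by (simp add: le_floor_iff)
    then have "?c (\<lfloor>x\<rfloor> + u) = a' \<lfloor>x\<rfloor>" "?c (\<lfloor>x\<rfloor> + 1 + u) = a' (\<lfloor>x\<rfloor> + 1)"
      using end_eq by (auto simp: loop_sum_def defs)
    moreover have "\<lfloor>x + of_int u\<rfloor> = \<lfloor>x\<rfloor> + u" "frac (x + of_int u) = frac x"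
      by (simp_all add: frac_def)
    ultimately show ?thesis
      by (simp add: hat_def add.commute add.left_commute)
  qed
  \<comment> \<open>The first half runs through the interval from l + l' to u + l', the second from
    u + l' to u + u'.\<close>
  define \<beta> :: "real \<Rightarrow> real" where "\<beta> s =
    (if s \<le> 1/2 then of_int l + (2 * s) * of_int (u - l) + of_int l'
     else of_int l' + (2 * s - 1) * of_int (u' - l') + of_int u)" for s
  have "continuous_on ({0..1/2} \<union> {1/2..1}) \<beta>"
    unfolding \<beta>_def
    by (intro continuous_on_If) (auto intro!: continuous_intros simp: algebra_simps)
  moreover have "{0..1/2} \<union> {1/2..1} = {0..1::real}" by auto
  ultimately have cont: "continuous_on {0..1} \<beta>" by simp
  have "hat_loop b a +++ hat_loop b a' = hat ?c \<circ> \<beta>"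
  proof
    fix s :: real
    show "(hat_loop b a +++ hat_loop b a') s = (hat ?c \<circ> \<beta>) s"
    proof (cases "s \<le> 1/2")
      case True
      then have "(2 * s) * of_int (u - l) \<le> 1 * of_int (u - l)"
        using lu by (intro mult_right_mono) auto
      then have "of_int l + (2 * s) * of_int (u - l) \<le> of_int u" by simp
      from left[OF this] show ?thesis
        using True by (simp add: joinpaths_def hat_loop_def \<beta>_def flip: defs)
    next
      case False
      then have "0 \<le> (2 * s - 1) * of_int (u' - l')" using lu by simp
      then have "of_int l' \<le> of_int l' + (2 * s - 1) * of_int (u' - l')" by simp
      from right[OF this] show ?thesis
        using False by (simp add: joinpaths_def hat_loop_def \<beta>_def flip: defs)
    qed
  qed
  then show ?thesis
    using hat_loop_homotopic[OF K loop_sum_in_comb_loops[OF K a a'] sc cont]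
    by (simp add: \<beta>_def)
qed

text \<open>A combinatorial homotopy passes from one row to the next inside the simplices
  spanned by its unit squares.\<close>

lemma hat_loop_comb_loop_rel:
  assumes K: "linkage_complex K" and r: "(a, a') \<in> comb_loop_rel K b"
  shows "(hat_loop b a, hat_loop b a') \<in> top_loop_rel (realisation K) (vertex b)"
proof -
  let ?R = "top_loop_rel (realisation K) (vertex b)"
  have refl: "\<And>p. p \<in> top_loops (realisation K) (vertex b) \<Longrightarrow> (p, p) \<in> ?R"
    and sym: "\<And>p q. (p, q) \<in> ?R \<Longrightarrow> (q, p) \<in> ?R"
    and trans: "\<And>p q r. (p, q) \<in> ?R \<Longrightarrow> (q, r) \<in> ?R \<Longrightarrow> (p, r) \<in> ?R"
    using equiv_top_loop_rel[of "realisation K" "vertex b"]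
    by (auto simp: equiv_def refl_on_def dest: symD transD)
  obtain A l u m n where C: "a \<in> comb_loops K b" "a' \<in> comb_loops K b"
    and A: "simplicial_map (prod_complex int_line int_line) K A" "l \<le> u" "m \<le> n"
      "\<forall>i j. i \<le> l \<or> u \<le> i \<longrightarrow> A (i, j) = b" "\<forall>i j. j \<le> m \<longrightarrow> A (i, j) = a i"
      "\<forall>i j. n \<le> j \<longrightarrow> A (i, j) = a' i"
    using r unfolding comb_loop_rel_def by blast
  define c where "c j i = A (i, j)" for i j
  have sq: "{c j i, c j (i + 1), c (j + 1) i, c (j + 1) (i + 1)} \<in> linked K" for i j
    using A(1) by (simp add: simplicial_map_int_plane[OF K] c_def)
  have "{c j i, c j (i + 1)} \<in> linked K" for i j
    by (rule linkage_complexD(4)[OF K sq[of j i]]) auto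
  moreover have s: "loop_support b (c j) l u" for j
    using A(2,4) by (auto simp: loop_support_def c_def)
  ultimately have c: "c j \<in> comb_loops K b" for j
    unfolding comb_loops_iff[OF K] by blast
  \<comment> \<open>Least supports change from row to row; a common parametrisation makes
    neighbouring rows comparable at equal times.\<close>
  define \<beta> :: "real \<Rightarrow> real" where "\<beta> s = of_int l + s * of_int (u - l)" for s
  have \<beta>: "continuous_on {0..1} \<beta>" "\<beta> 0 \<le> of_int l" "of_int u \<le> \<beta> 1"
    unfolding \<beta>_def by (auto intro!: continuous_intros)
  have hom: "(hat_loop b (c j), hat (c j) \<circ> \<beta>) \<in> ?R" for j
    by (rule hat_loop_homotopic[OF K c s \<beta>])
  have "(hat (c j) \<circ> \<beta>, hat (c (j + 1)) \<circ> \<beta>) \<in> ?R" for j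
  proof (rule straight_line_homotopy_realisation[OF K])
    show "hat (c j) \<circ> \<beta> \<in> top_loops (realisation K) (vertex b)"
      "hat (c (j + 1)) \<circ> \<beta> \<in> top_loops (realisation K) (vertex b)"
      using hom by (auto simp: top_loop_rel_def)
    show "fsupp ((hat (c j) \<circ> \<beta>) s) \<union> fsupp ((hat (c (j + 1)) \<circ> \<beta>) s) \<in> linked K" for s
      by (rule linkage_complexD(4)[OF K sq[of j "\<lfloor>\<beta> s\<rfloor>"]])
         (use fsupp_hat[of "c j" "\<beta> s"] fsupp_hat[of "c (j + 1)" "\<beta> s"] in auto)
  qed
  then have step: "(hat_loop b (c j), hat_loop b (c (j + 1))) \<in> ?R" for j
    using hom sym trans by meson
  have "(hat_loop b (c m), hat_loop b (c n)) \<in> ?R"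
    using A(3)
  proof (induction n rule: int_ge_induct)
    case base
    show ?case using refl hat_loop_in_top_loops[OF K c] by blast
  next
    case (step j)
    then show ?case using trans \<open>\<And>j. (hat_loop b (c j), hat_loop b (c (j + 1))) \<in> ?R\<close> by blast
  qed
  moreover have "c m = a" "c n = a'" using A(5,6) by (auto simp: c_def)
  ultimately show ?thesis by simp
qed

section \<open>Subdivision of the unit interval and simplicial approximation\<close>

lemma Lebesgue_number_path:
  fixes p :: "real \<Rightarrow> 'b"
  assumes p: "continuous_map (top_of_set {0..1}) T p" and V: "\<And>i. openin T (V i)"
    and cov: "p ` {0..1} \<subseteq> (\<Union>i. V i)"
  obtains \<delta> where "\<delta> > 0" "\<And>s. s \<in> {0..1} \<Longrightarrow> \<exists>i. \<forall>s'\<in>{0..1}. dist s s' < \<delta> \<longrightarrow> p s' \<in> V i"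
proof -
  \<comment> \<open>The target carries no metric, so the Lebesgue number is that of the preimages in
    the interval; these are only relatively open and are first extended to open sets of the
    line.\<close>
  have "\<exists>G. open G \<and> {s \<in> {0..1}. p s \<in> V i} = {0..1} \<inter> G" for i
    using openin_continuous_map_preimage[OF p V[of i]] by (simp add: openin_open)
  then obtain G where G: "\<And>i. open (G i)" "\<And>i. {s \<in> {0..1}. p s \<in> V i} = {0..1} \<inter> G i"
    by metis
  have "{0..1} \<subseteq> \<Union>(range G)"
  proof
    fix s :: real assume s: "s \<in> {0..1}"
    then obtain i where "p s \<in> V i" using cov by blast
    then have "s \<in> {0..1} \<inter> G i" using G(2)[of i] s by blast
    then show "s \<in> \<Union>(range G)" by blast
  qed
  then obtain \<delta> where \<delta>: "0 < \<delta>" "\<And>s. s \<in> {0..1} \<Longrightarrow> \<exists>H\<in>range G. ball s \<delta> \<subseteq> H"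
    using Heine_Borel_lemma[of "{0..1::real}" "range G"] G(1) by (metis compact_Icc rangeE)
  have "\<exists>i. \<forall>s'\<in>{0..1}. dist s s' < \<delta> \<longrightarrow> p s' \<in> V i" if s: "s \<in> {0..1}" for s
  proof -
    obtain i where i: "ball s \<delta> \<subseteq> G i" using \<delta>(2)[OF s] by blast
    have "p s' \<in> V i" if "s' \<in> {0..1}" "dist s s' < \<delta>" for s'
    proof -
      have "s' \<in> {0..1} \<inter> G i" using that i by auto
      then show ?thesis unfolding G(2)[symmetric] by simp
    qed
    then show ?thesis by blast
  qed
  then show thesis using \<delta>(1) that by blast
qed

text \<open>Clipping makes data sampled along the grid constant before 0 and after N, as the
  definition of a combinatorial loop requires.\<close>

definition grid :: "int \<Rightarrow> int \<Rightarrow> real" where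
  "grid N i = of_int (max 0 (min N i)) / of_int N"

lemma grid_in: "1 \<le> N \<Longrightarrow> grid N i \<in> {0..1}"
  by (auto simp: grid_def field_simps)

lemma grid_low: "1 \<le> N \<Longrightarrow> i \<le> 0 \<Longrightarrow> grid N i = 0"
  by (simp add: grid_def)

lemma grid_high: "1 \<le> N \<Longrightarrow> N \<le> i \<Longrightarrow> grid N i = 1"
  by (simp add: grid_def)

lemma grid_Suc:
  assumes "1 \<le> N"
  shows "dist (grid N i) (grid N (i + 1)) \<le> 1 / of_int N"
proof -
  have "\<bar>of_int (max 0 (min N i)) - of_int (max 0 (min N (i + 1))) :: real\<bar> \<le> 1" by linarith
  then show ?thesis
    using assms by (simp add: grid_def dist_real_def divide_right_mono flip: diff_divide_distrib)
qed

lemma grid_floor: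
  assumes N: "1 \<le> N" and s: "s \<in> {0..1}" and i: "i = \<lfloor>of_int N * s\<rfloor> \<or> i = \<lfloor>of_int N * s\<rfloor> + 1"
  shows "dist (grid N i) s \<le> 1 / of_int N"
proof -
  have Ns: "0 \<le> of_int N * s" "of_int N * s \<le> of_int N"
    using s N by (auto simp: mult_le_cancel_left2)
  then have fl: "0 \<le> \<lfloor>of_int N * s\<rfloor>" "\<lfloor>of_int N * s\<rfloor> \<le> N" by (auto simp: floor_le_iff)
  have "\<bar>of_int (max 0 (min N i)) - of_int N * s\<bar> \<le> 1"
  proof (cases "i \<le> N")
    case True
    then have "max 0 (min N i) = i" using i fl by auto
    then show ?thesis using i by (simp add: abs_le_iff) linarith
  next
    \<comment> \<open>This occurs only at s = 1, where i = N + 1 is clipped back to N.\<close>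
    case False
    then have "max 0 (min N i) = N" "\<lfloor>of_int N * s\<rfloor> = N" using i fl N by auto
    then show ?thesis using Ns by (simp add: abs_le_iff) linarith
  qed
  moreover have "of_int N * grid N i = of_int (max 0 (min N i))" using N by (simp add: grid_def)
  ultimately have "\<bar>of_int N * (grid N i - s)\<bar> \<le> 1" by (simp add: right_diff_distrib)
  then have "of_int N * dist (grid N i) s \<le> 1" using N by (simp add: abs_mult dist_real_def)
  then show ?thesis using N by (simp add: field_simps)
qed

text \<open>The bound \<open>M\<close> serves injectivity, where the grid must be at least as fine
  as the unit steps of the given loops.\<close>

lemma ex_grid:
  fixes \<delta> :: real
  assumes "0 < \<delta>"
  shows "\<exists>N::int. 1 \<le> N \<and> M \<le> N \<and> 1 / of_int N < \<delta>"
proof -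
  obtain n :: nat where n: "1 / \<delta> < n" using reals_Archimedean2 by blast
  define N where "N = max (max 1 M) (int n)"
  have "1 / \<delta> < of_int N" using n unfolding N_def by linarith
  moreover have "1 \<le> N" by (simp add: N_def)
  ultimately have "1 / of_int N < \<delta>" using assms by (simp add: field_simps)
  then show ?thesis using \<open>1 \<le> N\<close> by (auto simp: N_def)
qed

lemma open_star: "openin (realisation K) {w \<in> realisation_set K. 0 < w y}"
  using openin_continuous_map_preimage[OF continuous_map_realisation_coordinate[of K y], of "{0<..}"]
  by simp

text \<open>Simplicial approximation: the stars are so chosen that \<open>p s\<close> lies in those of both
  end points of the edge which carries \<open>hat a (N * s)\<close>.\<close>

lemma hat_loop_surj:
  assumes K: "linkage_complex K" and p: "p \<in> top_loops (realisation K) (vertex b)"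
  shows "\<exists>a\<in>comb_loops K b. (hat_loop b a, p) \<in> top_loop_rel (realisation K) (vertex b)"
proof -
  let ?R = "top_loop_rel (realisation K) (vertex b)"
  let ?V = "\<lambda>y. {w \<in> realisation_set K. 0 < w y}"
  have cont: "continuous_map (top_of_set {0..1}) (realisation K) p" and ends: "p 0 = vertex b" "p 1 = vertex b"
    using p by (auto simp: top_loops_iff)
  have in_S: "p s \<in> realisation_set K" if "s \<in> {0..1}" for s
    using cont that by (auto simp: continuous_map_def Pi_iff)
  have "p ` {0..1} \<subseteq> (\<Union>y. ?V y)"
  proof
    fix w assume "w \<in> p ` {0..1}"
    then have w: "w \<in> realisation_set K" using in_S by blast
    then obtain y where "w y \<noteq> 0" using realisation_setD(3)[OF K w] by (auto simp: fsupp_def)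
    then have "0 < w y" using realisation_setD(4)[OF K w, of y] by simp
    then show "w \<in> (\<Union>y. ?V y)" using w by blast
  qed
  then obtain \<delta> where \<delta>: "\<delta> > 0"
      "\<And>s. s \<in> {0..1} \<Longrightarrow> \<exists>y. \<forall>s'\<in>{0..1}. dist s s' < \<delta> \<longrightarrow> p s' \<in> ?V y"
    by (rule Lebesgue_number_path[OF cont open_star]) blast
  then have "\<forall>s\<in>{0..1}. \<exists>y. \<forall>s'\<in>{0..1}. dist s s' < \<delta> \<longrightarrow> p s' \<in> ?V y" by blast
  from bchoice[OF this] obtain x
    where "\<forall>s\<in>{0..1}. \<forall>s'\<in>{0..1}. dist s s' < \<delta> \<longrightarrow> p s' \<in> ?V (x s)"
    by blast
  then have x: "\<And>s s'. s \<in> {0..1} \<Longrightarrow> s' \<in> {0..1} \<Longrightarrow> dist s s' < \<delta> \<Longrightarrow> p s' \<in> ?V (x s)"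
    by blast
  \<comment> \<open>The support of \<open>vertex b\<close> is \<open>{b}\<close>, so no other star
    can have been chosen at the ends.\<close>
  have x_ends: "x 0 = b" "x 1 = b"
    using x[of 0 0] x[of 1 1] \<delta>(1) ends by (auto simp: vertex_apply split: if_splits)
  obtain N :: int where N: "N \<ge> 1" "1 / of_int N < \<delta>"
    using ex_grid[OF \<delta>(1), of 1] by blast
  define a where "a i = x (grid N i)" for i
  have near: "dist (grid N i) s < \<delta>"
    if "s \<in> {0..1}" "i = \<lfloor>of_int N * s\<rfloor> \<or> i = \<lfloor>of_int N * s\<rfloor> + 1" for i s
    using grid_floor[OF N(1) that] N(2) by linarith
  have pos: "{a \<lfloor>of_int N * s\<rfloor>, a (\<lfloor>of_int N * s\<rfloor> + 1)} \<subseteq> fsupp (p s)" if "s \<in> {0..1}" for s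
    using x[OF grid_in[OF N(1)] that near[OF that]] by (force simp: a_def fsupp_def)
  have s: "loop_support b a 0 N"
    using x_ends N(1) by (auto simp: loop_support_def a_def grid_low grid_high)
  have "{a i, a (i + 1)} \<in> linked K" for i
  proof (cases "0 \<le> i \<and> i \<le> N")
    case True
    \<comment> \<open>At the parameter i / N the support of \<open>p\<close> contains both
      \<open>a i\<close> and \<open>a (i + 1)\<close>, which are therefore linked.\<close>
    then have i: "of_int i / of_int N \<in> {0..1::real}" "\<lfloor>of_int N * (of_int i / of_int N) :: real\<rfloor> = i"
      using N(1) by auto
    then show ?thesis
      using linkage_complexD(4)[OF K realisation_setD(1)[OF K in_S[OF i(1)]] pos[OF i(1)]] by simp
  next
    case False
    then have "a i = b" "a (i + 1) = b" using s by (auto simp: loop_support_def)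
    moreover have "{b} \<in> linked K"
      using realisation_setD(1)[OF K in_S[of 0]] ends by simp
    ultimately show ?thesis by simp
  qed
  then have a: "a \<in> comb_loops K b" using s comb_loops_iff[OF K] by blast
  have hom: "(hat_loop b a, hat a \<circ> (\<lambda>s. of_int N * s)) \<in> ?R"
    by (rule hat_loop_homotopic[OF K a s]) (auto intro!: continuous_intros)
  have "(hat a \<circ> (\<lambda>s. of_int N * s), p) \<in> ?R"
  proof (rule straight_line_homotopy_realisation[OF K _ p])
    show "hat a \<circ> (\<lambda>s. of_int N * s) \<in> top_loops (realisation K) (vertex b)"
      using hom by (auto simp: top_loop_rel_def)
    fix s :: real assume s: "s \<in> {0..1}"
    \<comment> \<open>The simplex that carries \<open>p s\<close> contains the realised loop at the
      same time, so the two are joined by a segment.\<close>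
    have "fsupp (hat a (of_int N * s)) \<subseteq> fsupp (p s)"
      using fsupp_hat[of a "of_int N * s"] pos[OF s] by blast
    then show "fsupp ((hat a \<circ> (\<lambda>s. of_int N * s)) s) \<union> fsupp (p s) \<in> linked K"
      using realisation_setD(1)[OF K in_S[OF s]] by (simp add: Un_absorb1)
  qed
  then have "(hat_loop b a, p) \<in> ?R"
    using hom equiv_top_loop_rel[of "realisation K" "vertex b"] by (auto simp: equiv_def dest: transD)
  then show ?thesis using a by blast
qed

section \<open>Comparison with the spot dilation\<close>

lemma affine_ext_superset:
  assumes "finite F" "fsupp w \<subseteq> F"
  shows "affine_ext w = (\<Sum>x\<in>F. w x *\<^sub>R x)"
  unfolding affine_ext_def using assms by (intro sum.mono_neutral_left) (auto simp: fsupp_def)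

lemma affine_ext_hat:
  assumes "0 \<le> r" "r \<le> 1"
  shows "affine_ext (hat a (of_int m + r)) = (1 - r) *\<^sub>R a m + r *\<^sub>R a (m + 1)"
proof -
  have "affine_ext (\<lambda>y. (1 - r) * vertex x y + r * vertex x' y) = (1 - r) *\<^sub>R x + r *\<^sub>R x'"
    for x x' :: 'a
  \<comment> \<open>When the ends coincide, the set \<open>{x, x'}\<close> has one element and the
    two terms merge.\<close>
  proof (cases "x = x'")
    case True
    then have "(\<lambda>y. (1 - r) * vertex x y + r * vertex x' y) = vertex x"
      by (simp add: fun_eq_iff algebra_simps)
    then show ?thesis using True by (simp add: affine_ext_vertex flip: scaleR_add_left)
  next
    case False
    then show ?thesis
      by (subst affine_ext_superset[of "{x, x'}"]) (auto simp: fsupp_def vertex_apply split: if_splits)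
  qed
  then show ?thesis by (simp add: hat_affine[OF assms])
qed

lemma affine_ext_hat_floor:
  "affine_ext (hat a t) = (1 - frac t) *\<^sub>R a \<lfloor>t\<rfloor> + frac t *\<^sub>R a (\<lfloor>t\<rfloor> + 1)"
  using affine_ext_hat[of "frac t" a "\<lfloor>t\<rfloor>"] frac_lt_1[of t]
  by (simp add: frac_def algebra_simps)

text \<open>The ends are less than 2\<rho> apart, so \<open>z\<close> is within \<rho> of the nearer
  one. The ball around that end contains \<open>p\<close> too and is convex.\<close>

lemma closed_segment_near_endpoints:
  fixes x y z p :: "'a::real_normed_vector"
  assumes "dist x p < \<rho>" "dist y p < \<rho>" "z \<in> closed_segment x y"
  shows "closed_segment p z \<subseteq> ball x \<rho> \<union> ball y \<rho>"
proof -
  obtain \<tau> where \<tau>: "0 \<le> \<tau>" "\<tau> \<le> 1" "z = (1 - \<tau>) *\<^sub>R x + \<tau> *\<^sub>R y"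
    using assms(3) by (auto simp: in_segment)
  have xy: "dist x y < 2 * \<rho>" using dist_triangle2[of x y p] assms(1,2) by linarith
  have "x - z = \<tau> *\<^sub>R (x - y)" "y - z = (1 - \<tau>) *\<^sub>R (y - x)" using \<tau>(3) by (simp_all add: algebra_simps)
  then have d: "dist x z = \<tau> * dist x y" "dist y z = (1 - \<tau>) * dist x y"
    using \<tau>(1,2) by (simp_all add: dist_norm norm_minus_commute)
  have "dist x z < \<rho> \<or> dist y z < \<rho>"
  proof (cases "\<tau> \<le> 1/2")
    case True
    then have "\<tau> * dist x y \<le> 1/2 * dist x y" by (intro mult_right_mono) auto
    then show ?thesis using d xy by linarith
  next
    case False
    then have "(1 - \<tau>) * dist x y \<le> 1/2 * dist x y" by (intro mult_right_mono) auto
    then show ?thesis using d xy by linarith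
  qed
  then have "closed_segment p z \<subseteq> ball x \<rho> \<or> closed_segment p z \<subseteq> ball y \<rho>"
    using assms(1,2) by (metis closed_segment_subset convex_ball mem_ball)
  then show ?thesis by blast
qed

text \<open>The complexes between \<open>t\<^sub>\<epsilon>\<^sup>-X\<close> and \<open>t\<^sub>\<epsilon>X\<close>
  which the affine extension maps into the spot dilation; the flag condition reduces linkedness
  of unit squares to distances.\<close>

locale spot_complex =
  fixes X :: "'a::real_normed_vector set" and \<epsilon> :: real and K :: "'a complex_on"
  assumes eps: "0 < \<epsilon>" and K: "linkage_complex K" and points: "points K = X"
    and close_linked: "\<And>\<xi>. finite \<xi> \<Longrightarrow> \<xi> \<subseteq> X \<Longrightarrow> (\<And>x y. x \<in> \<xi> \<Longrightarrow> y \<in> \<xi> \<Longrightarrow> dist x y < \<epsilon>) \<Longrightarrow> \<xi> \<in> linked K"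
    and linked_diam: "\<And>\<xi> x y. \<xi> \<in> linked K \<Longrightarrow> x \<in> \<xi> \<Longrightarrow> y \<in> \<xi> \<Longrightarrow> dist x y \<le> \<epsilon>"
    and flag: "\<And>\<xi>. finite \<xi> \<Longrightarrow> (\<And>x y. x \<in> \<xi> \<Longrightarrow> y \<in> \<xi> \<Longrightarrow> {x, y} \<in> linked K) \<Longrightarrow> \<xi> \<in> linked K"
    and hull: "\<And>\<xi>. \<xi> \<in> linked K \<Longrightarrow> convex hull \<xi> \<subseteq> spot_dilation \<epsilon> X"
begin

abbreviation D :: "'a topology" where "D \<equiv> top_of_set (spot_dilation \<epsilon> X)"

abbreviation S :: "('a \<Rightarrow> real) topology" where "S \<equiv> realisation K"

lemma ball_subset_dilation: "x \<in> X \<Longrightarrow> ball x (\<epsilon> / 2) \<subseteq> spot_dilation \<epsilon> X"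
  by (auto simp: spot_dilation_def)

lemma base_in_dilation: "x \<in> X \<Longrightarrow> x \<in> spot_dilation \<epsilon> X"
  using ball_subset_dilation eps by force

lemma close_pair_linked: "x \<in> X \<Longrightarrow> y \<in> X \<Longrightarrow> dist x y < \<epsilon> \<Longrightarrow> {x, y} \<in> linked K"
  using eps by (intro close_linked) (auto simp: dist_commute)

lemma continuous_affine_ext: "continuous_map S D affine_ext"
  by (rule continuous_map_affine_ext[OF K hull])

lemma comb_loops_points: "a \<in> comb_loops K b \<Longrightarrow> a i \<in> X"
  using linkage_complexD(2)[OF K] points unfolding comb_loops_iff[OF K] by blast

text \<open>A Lebesgue number for the cover of \<open>C\<close> by the balls that make up the
  dilation. The choice is corrected at \<open>b\<close> so that base points go to base points; this
  is what the bound \<epsilon>/2 on \<open>e\<close> pays for.\<close>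

lemma nearby_center:
  assumes C: "compact C" "C \<subseteq> spot_dilation \<epsilon> X" and b: "b \<in> X"
  obtains e c where "0 < e" "c b = b" "\<And>z. z \<in> C \<Longrightarrow> c z \<in> X"
    "\<And>z z'. z \<in> C \<Longrightarrow> dist z z' < e \<Longrightarrow> dist (c z) z' < \<epsilon> / 2"
proof -
  have "C \<subseteq> \<Union>((\<lambda>x. ball x (\<epsilon> / 2)) ` X)"
    using C(2) by (force simp: spot_dilation_def)
  then obtain e0 where e0: "0 < e0" "\<And>z. z \<in> C \<Longrightarrow> \<exists>G\<in>(\<lambda>x. ball x (\<epsilon> / 2)) ` X. ball z e0 \<subseteq> G"
    by (rule Heine_Borel_lemma[OF C(1)]) auto
  have "\<forall>z\<in>C. \<exists>x. x \<in> X \<and> ball z e0 \<subseteq> ball x (\<epsilon> / 2)" using e0(2) by blast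
  from bchoice[OF this] obtain x where x: "\<forall>z\<in>C. x z \<in> X \<and> ball z e0 \<subseteq> ball (x z) (\<epsilon> / 2)"
    by blast
  define c where "c z = (if z = b then b else x z)" for z
  have "dist (c z) z' < \<epsilon> / 2" if "z \<in> C" "dist z z' < min e0 (\<epsilon> / 2)" for z z'
  proof (cases "z = b")
    case False
    have "z' \<in> ball z e0" using that by simp
    then have "z' \<in> ball (x z) (\<epsilon> / 2)" using x that(1) by blast
    then show ?thesis using False by (simp add: c_def)
  qed (use that in \<open>simp add: c_def\<close>)
  moreover have "c z \<in> X" if "z \<in> C" for z using x that b by (simp add: c_def)
  moreover have "0 < min e0 (\<epsilon> / 2)" "c b = b" using e0(1) eps by (simp_all add: c_def)
  ultimately show thesis using that by blast
qed

lemma dilation_loop_surj: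
  assumes b: "b \<in> X" and q: "q \<in> top_loops D b"
  shows "\<exists>a\<in>comb_loops K b. (affine_ext \<circ> hat_loop b a, q) \<in> top_loop_rel D b"
proof -
  have q': "path q" "path_image q \<subseteq> spot_dilation \<epsilon> X" "q 0 = b" "q 1 = b"
    using q by (auto simp: top_loops_top_of_set pathstart_def pathfinish_def)
  obtain e c where e: "0 < e" "c b = b" and c: "\<And>z. z \<in> path_image q \<Longrightarrow> c z \<in> X"
    "\<And>z z'. z \<in> path_image q \<Longrightarrow> dist z z' < e \<Longrightarrow> dist (c z) z' < \<epsilon> / 2"
    using nearby_center[OF compact_path_image[OF q'(1)] q'(2) b] by blast
  have "uniformly_continuous_on {0..1} q"
    using q'(1) by (intro compact_uniformly_continuous) (auto simp: path_def)
  then obtain \<delta> where \<delta>: "0 < \<delta>"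
    "\<And>s s'. s \<in> {0..1} \<Longrightarrow> s' \<in> {0..1} \<Longrightarrow> dist s s' < \<delta> \<Longrightarrow> dist (q s) (q s') < e"
    using e(1) unfolding uniformly_continuous_on_def by (metis dist_commute)
  obtain N :: int where N: "N \<ge> 1" "1 / of_int N < \<delta>"
    using ex_grid[OF \<delta>(1), of 1] by blast
  define a where "a i = c (q (grid N i))" for i
  have in_im: "q (grid N i) \<in> path_image q" for i
    using grid_in[OF N(1)] by (auto simp: path_image_def)
  have near: "dist (a i) (q s) < \<epsilon> / 2" if "s \<in> {0..1}" "dist (grid N i) s \<le> 1 / of_int N" for i s
    unfolding a_def using that N \<delta>(2) grid_in[OF N(1)] by (intro c(2) in_im) auto
  have s: "loop_support b a 0 N"
    using N(1) e(2) q' by (auto simp: loop_support_def a_def grid_low grid_high)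
  have "{a i, a (i + 1)} \<in> linked K" for i
  proof (rule close_pair_linked)
    \<comment> \<open>Both centres are compared with one and the same point of \<open>q\<close>,
      each at distance less than \<epsilon>/2.\<close>
    have "dist (a i) (q (grid N i)) < \<epsilon> / 2" using N(1) by (intro near grid_in) auto
    moreover have "dist (a (i + 1)) (q (grid N i)) < \<epsilon> / 2"
      using grid_Suc[OF N(1), of i] by (intro near grid_in[OF N(1)]) (auto simp: dist_commute)
    ultimately show "dist (a i) (a (i + 1)) < \<epsilon>"
      using dist_triangle2[of "a i" "a (i + 1)" "q (grid N i)"] by linarith
  qed (auto simp: a_def intro: c in_im)
  then have a: "a \<in> comb_loops K b" using s comb_loops_iff[OF K] by blast
  have hom: "(hat_loop b a, hat a \<circ> (\<lambda>s. of_int N * s)) \<in> top_loop_rel S (vertex b)"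
    by (rule hat_loop_homotopic[OF K a s]) (auto intro!: continuous_intros)
  from compose_top_loop_rel[OF continuous_affine_ext hom]
  have hom': "(affine_ext \<circ> hat_loop b a, affine_ext \<circ> (hat a \<circ> (\<lambda>s. of_int N * s))) \<in> top_loop_rel D b"
    by (simp add: affine_ext_vertex)
  then have l: "affine_ext \<circ> (hat a \<circ> (\<lambda>s. of_int N * s)) \<in> top_loops D b"
    by (auto simp: top_loop_rel_def)
  \<comment> \<open>At each time \<open>q s\<close> is strictly within \<epsilon>/2 of both ends of
    the edge on which the sampled loop then lies, so the segment between the two paths stays in two
    balls of the dilation.\<close>
  have "homotopic_paths (spot_dilation \<epsilon> X) q (affine_ext \<circ> (hat a \<circ> (\<lambda>s. of_int N * s)))"
  proof (rule homotopic_paths_linear)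
    fix s :: real assume s: "s \<in> {0..1}"
    let ?i = "\<lfloor>of_int N * s\<rfloor>"
    have "closed_segment (q s) (affine_ext (hat a (of_int N * s))) \<subseteq> ball (a ?i) (\<epsilon> / 2) \<union> ball (a (?i + 1)) (\<epsilon> / 2)"
    proof (rule closed_segment_near_endpoints)
      show "dist (a ?i) (q s) < \<epsilon> / 2" "dist (a (?i + 1)) (q s) < \<epsilon> / 2"
        by (rule near[OF s grid_floor[OF N(1) s]], simp)+
      show "affine_ext (hat a (of_int N * s)) \<in> closed_segment (a ?i) (a (?i + 1))"
        unfolding affine_ext_hat_floor in_segment
        using frac_lt_1[of "of_int N * s"] frac_ge_0[of "of_int N * s"] less_imp_le by blast
    qed
    also have "\<dots> \<subseteq> spot_dilation \<epsilon> X"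
      using ball_subset_dilation comb_loops_points[OF a] by blast
    finally show "closed_segment (q s) ((affine_ext \<circ> (hat a \<circ> (\<lambda>s. of_int N * s))) s) \<subseteq> spot_dilation \<epsilon> X"
      by simp
  qed (use l q in \<open>auto simp: top_loops_top_of_set\<close>)
  then have "(q, affine_ext \<circ> (hat a \<circ> (\<lambda>s. of_int N * s))) \<in> top_loop_rel D b"
    using q by (simp add: top_loop_rel_top_of_set)
  then have "(affine_ext \<circ> hat_loop b a, q) \<in> top_loop_rel D b"
    using hom' equiv_top_loop_rel[of D b] by (meson equiv_def symD transD)
  then show ?thesis using a by blast
qed

text \<open>Rounding selects the nearer end of an edge of length at most \<epsilon>. The bound is
  attained at the midpoint of an edge of length \<epsilon>, hence the weak inequality.\<close>

lemma dist_round_hat: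
  assumes a: "a \<in> comb_loops K b"
  shows "dist (a (round t)) (affine_ext (hat a t)) \<le> \<epsilon> / 2"
proof -
  define m where "m = \<lfloor>t\<rfloor>"
  have "{a m, a (m + 1)} \<in> linked K" using a comb_loops_iff[OF K] by blast
  then have d: "dist (a m) (a (m + 1)) \<le> \<epsilon>" by (rule linked_diam) auto
  let ?z = "(1 - frac t) *\<^sub>R a m + frac t *\<^sub>R a (m + 1)"
  have "a m - ?z = frac t *\<^sub>R (a m - a (m + 1))"
    "a (m + 1) - ?z = (1 - frac t) *\<^sub>R (a (m + 1) - a m)"
    by (simp_all add: algebra_simps)
  then have dz: "dist (a m) ?z = frac t * dist (a m) (a (m + 1))"
    "dist (a (m + 1)) ?z = (1 - frac t) * dist (a m) (a (m + 1))"
    using frac_lt_1[of t] by (simp_all add: dist_norm norm_minus_commute)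
  have half: "r * dist (a m) (a (m + 1)) \<le> \<epsilon> / 2" if "0 \<le> r" "r \<le> 1/2" for r
  proof -
    have "r * dist (a m) (a (m + 1)) \<le> 1/2 * \<epsilon>" using that d by (intro mult_mono) auto
    then show ?thesis by simp
  qed
  show ?thesis
  proof (cases "frac t < 1/2")
    case True
    then have "round t = m" by (simp add: round_altdef m_def)
    then show ?thesis
      using dz(1) half[of "frac t"] True by (simp add: affine_ext_hat_floor m_def)
  next
    case False
    then have "round t = m + 1" by (simp add: round_altdef m_def ceiling_altdef frac_def split: if_splits)
    then show ?thesis
      using dz(2) half[of "1 - frac t"] False frac_lt_1[of t] by (simp add: affine_ext_hat_floor m_def)
  qed
qed

end

text \<open>The slope w / N is at most 1, so rounded values never skip, and it is positive, so they
  are unbounded.\<close>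

lemma step_map_round:
  assumes "1 \<le> w" "w \<le> N"
  shows "step_map (\<lambda>i. round (of_int l + of_int w * of_int i / of_int N :: real))"
  unfolding step_map_def
proof (intro conjI allI)
  let ?f = "\<lambda>i. of_int l + of_int w * of_int i / of_int N :: real"
  have N: "0 < (of_int N :: real)" using assms by simp
  have f: "?f i \<le> ?f (i + 1)" "?f (i + 1) \<le> ?f i + 1" for i
    using assms N by (simp_all add: field_simps)
  show "round (?f i) \<le> round (?f (i + 1))" for i using f(1) by (rule round_mono)
  show "round (?f (i + 1)) \<le> round (?f i) + 1" for i
    using f(2)[of i] unfolding round_def by linarith
  \<comment> \<open>At multiples of N rounding is exact, which provides the witnesses for
    unboundedness.\<close>
  have at: "round (?f (N * k)) = l + w * k" for k
  proof -
    have "?f (N * k) = of_int (l + w * k)" using N by (simp add: field_simps)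
    then show ?thesis by (metis round_of_int)
  qed
  show "\<exists>i. round (?f i) \<le> k" for k
  proof -
    define m where "m = min 0 (k - l)"
    have "w * m \<le> 1 * m" using assms by (intro mult_right_mono_neg) (auto simp: m_def)
    moreover have "m \<le> k - l" by (simp add: m_def)
    ultimately have "l + w * m \<le> k" by linarith
    then show ?thesis using at[of m] by (intro exI[of _ "N * m"]) simp
  qed
  show "\<exists>i. k \<le> round (?f i)" for k
  proof -
    define m where "m = max 0 (k - l)"
    have "1 * m \<le> w * m" using assms by (intro mult_right_mono) (auto simp: m_def)
    moreover have "k - l \<le> m" by (simp add: m_def)
    ultimately have "k \<le> l + w * m" by linarith
    then show ?thesis using at[of m] by (intro exI[of _ "N * m"]) simp
  qed
qed

context spot_complex
begin

lemma comb_loop_normalised: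
  assumes a: "a \<in> comb_loops K b"
  obtains l w where "1 \<le> w" "loop_support b a l (l + w)"
    "(affine_ext \<circ> hat_loop b a, affine_ext \<circ> (hat a \<circ> (\<lambda>s. of_int l + of_int w * s))) \<in> top_loop_rel D b"
proof -
  obtain l u where s: "loop_support b a l u" using a by (auto simp: comb_loops_def)
  then have "l \<le> u" by (simp add: loop_support_def)
  \<comment> \<open>One extra unit keeps the width positive even when the support is a single
    point.\<close>
  define w where "w = u + 1 - l"
  have s': "loop_support b a l (l + w)" using loop_support_mono[OF s] by (simp add: w_def)
  have "(hat_loop b a, hat a \<circ> (\<lambda>s. of_int l + of_int w * s)) \<in> top_loop_rel S (vertex b)"
    by (rule hat_loop_homotopic[OF K a s']) (auto intro!: continuous_intros)
  from compose_top_loop_rel[OF continuous_affine_ext this]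
  show thesis
    using that[of w l] s' \<open>l \<le> u\<close> by (simp add: affine_ext_vertex w_def)
qed

text \<open>The grid points of a fine subdivision of the homotopy are replaced by near points of \<open>X\<close>;
  beyond the first and last rows, the boundary loops are replaced by their nearest vertices.\<close>

lemma dilation_loop_inj:
  assumes b: "b \<in> X" and a: "a \<in> comb_loops K b" and a': "a' \<in> comb_loops K b"
    and hom: "(affine_ext \<circ> hat_loop b a, affine_ext \<circ> hat_loop b a') \<in> top_loop_rel D b"
  shows "(a, a') \<in> comb_loop_rel K b"
proof -
  obtain l w where w: "1 \<le> w" and s: "loop_support b a l (l + w)"
    and h: "(affine_ext \<circ> hat_loop b a, affine_ext \<circ> (hat a \<circ> (\<lambda>s. of_int l + of_int w * s))) \<in> top_loop_rel D b"
    using comb_loop_normalised[OF a] by blast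
  obtain l' w' where w': "1 \<le> w'" and s': "loop_support b a' l' (l' + w')"
    and h': "(affine_ext \<circ> hat_loop b a', affine_ext \<circ> (hat a' \<circ> (\<lambda>s. of_int l' + of_int w' * s))) \<in> top_loop_rel D b"
    using comb_loop_normalised[OF a'] by blast
  let ?p = "affine_ext \<circ> (hat a \<circ> (\<lambda>s. of_int l + of_int w * s))"
  let ?p' = "affine_ext \<circ> (hat a' \<circ> (\<lambda>s. of_int l' + of_int w' * s))"
  have pp: "(?p, ?p') \<in> top_loop_rel D b"
    using equiv_top_loop_rel[of D b] h h' hom by (meson equiv_def symD transD)
  then have hp: "homotopic_paths (spot_dilation \<epsilon> X) ?p ?p'" and st: "pathstart ?p = b" "pathfinish ?p = b"
    unfolding top_loop_rel_top_of_set top_loops_top_of_set by blast+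
  from hp obtain F :: "real \<times> real \<Rightarrow> 'a" where F: "continuous_on ({0..1} \<times> {0..1}) F"
      "F \<in> ({0..1} \<times> {0..1}) \<rightarrow> spot_dilation \<epsilon> X"
      "\<forall>x\<in>{0..1}. F (0, x) = ?p x" "\<forall>x\<in>{0..1}. F (1, x) = ?p' x"
      "\<forall>t\<in>{0..1}. pathstart (F \<circ> Pair t) = b \<and> pathfinish (F \<circ> Pair t) = b"
    unfolding homotopic_paths st by blast
  let ?Q = "{0..1} \<times> {0..1} :: (real \<times> real) set"
  have Q: "compact ?Q" by (intro compact_Times compact_Icc)
  have im: "compact (F ` ?Q)" "F ` ?Q \<subseteq> spot_dilation \<epsilon> X"
    using compact_continuous_image[OF F(1) Q] F(2) by auto
  obtain e c where e: "0 < e" "c b = b" and c: "\<And>z. z \<in> F ` ?Q \<Longrightarrow> c z \<in> X"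
    "\<And>z z'. z \<in> F ` ?Q \<Longrightarrow> dist z z' < e \<Longrightarrow> dist (c z) z' < \<epsilon> / 2"
    using nearby_center[OF im b] by blast
  obtain \<delta> where \<delta>: "0 < \<delta>" "\<And>z z'. z \<in> ?Q \<Longrightarrow> z' \<in> ?Q \<Longrightarrow> dist z z' < \<delta> \<Longrightarrow> dist (F z) (F z') < e"
    using compact_uniformly_continuous[OF F(1) Q] e(1)
    unfolding uniformly_continuous_on_def by (metis dist_commute)
  \<comment> \<open>A bound of \<delta>/2 in each coordinate covers diagonal neighbours too;
    \<open>N \<ge> max w w'\<close> makes the rescaled indices step maps.\<close>
  obtain N :: int where N: "N \<ge> 1" "N \<ge> max w w'" "1 / of_int N < \<delta> / 2"
    using ex_grid[of "\<delta> / 2" "max w w'"] \<delta>(1) by auto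
  define \<phi> where "\<phi> i = round (of_int l + of_int w * of_int i / of_int N :: real)" for i
  define \<phi>' where "\<phi>' i = round (of_int l' + of_int w' * of_int i / of_int N :: real)" for i
  have \<phi>: "step_map \<phi>" and \<phi>': "step_map \<phi>'"
    unfolding \<phi>_def \<phi>'_def using w w' N by (auto intro!: step_map_round)
  define pt where "pt i j = F (grid N j, grid N i)" for i j
  \<comment> \<open>Rows 0 to N hold centres, also on the boundary of the homotopy. The vertices of
    the given loops occupy the rows outside, where \<open>pt\<close> is clipped to the boundary and
    so still names the point they approximate.\<close>
  define A where "A = (\<lambda>(i, j). if j < 0 then a (\<phi> i) else if N < j then a' (\<phi>' i) else c (pt i j))"
  have Q_grid: "(grid N j, grid N i) \<in> ?Q" for i j using grid_in[OF N(1)] by auto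
  have pt_in: "pt i j \<in> F ` ?Q" for i j unfolding pt_def using Q_grid by (rule imageI)
  have pt_near: "dist (pt i j) (pt i' j') < e"
    if "i' \<in> {i - 1, i, i + 1}" "j' \<in> {j - 1, j, j + 1}" for i j i' j'
  proof -
    have g: "dist (grid N k) (grid N k') < \<delta> / 2" if "k' \<in> {k - 1, k, k + 1}" for k k'
      using that grid_Suc[OF N(1), of k] grid_Suc[OF N(1), of "k - 1"] N(3) \<delta>(1)
      by (auto simp: dist_commute)
    have "dist (grid N j, grid N i) (grid N j', grid N i') \<le>
        dist (grid N j) (grid N j') + dist (grid N i) (grid N i')"
      unfolding dist_Pair_Pair by (rule sqrt_sum_squares_le_sum) auto
    also have "\<dots> < \<delta>" using g[OF that(1)] g[OF that(2)] by simp
    finally show ?thesis unfolding pt_def by (intro \<delta>(2) Q_grid)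
  qed
  \<comment> \<open>Outside the columns 0 to N the affine parameter leaves the support, where
    \<open>hat\<close> is constant, in agreement with the clipped grid.\<close>
  have row: "affine_ext (hat a0 (of_int l0 + of_int w0 * of_int i / of_int N)) = p0 (grid N i)"
    if "loop_support b a0 l0 (l0 + w0)" "1 \<le> w0"
      and p0: "p0 = affine_ext \<circ> (hat a0 \<circ> (\<lambda>s. of_int l0 + of_int w0 * s))" for a0 :: "int \<Rightarrow> 'a" and l0 w0 i p0
  proof -
    have ends: "p0 0 = b" "p0 1 = b"
      unfolding p0 using hat_base[OF that(1)] by (simp_all add: affine_ext_vertex)
    consider "i \<le> 0" | "N \<le> i" | "0 \<le> i" "i \<le> N" by linarith
    then show ?thesis
    proof cases
      case 1
      then have "of_int w0 * of_int i / of_int N \<le> (0::real)"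
        using that(2) N(1) by (simp add: divide_nonpos_pos mult_nonneg_nonpos)
      then have "of_int l0 + of_int w0 * of_int i / of_int N \<le> (of_int l0 :: real)" by simp
      then show ?thesis
        using hat_base[OF that(1)] 1 N(1) ends(1) by (simp add: affine_ext_vertex grid_low)
    next
      case 2
      then have "of_int w0 * of_int N \<le> (of_int w0 * of_int i :: real)"
        using that(2) by (intro mult_left_mono) auto
      then have "of_int (l0 + w0) \<le> of_int l0 + of_int w0 * of_int i / (of_int N :: real)"
        using N(1) by (simp add: field_simps)
      then show ?thesis
        using hat_base[OF that(1)] 2 N(1) ends(2) by (simp add: affine_ext_vertex grid_high)
    next
      case 3
      then show ?thesis by (simp add: p0 grid_def)
    qed
  qed
  have strict: "dist (A (i, j)) z < \<epsilon> / 2" if "0 \<le> j" "j \<le> N" "dist (pt i j) z < e" for i j z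
    using c(2)[OF pt_in that(3)] that(1,2) by (simp add: A_def)
  \<comment> \<open>In the outer rows \<open>pt\<close> is a point of a realised boundary loop and
    \<open>A\<close> is the vertex nearest to it.\<close>
  have weak: "dist (A (i, j)) (pt i j) \<le> \<epsilon> / 2" for i j
  proof -
    consider "j < 0" | "N < j" | "0 \<le> j" "j \<le> N" by linarith
    then show ?thesis
    proof cases
      case 1
      then have "pt i j = ?p (grid N i)"
        using F(3) grid_in[OF N(1)] N(1) by (simp add: pt_def grid_low)
      also have "\<dots> = affine_ext (hat a (of_int l + of_int w * of_int i / of_int N))"
        using row[OF s w refl, of i] by simp
      finally show ?thesis using dist_round_hat[OF a] 1 by (simp add: A_def \<phi>_def)
    next
      case 2
      then have "pt i j = ?p' (grid N i)"
        using F(4) grid_in[OF N(1)] N(1) by (simp add: pt_def grid_high)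
      also have "\<dots> = affine_ext (hat a' (of_int l' + of_int w' * of_int i / of_int N))"
        using row[OF s' w' refl, of i] by simp
      finally show ?thesis using dist_round_hat[OF a'] 2 N(1) by (simp add: A_def \<phi>'_def)
    next
      case 3
      then show ?thesis using strict[of j i "pt i j"] e(1) by simp
    qed
  qed
  have A_in: "A z \<in> X" for z
    using c(1)[OF pt_in] comb_loops_points[OF a] comb_loops_points[OF a'] by (cases z) (simp add: A_def)
  \<comment> \<open>Both distances are taken to \<open>pt i' j'\<close>: strict from the entry in
    rows 0 to N, which tolerates moving to a neighbour, and weak from the other entry.\<close>
  have pair_strict: "{A (i, j), A (i', j')} \<in> linked K"
    if "i' \<in> {i - 1, i, i + 1}" "j' \<in> {j - 1, j, j + 1}" "0 \<le> j" "j \<le> N" for i j i' j'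
  proof (rule close_pair_linked[OF A_in A_in])
    have "dist (A (i, j)) (pt i' j') < \<epsilon> / 2" by (rule strict[OF that(3,4) pt_near[OF that(1,2)]])
    then show "dist (A (i, j)) (A (i', j')) < \<epsilon>"
      using weak[of i' j'] dist_triangle2[of "A (i, j)" "A (i', j')" "pt i' j'"] by linarith
  qed
  \<comment> \<open>Two vertices of a given loop may be exactly \<epsilon> apart, so they are linked
    through the loop and not through distances.\<close>
  have row_linked: "{a0 (\<psi> i), a0 (\<psi> i')} \<in> linked K"
    if "a0 \<in> comb_loops K b" "step_map \<psi>" "i' \<in> {i - 1, i, i + 1}" for a0 :: "int \<Rightarrow> 'a" and \<psi> i i'
  proof -
    have "{(a0 \<circ> \<psi>) k, (a0 \<circ> \<psi>) (k + 1)} \<in> linked K" for k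
      using step_map_in_comb_loops[OF K that(1,2)] comb_loops_iff[OF K] by blast
    from this[of i] this[of "i - 1"]
    have "{a0 (\<psi> i), a0 (\<psi> (i + 1))} \<in> linked K" "{a0 (\<psi> i), a0 (\<psi> (i - 1))} \<in> linked K"
      by (simp_all add: insert_commute)
    moreover have "{a0 (\<psi> i)} \<in> linked K"
      using linkage_complexD(3)[OF K] comb_loops_points[OF that(1)] points by blast
    ultimately show ?thesis using that(3) by (elim insertE) auto
  qed
  have pair: "{A (i, j), A (i', j')} \<in> linked K"
    if i: "i' \<in> {i - 1, i, i + 1}" and j: "j' \<in> {j - 1, j, j + 1}" for i j i' j'
  proof -
    have i2: "i \<in> {i' - 1, i', i' + 1}" and j2: "j \<in> {j' - 1, j', j' + 1}" using i j by auto
    \<comment> \<open>Since N is at least 1, neighbouring rows cannot lie on opposite sides of the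
      strip from 0 to N.\<close>
    consider "0 \<le> j" "j \<le> N" | "0 \<le> j'" "j' \<le> N" | "j < 0" "j' < 0" | "N < j" "N < j'"
      using j N(1) by force
    then show ?thesis
    proof cases
      case 1
      then show ?thesis by (rule pair_strict[OF i j])
    next
      case 2
      then show ?thesis using pair_strict[OF i2 j2] by (simp add: insert_commute)
    next
      case 3
      then show ?thesis using row_linked[OF a \<phi> i] by (simp add: A_def)
    next
      case 4
      then show ?thesis using row_linked[OF a' \<phi>' i] N(1) by (simp add: A_def)
    qed
  qed
  have "{A (i, j), A (i + 1, j), A (i, j + 1), A (i + 1, j + 1)} \<in> linked K" for i j
  proof (rule flag)
    fix x y assume xy: "x \<in> {A (i, j), A (i + 1, j), A (i, j + 1), A (i + 1, j + 1)}"
      "y \<in> {A (i, j), A (i + 1, j), A (i, j + 1), A (i + 1, j + 1)}"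
    have "\<exists>i' j'. z = A (i', j') \<and> i' \<in> {i, i + 1} \<and> j' \<in> {j, j + 1}"
      if "z \<in> {A (i, j), A (i + 1, j), A (i, j + 1), A (i + 1, j + 1)}" for z
      using that by blast
    then obtain i1 j1 i2 j2 where "x = A (i1, j1)" "y = A (i2, j2)"
      "i1 \<in> {i, i + 1}" "j1 \<in> {j, j + 1}" "i2 \<in> {i, i + 1}" "j2 \<in> {j, j + 1}"
      using xy by meson
    then show "{x, y} \<in> linked K" using pair[of i2 i1 j2 j1] by auto
  qed simp
  then have A: "simplicial_map (prod_complex int_line int_line) K A"
    by (simp add: simplicial_map_int_plane[OF K])
  have base: "a0 (round (of_int l0 + of_int w0 * of_int i / of_int N :: real)) = b"
    if "loop_support b a0 l0 (l0 + w0)" "1 \<le> w0" "i \<le> 0 \<or> N \<le> i" for a0 :: "int \<Rightarrow> 'a" and l0 w0 i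
    using that(3)
  proof
    assume "i \<le> 0"
    then have "of_int w0 * of_int i / of_int N \<le> (0::real)"
      using that(2) N(1) by (simp add: divide_nonpos_pos mult_nonneg_nonpos)
    then have "round (of_int l0 + of_int w0 * of_int i / of_int N :: real) \<le> round (of_int l0 :: real)"
      by (intro round_mono) simp
    then show ?thesis using that(1) by (simp add: loop_support_def)
  next
    assume "N \<le> i"
    then have "of_int w0 * of_int N \<le> (of_int w0 * of_int i :: real)"
      using that(2) by (intro mult_left_mono) auto
    then have "of_int (l0 + w0) \<le> of_int l0 + of_int w0 * of_int i / (of_int N :: real)"
      using N(1) by (simp add: field_simps)
    then have "round (of_int (l0 + w0) :: real) \<le> round (of_int l0 + of_int w0 * of_int i / of_int N :: real)"
      by (rule round_mono)
    then show ?thesis using that(1) unfolding round_of_int by (simp add: loop_support_def)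
  qed
  have "A (i, j) = b" if i: "i \<le> 0 \<or> N \<le> i" for i j
  proof -
    \<comment> \<open>The homotopy fixes end points and \<open>c b = b\<close>, so the middle rows
      are also based at \<open>b\<close> in the outer columns.\<close>
    have "pt i j = b"
      using i F(5) grid_in[OF N(1)] N(1) by (auto simp: pt_def grid_low grid_high pathstart_def pathfinish_def)
    then show ?thesis
      using base[OF s w i] base[OF s' w' i] e(2) by (simp add: A_def \<phi>_def \<phi>'_def)
  qed
  moreover have "A (i, j) = (a \<circ> \<phi>) i" if "j \<le> -1" for i j using that by (simp add: A_def)
  moreover have "A (i, j) = (a' \<circ> \<phi>') i" if "N + 1 \<le> j" for i j using that N(1) by (simp add: A_def)
  moreover have "0 \<le> N" "-1 \<le> N + 1" using N(1) by auto
  ultimately have mid: "(a \<circ> \<phi>, a' \<circ> \<phi>') \<in> comb_loop_rel K b"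
    unfolding comb_loop_rel_def
    using A step_map_in_comb_loops[OF K a \<phi>] step_map_in_comb_loops[OF K a' \<phi>'] by blast
  \<comment> \<open>Comparison with the identity removes the reparametrisations \<phi> and \<phi>'
    that sampling has introduced.\<close>
  have id: "step_map (\<lambda>i. i)" by (auto simp: step_map_def)
  have "(a, a \<circ> \<phi>) \<in> comb_loop_rel K b" "(a' \<circ> \<phi>', a') \<in> comb_loop_rel K b"
    using comb_loop_rel_step[OF K a id \<phi>] comb_loop_rel_step[OF K a' \<phi>' id] by (simp_all add: o_def)
  then show ?thesis
    using mid comb_loop_rel_trans[OF K] by blast
qed

end

section \<open>Comparison of loop classes and the isomorphisms of fundamental groups\<close>

context spot_complex
begin

lemma comb_to_dilation:
  assumes b: "b \<in> X"
  shows "quot_equiv (comb_loops K b) (comb_loop_rel K b) ((\<circ>) affine_ext \<circ> hat_loop b)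
    (top_loops D b) (top_loop_rel D b)"
  unfolding quot_equiv_def
proof (intro conjI ballI)
  show "comb_loop_rel K b \<subseteq> comb_loops K b \<times> comb_loops K b"
    by (auto simp: comb_loop_rel_def)
  show "equiv (top_loops D b) (top_loop_rel D b)" by (rule equiv_top_loop_rel)
  show "(\<circ>) affine_ext \<circ> hat_loop b \<in> comb_loops K b \<rightarrow> top_loops D b"
    using compose_in_top_loops[OF continuous_affine_ext hat_loop_in_top_loops[OF K]]
    by (auto simp: affine_ext_vertex)
  show "(a, a') \<in> comb_loop_rel K b \<longleftrightarrow>
      (((\<circ>) affine_ext \<circ> hat_loop b) a, ((\<circ>) affine_ext \<circ> hat_loop b) a') \<in> top_loop_rel D b"
    if "a \<in> comb_loops K b" "a' \<in> comb_loops K b" for a a'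
  proof
    assume "(a, a') \<in> comb_loop_rel K b"
    from compose_top_loop_rel[OF continuous_affine_ext hat_loop_comb_loop_rel[OF K this]]
    show "(((\<circ>) affine_ext \<circ> hat_loop b) a, ((\<circ>) affine_ext \<circ> hat_loop b) a') \<in> top_loop_rel D b"
      by (simp add: affine_ext_vertex)
  qed (use dilation_loop_inj[OF b that] in simp)
  show "\<exists>a\<in>comb_loops K b. (((\<circ>) affine_ext \<circ> hat_loop b) a, q) \<in> top_loop_rel D b"
    if "q \<in> top_loops D b" for q
    using dilation_loop_surj[OF b that] by simp
qed

lemma realisation_to_dilation:
  assumes b: "b \<in> X"
  shows "quot_equiv (top_loops S (vertex b)) (top_loop_rel S (vertex b)) ((\<circ>) affine_ext)
    (top_loops D b) (top_loop_rel D b)"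
  unfolding quot_equiv_def
proof (intro conjI ballI)
  note q = quot_equivD[OF comb_to_dilation[OF b]]
  have sym: "\<And>T c p q. (p, q) \<in> top_loop_rel T c \<Longrightarrow> (q, p) \<in> top_loop_rel T c"
    and trans: "\<And>T c p q r. (p, q) \<in> top_loop_rel T c \<Longrightarrow> (q, r) \<in> top_loop_rel T c \<Longrightarrow> (p, r) \<in> top_loop_rel T c"
    using equiv_top_loop_rel unfolding equiv_def by (meson symD, meson transD)
  have push: "(affine_ext \<circ> p, affine_ext \<circ> p') \<in> top_loop_rel D b"
    if "(p, p') \<in> top_loop_rel S (vertex b)" for p p'
    using compose_top_loop_rel[OF continuous_affine_ext that] by (simp add: affine_ext_vertex)
  show "top_loop_rel S (vertex b) \<subseteq> top_loops S (vertex b) \<times> top_loops S (vertex b)"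
    by (auto simp: top_loop_rel_def)
  show "equiv (top_loops D b) (top_loop_rel D b)" by (rule equiv_top_loop_rel)
  show "(\<circ>) affine_ext \<in> top_loops S (vertex b) \<rightarrow> top_loops D b"
    using compose_in_top_loops[OF continuous_affine_ext, of _ "vertex b"]
    by (auto simp: affine_ext_vertex)
  show "(p, p') \<in> top_loop_rel S (vertex b) \<longleftrightarrow> (affine_ext \<circ> p, affine_ext \<circ> p') \<in> top_loop_rel D b"
    if p: "p \<in> top_loops S (vertex b)" and p': "p' \<in> top_loops S (vertex b)" for p p'
  proof
    assume r: "(affine_ext \<circ> p, affine_ext \<circ> p') \<in> top_loop_rel D b"
    \<comment> \<open>Injectivity is imported from combinatorial loops: both paths are replaced by
      realised loops, whose combinatorial homotopy is then realised.\<close>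
    obtain a where a: "a \<in> comb_loops K b" "(hat_loop b a, p) \<in> top_loop_rel S (vertex b)"
      using hat_loop_surj[OF K p] by blast
    obtain a' where a': "a' \<in> comb_loops K b" "(hat_loop b a', p') \<in> top_loop_rel S (vertex b)"
      using hat_loop_surj[OF K p'] by blast
    have "(affine_ext \<circ> hat_loop b a, affine_ext \<circ> hat_loop b a') \<in> top_loop_rel D b"
      by (rule trans[OF trans[OF push[OF a(2)] r] sym[OF push[OF a'(2)]]])
    then have "(a, a') \<in> comb_loop_rel K b" by (rule dilation_loop_inj[OF b a(1) a'(1)])
    then have "(hat_loop b a, hat_loop b a') \<in> top_loop_rel S (vertex b)"
      by (rule hat_loop_comb_loop_rel[OF K])
    then show "(p, p') \<in> top_loop_rel S (vertex b)"
      by (rule trans[OF trans[OF sym[OF a(2)]] a'(2)])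
  qed (rule push)
  show "\<exists>p\<in>top_loops S (vertex b). (affine_ext \<circ> p, q) \<in> top_loop_rel D b"
    if "q \<in> top_loops D b" for q
    using q(5)[OF that] hat_loop_in_top_loops[OF K] by auto
qed

lemma comb_to_realisation:
  assumes b: "b \<in> X"
  shows "quot_equiv (comb_loops K b) (comb_loop_rel K b) (hat_loop b)
    (top_loops S (vertex b)) (top_loop_rel S (vertex b))"
  using quot_equiv_cancel[OF comb_to_dilation[OF b] realisation_to_dilation[OF b]]
    hat_loop_in_top_loops[OF K] by blast

lemma vertex_in_S: "b \<in> X \<Longrightarrow> vertex b \<in> realisation_set K"
  using vertex_in_realisation[OF K] points by simp

text \<open>The two loops are in fact equal; the relation is the form in which the quotient lemmas
  expect a homomorphism law.\<close>

lemma join_affine_ext: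
  assumes b: "b \<in> X" and "p \<in> top_loops S (vertex b)" "q \<in> top_loops S (vertex b)"
  shows "(affine_ext \<circ> (p +++ q), (affine_ext \<circ> p) +++ (affine_ext \<circ> q)) \<in> top_loop_rel D b"
proof -
  have "affine_ext \<circ> (p +++ q) \<in> top_loops D b"
    using compose_in_top_loops[OF continuous_affine_ext join_in_top_loops[OF assms(2,3)]]
    by (simp add: affine_ext_vertex)
  then show ?thesis
    using equiv_top_loop_rel[of D b] by (simp add: equiv_def refl_on_def path_compose_join)
qed

lemma quot_group_realisation:
  assumes b: "b \<in> X"
  shows "quot_group (top_loops S (vertex b)) (top_loop_rel S (vertex b)) (+++) (\<lambda>t. vertex b)"
proof (rule quot_group_pullback[OF realisation_to_dilation[OF b] quot_group_top_of_set[OF base_in_dilation[OF b]]])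
  show c: "(\<lambda>t. vertex b) \<in> top_loops S (vertex b)"
    using const_in_top_loops[of "vertex b" S] vertex_in_S[OF b] by simp
  have "affine_ext \<circ> (\<lambda>t. vertex b) = (\<lambda>t. b)" by (simp add: fun_eq_iff affine_ext_vertex)
  then show "(affine_ext \<circ> (\<lambda>t. vertex b), \<lambda>t. b) \<in> top_loop_rel D b"
    using equiv_top_loop_rel[of D b] const_in_top_loops[of b D] base_in_dilation[OF b]
    by (simp add: equiv_def refl_on_def affine_ext_vertex)
  show "(+++) \<in> top_loops S (vertex b) \<rightarrow> top_loops S (vertex b) \<rightarrow> top_loops S (vertex b)"
    using join_in_top_loops by auto
qed (rule join_affine_ext[OF b])

text \<open>Compatibility of \<open>loop_sum\<close> with homotopy, associativity and inverses thus
  come without combinatorial constructions, from \<open>hat_loop_sum\<close> alone.\<close>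

lemma quot_group_comb:
  assumes b: "b \<in> X"
  shows "quot_group (comb_loops K b) (comb_loop_rel K b) (loop_sum b) (\<lambda>i. b)"
proof (rule quot_group_pullback[OF comb_to_realisation[OF b] quot_group_realisation[OF b]])
  show "(\<lambda>i. b) \<in> comb_loops K b" using const_in_comb_loops[OF K] points b by simp
  have "hat_loop b (\<lambda>i. b) = (\<lambda>t. vertex b)"
    by (simp add: hat_loop_def hat_def fun_eq_iff algebra_simps)
  then show "(hat_loop b (\<lambda>i. b), \<lambda>t. vertex b) \<in> top_loop_rel S (vertex b)"
    using equiv_top_loop_rel[of S "vertex b"] const_in_top_loops[of "vertex b" S] vertex_in_S[OF b]
    by (simp add: equiv_def refl_on_def)
  show "loop_sum b \<in> comb_loops K b \<rightarrow> comb_loops K b \<rightarrow> comb_loops K b"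
    using loop_sum_in_comb_loops[OF K] by blast
qed (rule hat_loop_sum[OF K])

lemma pi1_isos:
  assumes b: "b \<in> X"
  shows "group_iso (Phi1 K b) (comb_pi1 K b) (top_pi1 S (vertex b))"
    and "group_iso (top_pi1_map D b affine_ext) (top_pi1 S (vertex b)) (top_pi1 D b)"
    and "group_iso (top_pi1_map D b affine_ext \<circ> Phi1 K b) (comb_pi1 K b) (top_pi1 D b)"
proof -
  show 1: "group_iso (Phi1 K b) (comb_pi1 K b) (top_pi1 S (vertex b))"
    unfolding Phi1_quot comb_pi1_quot top_pi1_quot
    by (rule quot_group_iso[OF comb_to_realisation[OF b] quot_group_comb[OF b] quot_group_realisation[OF b]])
       (rule hat_loop_sum[OF K])
  show 2: "group_iso (top_pi1_map D b affine_ext) (top_pi1 S (vertex b)) (top_pi1 D b)"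
    unfolding top_pi1_map_quot top_pi1_quot
    by (rule quot_group_iso[OF realisation_to_dilation[OF b] quot_group_realisation[OF b]
          quot_group_top_of_set[OF base_in_dilation[OF b]]])
       (rule join_affine_ext[OF b])
  show "group_iso (top_pi1_map D b affine_ext \<circ> Phi1 K b) (comb_pi1 K b) (top_pi1 D b)"
    using 1 2 unfolding group_iso_def by (auto intro: iso_set_trans)
qed

section \<open>Path components\<close>

lemma path_component_dilation_imp_comb:
  assumes x: "x \<in> X" and y: "y \<in> X" and path: "path_component (spot_dilation \<epsilon> X) x y"
  shows "(x, y) \<in> comb_pi0_rel K"
proof (rule ccontr)
  assume neg: "(x, y) \<notin> comb_pi0_rel K"
  define Y where "Y = {z \<in> X. (x, z) \<in> comb_pi0_rel K}"
  \<comment> \<open>The balls around the class of \<open>x\<close> and those around the remaining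
    points of \<open>X\<close> are open and cover the dilation. A common point would put two centres
    less than \<epsilon> apart and link them, so the connected image of a path cannot meet both
    unions.\<close>
  define U V where "U = (\<Union>z\<in>Y. ball z (\<epsilon> / 2))" and "V = (\<Union>z\<in>X - Y. ball z (\<epsilon> / 2))"
  have xY: "x \<in> Y" using x points by (simp add: Y_def comb_pi0_rel_def equivclp_def)
  have yY: "y \<in> X - Y" using y neg by (simp add: Y_def)
  obtain p where p: "path p" "path_image p \<subseteq> spot_dilation \<epsilon> X" "pathstart p = x" "pathfinish p = y"
    using path unfolding path_component_def by blast
  have "U \<inter> V = {}"
  proof (rule ccontr)
    assume "U \<inter> V \<noteq> {}"
    then obtain v where "v \<in> U" "v \<in> V" by blast
    then obtain z z' where z: "z \<in> Y" "z' \<in> X - Y" "dist z v < \<epsilon> / 2" "dist z' v < \<epsilon> / 2"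
      unfolding U_def V_def UN_iff mem_ball by blast
    then have "dist z z' < \<epsilon>" using dist_triangle2[of z z' v] by linarith
    then have "{z, z'} \<in> linked K" using z by (intro close_pair_linked) (auto simp: Y_def)
    then have "equivclp (\<lambda>u v. {u, v} \<in> linked K) x z'"
      using z(1) by (auto simp: Y_def comb_pi0_rel_def intro: equivclp_into_equivclp)
    then have "z' \<in> Y" using z(2) x points by (simp add: Y_def comb_pi0_rel_def)
    then show False using z(2) by simp
  qed
  moreover have "open U" "open V" by (auto simp: U_def V_def)
  moreover have "path_image p \<subseteq> U \<union> V"
    using p(2) by (fastforce simp: U_def V_def spot_dilation_def)
  moreover have "x \<in> U" "y \<in> V"
    using xY yY eps unfolding U_def V_def by (force intro: UN_I)+
  moreover have "x \<in> path_image p" "y \<in> path_image p"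
    using p pathstart_in_path_image[of p] pathfinish_in_path_image[of p] by simp_all
  ultimately show False
    using connectedD[OF connected_path_image[OF p(1)], of U V] by blast
qed

lemma points_to_dilation:
  "quot_equiv X (comb_pi0_rel K) (affine_ext \<circ> vertex) (topspace D) (path_rel D)"
  unfolding quot_equiv_def
proof (intro conjI ballI)
  show "comb_pi0_rel K \<subseteq> X \<times> X" using points by (auto simp: comb_pi0_rel_def)
  show "equiv (topspace D) (path_rel D)" by (rule equiv_path_rel)
  show "affine_ext \<circ> vertex \<in> X \<rightarrow> topspace D" by (simp add: affine_ext_vertex base_in_dilation)
  \<comment> \<open>The closedness hypothesis on \<open>X\<close> places the whole edge between
    linked points in the dilation.\<close>
  have seg: "path_component (spot_dilation \<epsilon> X) y z" if "{y, z} \<in> linked K" for y z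
    using hull[OF that] by (auto simp: segment_convex_hull path_component_def intro!: exI[of _ "linepath y z"])
  show "(x, y) \<in> comb_pi0_rel K \<longleftrightarrow> ((affine_ext \<circ> vertex) x, (affine_ext \<circ> vertex) y) \<in> path_rel D"
    if "x \<in> X" "y \<in> X" for x y
  proof
    assume "(x, y) \<in> comb_pi0_rel K"
    then have "equivclp (\<lambda>u v. {u, v} \<in> linked K) x y" by (simp add: comb_pi0_rel_def)
    then have "path_component (spot_dilation \<epsilon> X) x y"
    proof (induction rule: equivclp_induct)
      case base
      show ?case using that(1) base_in_dilation by (simp add: path_component_refl)
    next
      case (step y z)
      then show ?case using seg path_component_trans path_component_sym by blast
    qed
    then show "((affine_ext \<circ> vertex) x, (affine_ext \<circ> vertex) y) \<in> path_rel D"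
      by (simp add: path_rel_def affine_ext_vertex)
  qed (use path_component_dilation_imp_comb[OF that] in \<open>simp add: path_rel_def affine_ext_vertex\<close>)
  show "\<exists>x\<in>X. ((affine_ext \<circ> vertex) x, z) \<in> path_rel D" if "z \<in> topspace D" for z
  proof -
    obtain x where x: "x \<in> X" "z \<in> ball x (\<epsilon> / 2)" using \<open>z \<in> topspace D\<close> by (auto simp: spot_dilation_def)
    have "closed_segment x z \<subseteq> ball x (\<epsilon> / 2)"
      using x eps by (intro closed_segment_subset) auto
    then have "path_component (spot_dilation \<epsilon> X) x z"
      unfolding path_component_def using ball_subset_dilation[OF x(1)]
      by (intro exI[of _ "linepath x z"]) auto
    then show ?thesis using x(1) by (auto simp: path_rel_def affine_ext_vertex)
  qed
qed

text \<open>A point of the realisation slides inside its own simplex to any vertex of its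
  support.\<close>

lemma path_component_vertex:
  assumes w: "w \<in> realisation_set K"
  shows "\<exists>y\<in>X. (vertex y, w) \<in> path_rel S"
proof -
  obtain y where y: "y \<in> fsupp w" using realisation_setD(3)[OF K w] by blast
  then have "y \<in> X" using linkage_complexD(2)[OF K realisation_setD(1)[OF K w]] points by blast
  moreover have "path_component_of S (vertex y) w"
    using y realisation_setD(1)[OF K w]
    by (intro path_component_of_realisation[OF K vertex_in_S[OF \<open>y \<in> X\<close>] w]) (simp add: insert_absorb)
  ultimately show ?thesis by (auto simp: path_rel_def)
qed

lemma realisation_points_to_dilation:
  "quot_equiv (topspace S) (path_rel S) affine_ext (topspace D) (path_rel D)"
  unfolding quot_equiv_def
proof (intro conjI ballI)
  note q = quot_equivD[OF points_to_dilation]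
  have sym: "\<And>T p q. (p, q) \<in> path_rel T \<Longrightarrow> (q, p) \<in> path_rel T"
    and trans: "\<And>T p q r. (p, q) \<in> path_rel T \<Longrightarrow> (q, r) \<in> path_rel T \<Longrightarrow> (p, r) \<in> path_rel T"
    using equiv_path_rel unfolding equiv_def by (meson symD, meson transD)
  have push: "(affine_ext w, affine_ext w') \<in> path_rel D" if "(w, w') \<in> path_rel S" for w w'
    using that path_component_of_continuous_image[OF continuous_affine_ext] by (simp add: path_rel_def)
  show "path_rel S \<subseteq> topspace S \<times> topspace S" using equiv_path_rel[of S] by (simp add: equiv_def)
  show "equiv (topspace D) (path_rel D)" by (rule equiv_path_rel)
  show "affine_ext \<in> topspace S \<rightarrow> topspace D"
    using continuous_affine_ext by (auto simp: continuous_map_def)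
  show "(w, w') \<in> path_rel S \<longleftrightarrow> (affine_ext w, affine_ext w') \<in> path_rel D"
    if w: "w \<in> topspace S" "w' \<in> topspace S" for w w'
  proof
    assume r: "(affine_ext w, affine_ext w') \<in> path_rel D"
    obtain y where y: "y \<in> X" "(vertex y, w) \<in> path_rel S" using path_component_vertex[of w] w(1) by auto
    obtain y' where y': "y' \<in> X" "(vertex y', w') \<in> path_rel S" using path_component_vertex[of w'] w(2) by auto
    have "(affine_ext (vertex y), affine_ext (vertex y')) \<in> path_rel D"
      by (rule trans[OF trans[OF push[OF y(2)] r] sym[OF push[OF y'(2)]]])
    then have "equivclp (\<lambda>u v. {u, v} \<in> linked K) y y'"
      using q(4)[OF y(1) y'(1)] by (simp add: comb_pi0_rel_def)
    then have "(vertex y, vertex y') \<in> path_rel S"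
    proof (induction rule: equivclp_induct)
      case base
      show ?case using vertex_in_S[OF y(1)] by (simp add: path_rel_def path_component_of_refl)
    next
      case (step u v)
      have "(vertex u, vertex v) \<in> path_rel S" if "{u, v} \<in> linked K" for u v
        using linkage_complexD(2)[OF K that] points that unfolding path_rel_def
        by (auto intro!: path_component_of_realisation[OF K] vertex_in_S simp: insert_commute)
      then show ?case using step sym trans by meson
    qed
    then show "(w, w') \<in> path_rel S"
      by (rule trans[OF trans[OF sym[OF y(2)]] y'(2)])
  qed (rule push)
  show "\<exists>w\<in>topspace S. (affine_ext w, z) \<in> path_rel D" if "z \<in> topspace D" for z
    using q(5)[OF that] vertex_in_S by auto
qed

lemma points_to_realisation: "quot_equiv X (comb_pi0_rel K) vertex (topspace S) (path_rel S)"
  by (rule quot_equiv_cancel[OF points_to_dilation realisation_points_to_dilation])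
     (simp add: vertex_in_S)

lemma pi0_isos:
  assumes b: "b \<in> X"
  shows "pointed_iso (Phi0 K) (comb_pi0 K) (comb_pi0_rel K `` {b})
      (path_components_of S) (path_component_of_set S (vertex b))"
    and "pointed_iso (top_pi0_map D affine_ext) (path_components_of S) (path_component_of_set S (vertex b))
      (path_components_of D) (path_component_of_set D b)"
    and "pointed_iso (top_pi0_map D affine_ext \<circ> Phi0 K) (comb_pi0 K) (comb_pi0_rel K `` {b})
      (path_components_of D) (path_component_of_set D b)"
proof -
  have c: "comb_pi0 K = X // comb_pi0_rel K" by (simp add: comb_pi0_def points)
  show 1: "pointed_iso (Phi0 K) (comb_pi0 K) (comb_pi0_rel K `` {b})
      (path_components_of S) (path_component_of_set S (vertex b))"
    unfolding Phi0_quot path_components_of_quot c path_rel_class[symmetric]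
    by (rule quot_equiv_pointed_iso[OF points_to_realisation b])
  show 2: "pointed_iso (top_pi0_map D affine_ext) (path_components_of S) (path_component_of_set S (vertex b))
      (path_components_of D) (path_component_of_set D b)"
    unfolding top_pi0_map_quot path_components_of_quot path_rel_class[symmetric]
    using quot_equiv_pointed_iso[OF realisation_points_to_dilation, of "vertex b"] vertex_in_S[OF b]
    by (simp only: affine_ext_vertex topspace_realisation)
  show "pointed_iso (top_pi0_map D affine_ext \<circ> Phi0 K) (comb_pi0 K) (comb_pi0_rel K `` {b})
      (path_components_of D) (path_component_of_set D b)"
    using 1 2 unfolding pointed_iso_def by (auto intro: bij_betw_trans)
qed

end

section \<open>The two complexes of a metric subspace and the inclusion between them\<close>

lemma spot_complex_t_minus:
  assumes "0 < \<epsilon>" "t_minus_closed \<epsilon> X"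
  shows "spot_complex X \<epsilon> (t_minus_complex \<epsilon> X)"
proof
  show "convex hull \<xi> \<subseteq> spot_dilation \<epsilon> X" if "\<xi> \<in> linked (t_minus_complex \<epsilon> X)" for \<xi>
    using that assms(2) by (auto simp: t_minus_closed_def)
qed (use assms linkage_complex_t_minus_complex in \<open>force simp: t_minus_complex_def\<close>)+

lemma spot_complex_t:
  assumes "0 < \<epsilon>" "t_closed \<epsilon> X"
  shows "spot_complex X \<epsilon> (t_complex \<epsilon> X)"
proof
  show "convex hull \<xi> \<subseteq> spot_dilation \<epsilon> X" if "\<xi> \<in> linked (t_complex \<epsilon> X)" for \<xi>
    using that assms(2) by (auto simp: t_closed_def)
qed (use assms linkage_complex_t_complex in \<open>force simp: t_complex_def intro: less_imp_le\<close>)+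

text \<open>Both complexes share \<open>X\<close> and \<epsilon> and map to the same dilation by the
  same formula. Cancelling this common comparison, with the identity as first map, yields the
  vertical arrows.\<close>

locale spot_complex_pair = L: spot_complex X \<epsilon> L + K: spot_complex X \<epsilon> K
  for X :: "'a::real_normed_vector set" and \<epsilon> L K +
  assumes linked_mono: "linked L \<subseteq> linked K"
begin

text \<open>Continuity is tested on simplices, and a simplex of \<open>L\<close> is literally a
  simplex of \<open>K\<close> by \<open>realisation_set_iff\<close>.\<close>

lemma continuous_inclusion: "continuous_map (realisation L) (realisation K) (\<lambda>w. w)"
proof (rule continuous_map_from_realisation)
  show "(\<lambda>w. w) \<in> realisation_set L \<rightarrow> topspace (realisation K)"
    using linked_mono by (auto simp: realisation_set_def)
  fix \<xi> assume \<xi>: "\<xi> \<in> linked L"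
  then have \<xi>': "\<xi> \<in> linked K" using linked_mono by blast
  have "simplex_of L \<xi> = simplex_of K \<xi>"
    unfolding simplex_of_def realisation_set_iff[OF L.K \<xi>] realisation_set_iff[OF K.K \<xi>'] ..
  then have "simplex_topology L \<xi> = simplex_topology K \<xi>" by (simp add: simplex_topology_def)
  then show "continuous_map (simplex_topology L \<xi>) (realisation K) (\<lambda>w. w)"
    using simplex_topology_into_realisation[OF \<xi>'] by simp
qed

lemma realisation_map_id_eq: "realisation_map id = id"
  by (simp add: fun_eq_iff realisation_map_id)

lemma comp_id_eq: "(\<circ>) id = id"
  by (simp add: fun_eq_iff)

lemma comb_loops_mono: "comb_loops L b \<subseteq> comb_loops K b"
  unfolding subset_iff comb_loops_iff[OF L.K] comb_loops_iff[OF K.K] using linked_mono by blast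

lemma top_loops_mono: "top_loops (realisation L) v \<subseteq> top_loops (realisation K) v"
  using compose_in_top_loops[OF continuous_inclusion] by (auto simp: o_def)

lemma comb_inclusion:
  assumes "b \<in> X"
  shows "quot_equiv (comb_loops L b) (comb_loop_rel L b) id (comb_loops K b) (comb_loop_rel K b)"
  by (rule quot_equiv_cancel[OF _ K.comb_to_dilation[OF assms]])
     (use L.comb_to_dilation[OF assms] comb_loops_mono[of b] in auto)

lemma realisation_inclusion:
  assumes "b \<in> X"
  shows "quot_equiv (top_loops (realisation L) (vertex b)) (top_loop_rel (realisation L) (vertex b)) id
    (top_loops (realisation K) (vertex b)) (top_loop_rel (realisation K) (vertex b))"
  by (rule quot_equiv_cancel[OF _ K.realisation_to_dilation[OF assms]])
     (use L.realisation_to_dilation[OF assms] top_loops_mono[of "vertex b"] in auto)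

lemma points_inclusion: "quot_equiv X (comb_pi0_rel L) id X (comb_pi0_rel K)"
  by (rule quot_equiv_cancel[OF _ K.points_to_dilation]) (use L.points_to_dilation in auto)

lemma realisation_points_inclusion:
  "quot_equiv (topspace (realisation L)) (path_rel (realisation L)) id
    (topspace (realisation K)) (path_rel (realisation K))"
  by (rule quot_equiv_cancel[OF _ K.realisation_points_to_dilation])
     (use L.realisation_points_to_dilation linked_mono in \<open>auto simp: realisation_set_def\<close>)

lemma pi1_inclusion_isos:
  assumes b: "b \<in> X"
  shows "group_iso (comb_pi1_map K b id) (comb_pi1 L b) (comb_pi1 K b)"
    and "group_iso (top_pi1_map (realisation K) (vertex b) (realisation_map id))
      (top_pi1 (realisation L) (vertex b)) (top_pi1 (realisation K) (vertex b))"
proof -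
  show "group_iso (comb_pi1_map K b id) (comb_pi1 L b) (comb_pi1 K b)"
    unfolding comb_pi1_map_quot comb_pi1_quot comp_id_eq
  proof (rule quot_group_iso[OF comb_inclusion[OF b] L.quot_group_comb[OF b] K.quot_group_comb[OF b]])
    fix a a' assume "a \<in> comb_loops L b" "a' \<in> comb_loops L b"
    then have "loop_sum b a a' \<in> comb_loops K b"
      using loop_sum_in_comb_loops[OF K.K] comb_loops_mono by blast
    then show "(id (loop_sum b a a'), loop_sum b (id a) (id a')) \<in> comb_loop_rel K b"
      using K.quot_group_comb[OF b] by (auto simp: quot_group_def equiv_def refl_on_def)
  qed
  show "group_iso (top_pi1_map (realisation K) (vertex b) (realisation_map id))
      (top_pi1 (realisation L) (vertex b)) (top_pi1 (realisation K) (vertex b))"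
    unfolding top_pi1_map_quot top_pi1_quot realisation_map_id_eq comp_id_eq
  proof (rule quot_group_iso[OF realisation_inclusion[OF b] L.quot_group_realisation[OF b]
        K.quot_group_realisation[OF b]])
    fix p q assume "p \<in> top_loops (realisation L) (vertex b)" "q \<in> top_loops (realisation L) (vertex b)"
    then have "p +++ q \<in> top_loops (realisation K) (vertex b)"
      using join_in_top_loops top_loops_mono by blast
    then show "(id (p +++ q), id p +++ id q) \<in> top_loop_rel (realisation K) (vertex b)"
      using equiv_top_loop_rel[of "realisation K" "vertex b"] by (auto simp: equiv_def refl_on_def)
  qed
qed

text \<open>All arrows are instances of \<open>quot_map\<close>, so \<open>quot_map_comp\<close>
  reduces each square to representatives, where the vertical arrows are the identity.\<close>

lemma pi1_squares:
  assumes b: "b \<in> X"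
  shows "A \<in> carrier (comb_pi1 L b) \<Longrightarrow> Phi1 K b (comb_pi1_map K b id A) =
      top_pi1_map (realisation K) (vertex b) (realisation_map id) (Phi1 L b A)"
    and "P \<in> carrier (top_pi1 (realisation L) (vertex b)) \<Longrightarrow>
      top_pi1_map K.D b affine_ext (top_pi1_map (realisation K) (vertex b) (realisation_map id) P) =
      top_pi1_map K.D b affine_ext P"
  unfolding Phi1_quot comb_pi1_map_quot top_pi1_map_quot realisation_map_id_eq comp_id_eq
    comb_pi1_quot top_pi1_quot quot_monoid_def
  by (simp_all add: quot_map_comp[OF comb_inclusion[OF b] K.comb_to_realisation[OF b]]
      quot_map_comp[OF L.comb_to_realisation[OF b] realisation_inclusion[OF b]]
      quot_map_comp[OF realisation_inclusion[OF b] K.realisation_to_dilation[OF b]])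

lemma pi0_inclusion_isos:
  assumes b: "b \<in> X"
  shows "pointed_iso (comb_pi0_map K id) (comb_pi0 L) (comb_pi0_rel L `` {b}) (comb_pi0 K) (comb_pi0_rel K `` {b})"
    and "pointed_iso (top_pi0_map (realisation K) (realisation_map id))
      (path_components_of (realisation L)) (path_component_of_set (realisation L) (vertex b))
      (path_components_of (realisation K)) (path_component_of_set (realisation K) (vertex b))"
  using quot_equiv_pointed_iso[OF points_inclusion b]
    quot_equiv_pointed_iso[OF realisation_points_inclusion, of "vertex b"] L.vertex_in_S[OF b]
  by (simp_all add: comb_pi0_map_quot comb_pi0_def L.points K.points top_pi0_map_quot
      path_components_of_quot realisation_map_id_eq path_rel_class)

lemma pi0_squares:
  shows "A \<in> comb_pi0 L \<Longrightarrow> Phi0 K (comb_pi0_map K id A) =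
      top_pi0_map (realisation K) (realisation_map id) (Phi0 L A)"
    and "C \<in> path_components_of (realisation L) \<Longrightarrow>
      top_pi0_map K.D affine_ext (top_pi0_map (realisation K) (realisation_map id) C) =
      top_pi0_map K.D affine_ext C"
  unfolding Phi0_quot comb_pi0_map_quot top_pi0_map_quot realisation_map_id_eq
    path_components_of_quot comb_pi0_def L.points
  by (simp_all add: quot_map_comp[OF points_inclusion K.points_to_realisation]
      quot_map_comp[OF L.points_to_realisation realisation_points_inclusion]
      quot_map_comp[OF realisation_points_inclusion K.realisation_points_to_dilation]
      del: topspace_realisation)

end

theorem mainTheorem3:
  fixes X :: "'a::real_normed_vector set" and x0 :: 'a and \<epsilon> :: real
  defines "K\<^sub>m \<equiv> t_minus_complex \<epsilon> X"
    and "K \<equiv> t_complex \<epsilon> X"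
    and "D \<equiv> top_of_set (spot_dilation \<epsilon> X)"
  assumes "x0 \<in> X" and "0 < \<epsilon>" and "t_minus_closed \<epsilon> X"
  shows
    "(\<comment> \<open>(a), \<open>\<pi>\<^sub>1\<close>\<close>
      group_iso (Phi1 K\<^sub>m x0) (comb_pi1 K\<^sub>m x0) (top_pi1 (realisation K\<^sub>m) (vertex x0)) \<and>
      group_iso (top_pi1_map D x0 affine_ext)
        (top_pi1 (realisation K\<^sub>m) (vertex x0)) (top_pi1 D x0) \<and>
      group_iso (top_pi1_map D x0 affine_ext \<circ> Phi1 K\<^sub>m x0) (comb_pi1 K\<^sub>m x0) (top_pi1 D x0) \<and>
      \<comment> \<open>(a), \<open>\<pi>\<^sub>0\<close>\<close>
      pointed_iso (Phi0 K\<^sub>m)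
        (comb_pi0 K\<^sub>m) (comb_pi0_rel K\<^sub>m `` {x0})
        (path_components_of (realisation K\<^sub>m)) (path_component_of_set (realisation K\<^sub>m) (vertex x0)) \<and>
      pointed_iso (top_pi0_map D affine_ext)
        (path_components_of (realisation K\<^sub>m)) (path_component_of_set (realisation K\<^sub>m) (vertex x0))
        (path_components_of D) (path_component_of_set D x0) \<and>
      pointed_iso (top_pi0_map D affine_ext \<circ> Phi0 K\<^sub>m)
        (comb_pi0 K\<^sub>m) (comb_pi0_rel K\<^sub>m `` {x0})
        (path_components_of D) (path_component_of_set D x0))
     \<and>
     (t_closed \<epsilon> X \<longrightarrow>
      \<comment> \<open>(b), \<open>\<pi>\<^sub>1\<close>: the lower row, the vertical arrows, the two squares\<close>
      group_iso (Phi1 K x0) (comb_pi1 K x0) (top_pi1 (realisation K) (vertex x0)) \<and>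
      group_iso (top_pi1_map D x0 affine_ext)
        (top_pi1 (realisation K) (vertex x0)) (top_pi1 D x0) \<and>
      group_iso (top_pi1_map D x0 affine_ext \<circ> Phi1 K x0) (comb_pi1 K x0) (top_pi1 D x0) \<and>
      group_iso (comb_pi1_map K x0 id) (comb_pi1 K\<^sub>m x0) (comb_pi1 K x0) \<and>
      group_iso (top_pi1_map (realisation K) (vertex x0) (realisation_map id))
        (top_pi1 (realisation K\<^sub>m) (vertex x0)) (top_pi1 (realisation K) (vertex x0)) \<and>
      (\<forall>A\<in>carrier (comb_pi1 K\<^sub>m x0).
         Phi1 K x0 (comb_pi1_map K x0 id A) =
         top_pi1_map (realisation K) (vertex x0) (realisation_map id) (Phi1 K\<^sub>m x0 A)) \<and>
      (\<forall>P\<in>carrier (top_pi1 (realisation K\<^sub>m) (vertex x0)).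
         top_pi1_map D x0 affine_ext
           (top_pi1_map (realisation K) (vertex x0) (realisation_map id) P) =
         top_pi1_map D x0 affine_ext P) \<and>
      \<comment> \<open>(b), \<open>\<pi>\<^sub>0\<close>: the lower row, the vertical arrows, the two squares\<close>
      pointed_iso (Phi0 K)
        (comb_pi0 K) (comb_pi0_rel K `` {x0})
        (path_components_of (realisation K)) (path_component_of_set (realisation K) (vertex x0)) \<and>
      pointed_iso (top_pi0_map D affine_ext)
        (path_components_of (realisation K)) (path_component_of_set (realisation K) (vertex x0))
        (path_components_of D) (path_component_of_set D x0) \<and>
      pointed_iso (top_pi0_map D affine_ext \<circ> Phi0 K)
        (comb_pi0 K) (comb_pi0_rel K `` {x0})
        (path_components_of D) (path_component_of_set D x0) \<and>
      pointed_iso (comb_pi0_map K id)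
        (comb_pi0 K\<^sub>m) (comb_pi0_rel K\<^sub>m `` {x0})
        (comb_pi0 K) (comb_pi0_rel K `` {x0}) \<and>
      pointed_iso (top_pi0_map (realisation K) (realisation_map id))
        (path_components_of (realisation K\<^sub>m)) (path_component_of_set (realisation K\<^sub>m) (vertex x0))
        (path_components_of (realisation K)) (path_component_of_set (realisation K) (vertex x0)) \<and>
      (\<forall>A\<in>comb_pi0 K\<^sub>m.
         Phi0 K (comb_pi0_map K id A) =
         top_pi0_map (realisation K) (realisation_map id) (Phi0 K\<^sub>m A)) \<and>
      (\<forall>C\<in>path_components_of (realisation K\<^sub>m).
         top_pi0_map D affine_ext (top_pi0_map (realisation K) (realisation_map id) C) =
         top_pi0_map D affine_ext C))"
proof -
  have m: "spot_complex X \<epsilon> K\<^sub>m"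
    unfolding K\<^sub>m_def using assms by (intro spot_complex_t_minus)
  have p: "spot_complex_pair X \<epsilon> K\<^sub>m K" if "t_closed \<epsilon> X"
  proof (intro spot_complex_pair.intro spot_complex_pair_axioms.intro m)
    show "spot_complex X \<epsilon> K"
      unfolding K_def using assms that by (intro spot_complex_t)
    show "linked K\<^sub>m \<subseteq> linked K"
      by (force simp: K\<^sub>m_def K_def t_minus_complex_def t_complex_def intro: less_imp_le)
  qed
  note m_isos = spot_complex.pi1_isos[OF m \<open>x0 \<in> X\<close>, folded D_def]
    spot_complex.pi0_isos[OF m \<open>x0 \<in> X\<close>, folded D_def]
  \<comment> \<open>From here on the facts about \<open>K\<close> carry \<open>t_closed\<close> as a
    premise, which is met after \<open>impI\<close> in part (b).\<close>
  note k = spot_complex_pair.axioms(2)[OF p]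
  note k_isos = spot_complex.pi1_isos[OF k \<open>x0 \<in> X\<close>, folded D_def]
    spot_complex.pi0_isos[OF k \<open>x0 \<in> X\<close>, folded D_def]
  note pair = spot_complex_pair.pi1_inclusion_isos[OF p \<open>x0 \<in> X\<close>]
    spot_complex_pair.pi1_squares[OF p \<open>x0 \<in> X\<close>, folded D_def]
    spot_complex_pair.pi0_inclusion_isos[OF p \<open>x0 \<in> X\<close>]
    spot_complex_pair.pi0_squares[OF p, folded D_def]
  show ?thesis
    by (intro conjI impI ballI m_isos k_isos pair)
qed

end
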